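(* Let $\mathcal Z_\nu$ be the Zorich map described in the context with $\lambda>L^5$ and $\nu>\sqrt{2L/\lambda}$. Then the periodic points of $\mathcal Z_\nu$ are dense in $\mathbb R^3$.
   Context: Zorich maps. Let $Q=\{(x_1,x_2)\in\mathbb R^2:|x_1|\le1,|x_2|\le1\}$. Let $L\ge1$ and let $\mathfrak h=(\mathfrak h_1,\mathfrak h_2,\mathfrak h_3)$ be a sense-preserving $L$-bi-Lipschitz map (i.e. $|a-b|/L\le|\mathfrak h(a)-\mathfrak h(b)|\le L|a-b|$) of $Q$ onto the closed upper unit hemisphere $\{x\in\mathbb R^3:|x|=1,x_3\ge0\}$, with $\partial Q$ mapped onto the equator. Assume $\mathfrak h_1(t,t)=\mathfrak h_2(t,t)$ and $\mathfrak h_1(t,-t)=-\mathfrak h_2(t,-t)$ for $t\in[-1,1]$ (so $\mathfrak h(0,0)=(0,0,1)$). Let $\lambda\ge1$ and $h(x_1,x_2)=\lambda\mathfrak h(x_1/\lambda,x_2/\lambda)$ on $\lambda Q=[-\lambda,\lambda]^2$. For $\nu>0$ set $\mathcal Z_\nu(x_1,x_2,x_3)=\nu e^{x_3}h(x_1,x_2)$ on $\lambda Q\times\mathbb R$ (which is mapped onto $\{x_3\ge0\}$), and extend $\mathcal Z_\nu$ to $\mathbb R^3$ by repeated reflection: in the domain across the faces $x_1=(2k+1)\lambda$, $x_2=(2k+1)\lambda$ ($k\in\mathbb Z$) of the beams, and in the range across the plane $x_3=0$. The resulting $\mathcal Z_\nu:\mathbb R^3\to\mathbb R^3$ is quasiregular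 with an essential singularity at infinity. *)

theory Defs
  imports "HOL-Complex_Analysis.Complex_Analysis"
begin

definition sqQ :: "(real \<times> real) set" where
  "sqQ = {x. \<bar>fst x\<bar> \<le> 1 \<and> \<bar>snd x\<bar> \<le> 1}"

text \<open>Closed upper unit hemisphere and equator in R^3 (triples; product norm is Euclidean).\<close>
definition upper_hemisphere :: "(real \<times> real \<times> real) set" where
  "upper_hemisphere = {x. norm x = 1 \<and> snd (snd x) \<ge> 0}"

definition equator :: "(real \<times> real \<times> real) set" where
  "equator = {x. norm x = 1 \<and> snd (snd x) = 0}"

definition bi_lipschitz_on :: "real \<Rightarrow> ('a::metric_space) set \<Rightarrow> ('a \<Rightarrow> 'b::metric_space) \<Rightarrow> bool" where
  "bi_lipschitz_on L S f \<longleftrightarrow>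
     (\<forall>a\<in>S. \<forall>b\<in>S. dist a b / L \<le> dist (f a) (f b) \<and> dist (f a) (f b) \<le> L * dist a b)"

definition sq_boundary :: "real \<Rightarrow> complex" where
  "sq_boundary = linepath (Complex (-1) (-1)) (Complex 1 (-1)) +++
                 linepath (Complex 1 (-1)) (Complex 1 1) +++
                 linepath (Complex 1 1) (Complex (-1) 1) +++
                 linepath (Complex (-1) 1) (Complex (-1) (-1))"

text \<open>Sense-preserving for a homeomorphism of Q onto the upper hemisphere (hemisphere oriented
  by its outward normal): composed with the vertical projection onto the unit disc (viewed in C)
  it is a sense-preserving planar homeomorphism, i.e. the image of the positively oriented
  boundary winds once positively around the image of an interior point (the centre).\<close>
definition hemi_proj :: "((real \<times> real) \<Rightarrow> (real \<times> real \<times> real)) \<Rightarrow> complex \<Rightarrow> complex" where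
  "hemi_proj hh z = Complex (fst (hh (Re z, Im z))) (fst (snd (hh (Re z, Im z))))"

definition sense_preserving_hemi :: "((real \<times> real) \<Rightarrow> (real \<times> real \<times> real)) \<Rightarrow> bool" where
  "sense_preserving_hemi hh \<longleftrightarrow>
     winding_number (hemi_proj hh \<circ> sq_boundary) (hemi_proj hh 0) = 1"

text \<open>Reflection data on the line: t lies in [(2k-1)lam,(2k+1)lam); folded coordinate.\<close>
definition beam_index :: "real \<Rightarrow> real \<Rightarrow> int" where
  "beam_index lam t = \<lfloor>(t + lam) / (2 * lam)\<rfloor>"

definition fold_coord :: "real \<Rightarrow> real \<Rightarrow> real" where
  "fold_coord lam t = (if even (beam_index lam t) then 1 else -1) * (t - 2 * of_int (beam_index lam t) * lam)"

text \<open>The Zorich map Z_nu: on the beam lam Q x R it is nu e^{x3} h(x1,x2) with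
  h(x1,x2) = lam * hh(x1/lam, x2/lam); extended to R^3 by repeated reflection across the faces
  x1 = (2k+1) lam, x2 = (2k+1) lam in the domain and across x3 = 0 in the range.\<close>
definition zorich :: "((real \<times> real) \<Rightarrow> (real \<times> real \<times> real)) \<Rightarrow> real \<Rightarrow> real
    \<Rightarrow> (real \<times> real \<times> real) \<Rightarrow> (real \<times> real \<times> real)" where
  "zorich hh lam nu x =
    (let x1 = fst x; x2 = fst (snd x); x3 = snd (snd x);
         k = beam_index lam x1; m = beam_index lam x2;
         v = (nu * exp x3 * lam) *\<^sub>R hh (fold_coord lam x1 / lam, fold_coord lam x2 / lam)
     in if even (k + m) then v else (fst v, fst (snd v), - snd (snd v)))"

definition periodic_point :: "('a \<Rightarrow> 'a) \<Rightarrow> 'a \<Rightarrow> bool" where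
  "periodic_point f x \<longleftrightarrow> (\<exists>n::nat. n \<ge> 1 \<and> (f ^^ n) x = x)"

end

theory Submission
  imports Defs
begin

text \<open>Write the Zorich map as \<open>F x = nu * lam * exp x\<^sub>3 * H (x\<^sub>1, x\<^sub>2)\<close> with \<open>H\<close> of norm one.
  The union \<open>P\<close> of the planes \<open>x\<^sub>1 = \<plusminus>x\<^sub>2\<close> is forward invariant and contains all images of the branch set.
  Its preimage cuts space into square beams over tiles, each mapped homeomorphically onto a component
  of the complement of \<open>P\<close>.

  If no iterate of a ball met this preimage, all iterates would be injective on the ball. The measure
  with density \<open>\<rho>\<^sup>-\<^sup>3\<close>, where \<open>\<rho>\<close> is the distance to the \<open>x\<^sub>3\<close>-axis, is expanded at least by
  the factor \<open>lam / L ^ 5 > 1\<close>, whereas the part of each iterated ball above a given height has bounded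
  volume: slices at height \<open>t\<close> are spread over shells of radius about \<open>exp t\<close>, of which a beam contains
  only little. By Borel--Cantelli almost every orbit in the ball is attracted to the axis, which is
  absurd, since the axis repels. Inside \<open>P\<close> a similar count for areas, with expansion factor
  \<open>nu\<^sup>2 * lam / L > 2\<close>, shows that every open set contains a point that is eventually mapped
  into the positive \<open>x\<^sub>3\<close>-axis.

  Along this axis inverse branches on closed quadrants contract strongly, so some inverse branch maps a
  large piece of a closed quadrant into a given ball. Two further iterates map this piece over the ball,
  and Brouwer's theorem yields a periodic point in the ball.\<close>

section \<open>Volume expansion without derivatives\<close>

text \<open>Origin of \<open>lam / L ^ 5\<close>: the inverse of \<open>H\<close> on a beam has
  Lipschitz constant \<open>lam * L\<close>, while the vertical direction loses nothing, so wherever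
  a Jacobian exists it is at least \<open>norm (F x) ^ 3 / (lam * L)\<^sup>2\<close>. This is tiny
  at low heights, so plain volume need not grow. But
  \<open>rho (F x) \<le> L / lam * norm (F x) * rho x\<close>, where \<open>rho\<close> is the
  distance to the axis; raised to the power 3, the dimension, this cancels
  \<open>norm (F x) ^ 3\<close> and leaves \<open>lam / L ^ 5\<close> at every height. The obstacle
  at the end is that an orbit which reaches the axis may have passed through branch points, where
  \<open>F\<close> has no local inverse. Still, \<open>F\<close> is injective on every closed beam
  over a tile, and a closed quadrant is a union of such beams, so inverse branches can be composed
  one-sidedly.\<close>

type_synonym R3 = "real \<times> real \<times> real"

abbreviation ht :: "R3 \<Rightarrow> real" where "ht x \<equiv> snd (snd x)"
abbreviation base :: "R3 \<Rightarrow> real \<times> real" where "base x \<equiv> (fst x, fst (snd x))"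
abbreviation vol :: "'a::euclidean_space set \<Rightarrow> ennreal" where "vol \<equiv> emeasure lborel"

text \<open>The set is an ellipsoid, the preimage of a ball under the linear map that stretches
  direction \<open>e\<close> by \<open>k\<close>. Its factor \<open>1 / k\<close> becomes the gain
  \<open>k\<close> in the hypothesis \<open>fg\<close> of the expansion theorem.\<close>

lemma emeasure_scaled_cball:
  fixes e :: "'a::euclidean_space" and k r :: real
  assumes e: "e \<in> Basis" and k: "k > 0" and r: "r \<ge> 0"
  shows "vol {y. norm (y + ((k - 1) * (y \<bullet> e)) *\<^sub>R e - c) \<le> r}
       = ennreal (unit_ball_vol (DIM('a)) * r ^ DIM('a) / k)"
proof -
  define cf where "cf = (\<lambda>j::'a. if j = e then 1/k else 1)"
  \<comment> \<open>\<open>T\<close> inverts the stretching, in the coordinatewise form required by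
    the affine change of variables.\<close>
  define T where "T = (\<lambda>x::'a. 0 + (\<Sum>j\<in>Basis. (cf j * (x \<bullet> j)) *\<^sub>R j))"
  have Tb: "T x \<bullet> j = cf j * (x \<bullet> j)" if "j \<in> Basis" for x j
    using that unfolding T_def by (simp add: inner_sum_left_Basis)
  have L: "lborel = density (distr lborel borel T) (\<lambda>_. (\<Prod>j\<in>Basis. \<bar>cf j\<bar>))"
    unfolding T_def by (rule lborel_affine_euclidean) (use k in \<open>auto simp: cf_def\<close>)
  have P: "(\<Prod>j\<in>(Basis::'a set). \<bar>cf j\<bar>) = 1 / k"
    using e k by (subst prod.remove[OF _ e]) (auto simp: cf_def)
  let ?E = "{y. norm (y + ((k - 1) * (y \<bullet> e)) *\<^sub>R e - c) \<le> r}"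
  have cl: "closed ?E" by (intro closed_Collect_le continuous_intros)
  have "T x + ((k - 1) * (T x \<bullet> e)) *\<^sub>R e = x" for x
  proof (rule euclidean_eqI)
    fix b :: 'a assume b: "b \<in> Basis"
    show "(T x + ((k - 1) * (T x \<bullet> e)) *\<^sub>R e) \<bullet> b = x \<bullet> b"
      using k by (simp add: inner_add_left Tb[OF b] Tb[OF e] inner_Basis[OF e b] cf_def field_simps)
  qed
  then have V: "T -` ?E = cball c r" by (auto simp: dist_norm norm_minus_commute)
  have Tm: "T \<in> borel_measurable lborel" unfolding T_def by measurable
  have "vol ?E = (1/k) * emeasure (distr lborel borel T) ?E"
    using cl by (subst L, subst emeasure_density) (simp_all add: P nn_integral_cmult)
  also have "emeasure (distr lborel borel T) ?E = vol (T -` ?E \<inter> space lborel)"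
    by (rule emeasure_distr) (use Tm cl in auto)
  also have "\<dots> = vol (cball c r)"
    unfolding V by simp
  also have "ennreal (1/k) * \<dots> = ennreal (unit_ball_vol (DIM('a)) * r ^ DIM('a) / k)"
    using k r by (simp add: emeasure_cball ennreal_mult[symmetric] unit_ball_vol_nonneg)
  finally show ?thesis .
qed

text \<open>Local comparisons by continuity cost a factor \<open>c > 1\<close>; letting
  \<open>c\<close> tend to 1 removes the loss.\<close>

lemma ennreal_le_if_le_mult_powers:
  fixes a b :: ennreal and m :: nat
  assumes le: "\<And>c::real. c > 1 \<Longrightarrow> a \<le> ennreal (c ^ m) * b"
  shows "a \<le> b"
proof (cases b)
  case (real b')
  have "(\<lambda>n. ennreal ((1 + 1 / real (Suc n)) ^ m * b')) \<longlonglongrightarrow> ennreal ((1 + 0) ^ m * b')"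
    by (intro tendsto_ennrealI tendsto_intros LIMSEQ_Suc[OF lim_1_over_n])
  moreover have "a \<le> ennreal ((1 + 1 / real (Suc n)) ^ m * b')" for n
    using le[of "1 + 1 / real (Suc n)"] real by (simp add: ennreal_mult)
  ultimately have "a \<le> ennreal ((1 + 0) ^ m * b')"
    by (intro LIMSEQ_le_const[where a = a]) blast+
  then show ?thesis using real by simp
qed simp

text \<open>The estimate \<open>est\<close> replaces the Jacobian: after stretching the direction \<open>e\<close> by \<open>k\<close>, the
  inverse of \<open>F\<close> is pointwise Lipschitz with constant \<open>C / norm (F x)\<close>. Covering the image by balls
  (Vitali) loses nothing in the constant, which matters since the inequality is iterated.\<close>

theorem expansion_nn_integral_le:
  fixes F :: "'a::euclidean_space \<Rightarrow> 'a" and e :: 'a and f g :: "'a \<Rightarrow> real" and k C :: real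
  assumes e: "e \<in> Basis" and k: "k > 0" and C: "C > 0"
    and A: "open A" and contF: "continuous_on A F" and inj: "inj_on F A"
    and f: "continuous_on A f" and g: "continuous_on (F ` A) g"
    and fpos: "\<And>x. x \<in> A \<Longrightarrow> f x > 0" and gpos: "\<And>x. x \<in> A \<Longrightarrow> g (F x) > 0"
    and nz: "\<And>x. x \<in> A \<Longrightarrow> F x \<noteq> 0"
    and est: "\<And>x. x \<in> A \<Longrightarrow> \<exists>\<delta>>0. \<forall>y\<in>A. dist x y < \<delta> \<longrightarrow>
       norm (y - x + ((k - 1) * ((y - x) \<bullet> e)) *\<^sub>R e) * sqrt (norm (F x) * norm (F y)) \<le> C * dist (F x) (F y)"
    and fg: "\<And>x. x \<in> A \<Longrightarrow> f x * C ^ DIM('a) \<le> k * norm (F x) ^ DIM('a) * g (F x)"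
  shows "(\<integral>\<^sup>+x\<in>A. ennreal (f x) \<partial>lborel) \<le> (\<integral>\<^sup>+p\<in>F ` A. ennreal (g p) \<partial>lborel)"
proof -
  let ?d = "DIM('a)" and ?V = "unit_ball_vol (real DIM('a))"
  define S where "S = (\<lambda>w::'a. w + ((k - 1) * (w \<bullet> e)) *\<^sub>R e)"
  define E where "E = F ` A"
  define X where "X = (\<lambda>i::'a \<times> real. A \<inter> F -` ball (fst i) (snd i))"
  define M1 where "M1 = density lborel (\<lambda>x. ennreal (indicator A x * f x))"
  define M2 where "M2 = density lborel (\<lambda>x. ennreal (indicator E x * g x))"
  have E: "open E" unfolding E_def by (rule invariance_of_domain[OF contF A inj])
  have Xo: "open (X i)" for i
    unfolding X_def by (rule continuous_open_preimage[OF contF A]) simp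
  have [measurable]: "(\<lambda>x. indicator A x * f x) \<in> borel_measurable borel"
    using A borel_measurable_continuous_on_indicator[OF _ f] by simp
  have [measurable]: "(\<lambda>x. indicator E x * g x) \<in> borel_measurable borel"
    using E borel_measurable_continuous_on_indicator[of E g] g by (simp add: E_def)
  have sM[simp]: "sets M1 = sets borel" "sets M2 = sets borel" by (auto simp: M1_def M2_def)
  \<comment> \<open>No direction is collapsed by the stretching. Hence the inverse of
    \<open>F\<close> is pointwise Lipschitz in the usual norm and preserves null sets.\<close>
  have Slow: "min 1 k * norm w \<le> norm (S w)" for w
  proof -
    define h where "h = w - (w \<bullet> e) *\<^sub>R e"
    have ee: "e \<bullet> e = 1" using e by (simp add: inner_Basis)
    have he: "h \<bullet> e = 0" using ee by (simp add: h_def inner_diff_left)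
    have 1: "S w = h + (k * (w \<bullet> e)) *\<^sub>R e" "w = h + (w \<bullet> e) *\<^sub>R e"
      by (auto simp: S_def h_def algebra_simps)
    have pyth: "norm (h + t *\<^sub>R e) ^ 2 = norm h ^ 2 + t ^ 2" for t
      unfolding power2_norm_eq_inner using he ee by (simp add: inner_simps inner_commute power2_eq_square)
    have m: "(min 1 k)\<^sup>2 \<le> 1" "(min 1 k)\<^sup>2 \<le> k\<^sup>2" using k by (auto simp: power_le_one power_mono)
    have "(min 1 k * norm w)\<^sup>2 = (min 1 k)\<^sup>2 * (norm h ^ 2 + (w \<bullet> e)\<^sup>2)"
      using pyth[of "w \<bullet> e"] 1(2) by (simp add: power_mult_distrib)
    also have "\<dots> \<le> norm h ^ 2 + k\<^sup>2 * (w \<bullet> e)\<^sup>2"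
      using mult_right_mono[OF m(1), of "(norm h)\<^sup>2"] mult_right_mono[OF m(2), of "(w \<bullet> e)\<^sup>2"]
      by (simp add: algebra_simps)
    also have "\<dots> = norm (S w) ^ 2" using pyth[of "k * (w \<bullet> e)"] 1(1) by (simp add: power_mult_distrib)
    finally show ?thesis by (rule power2_le_imp_le) simp
  qed
  have local: "\<exists>r0>0. ball (F x) r0 \<subseteq> E \<and> (\<forall>y\<in>A. dist (F x) (F y) < r0 \<longrightarrow>
       f y \<le> c * f x \<and> g (F x) \<le> c * g (F y) \<and> norm (S (y - x)) \<le> C * c / norm (F x) * dist (F x) (F y))"
    if x: "x \<in> A" and c: "c > 1" for x c
  proof -
    obtain \<delta> where \<delta>: "\<delta> > 0" "\<And>y. y \<in> A \<Longrightarrow> dist x y < \<delta> \<Longrightarrow>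
       norm (S (y - x)) * sqrt (norm (F x) * norm (F y)) \<le> C * dist (F x) (F y)"
      using est[OF x] unfolding S_def by blast
    have "f x < c * f x" using fpos[OF x] c by simp
    then obtain \<delta>1 where \<delta>1: "\<delta>1 > 0" "\<And>y. y \<in> A \<Longrightarrow> dist y x < \<delta>1 \<Longrightarrow> dist (f y) (f x) < c * f x - f x"
      using f x unfolding continuous_on_iff by (metis diff_gt_0_iff_gt)
    have "g (F x) - g (F x) / c > 0" using gpos[OF x] c by (simp add: field_simps)
    then obtain r1 where r1: "r1 > 0" "\<And>y. y \<in> A \<Longrightarrow> dist (F y) (F x) < r1 \<Longrightarrow> dist (g (F y)) (g (F x)) < g (F x) - g (F x) / c"
      using g x unfolding continuous_on_iff by (metis imageI)
    \<comment> \<open>By invariance of domain and injectivity, a point whose image is close to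
      \<open>F x\<close> is itself close to \<open>x\<close>. This turns \<open>est\<close>, which
      is local in the domain, into a statement about balls in the range.\<close>
    define W where "W = F ` (A \<inter> ball x (min \<delta> \<delta>1))"
    have "open W" unfolding W_def
      by (rule invariance_of_domain) (use A contF inj in \<open>auto intro: continuous_on_subset inj_on_subset\<close>)
    moreover have "F x \<in> W" unfolding W_def using x \<delta>(1) \<delta>1(1) by auto
    ultimately obtain r2 where r2: "r2 > 0" "ball (F x) r2 \<subseteq> W" by (meson openE)
    \<comment> \<open>With this radius \<open>norm (F y) \<ge> norm (F x) / c ^ 2\<close>, so the
      geometric mean in \<open>est\<close> is at least \<open>norm (F x) / c\<close>.\<close>
    define r3 where "r3 = norm (F x) * (1 - 1 / c ^ 2)"
    have r3: "r3 > 0" using c nz[OF x] by (auto simp: r3_def one_less_power)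
    show ?thesis
    proof (intro exI[of _ "min r1 (min r2 r3)"] conjI ballI impI)
      show "min r1 (min r2 r3) > 0" using r1 r2 r3 by simp
      show "ball (F x) (min r1 (min r2 r3)) \<subseteq> E" using r2(2) by (auto simp: W_def E_def)
      fix y assume y: "y \<in> A" and d: "dist (F x) (F y) < min r1 (min r2 r3)"
      then have "F y \<in> W" using r2(2) by auto
      then obtain y' where y': "F y' = F y" "y' \<in> A" "dist x y' < min \<delta> \<delta>1" unfolding W_def by auto
      then have [simp]: "y' = y" using inj y by (meson inj_onD)
      have dx: "dist x y < \<delta>" "dist y x < \<delta>1" using y'(3) by (auto simp: dist_commute)
      show "f y \<le> c * f x" using \<delta>1(2)[OF y dx(2)] by (simp add: dist_real_def)
      have "g (F x) / c \<le> g (F y)" using r1(2)[OF y] d by (simp add: dist_real_def dist_commute)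
      then show "g (F x) \<le> c * g (F y)" using c by (simp add: field_simps)
      have nF: "norm (F y) \<ge> norm (F x) / c ^ 2"
      proof -
        have "norm (F x) - norm (F y) \<le> dist (F x) (F y)" by (simp add: dist_norm norm_triangle_ineq2)
        then show ?thesis using d by (simp add: r3_def algebra_simps)
      qed
      have "norm (F x) / c = sqrt ((norm (F x) / c) ^ 2)" using c by simp
      also have "(norm (F x) / c) ^ 2 = norm (F x) * (norm (F x) / c ^ 2)" by (simp add: power2_eq_square)
      also have "sqrt \<dots> \<le> sqrt (norm (F x) * norm (F y))"
        using nF by (intro real_sqrt_le_mono mult_left_mono) auto
      finally have "norm (S (y - x)) * (norm (F x) / c) \<le> norm (S (y - x)) * sqrt (norm (F x) * norm (F y))"
        by (intro mult_left_mono) auto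
      also have "\<dots> \<le> C * dist (F x) (F y)" by (rule \<delta>(2)[OF y dx(1)])
      finally show "norm (S (y - x)) \<le> C * c / norm (F x) * dist (F x) (F y)"
        using c nz[OF x] by (simp add: field_simps)
    qed
  qed
  \<comment> \<open>The exponent counts the losses: one \<open>c\<close> for the oscillation of
    \<open>f\<close>, one for \<open>g\<close>, and one per dimension for the size of the ellipsoid
    that contains the preimage of a ball.\<close>
  have main: "emeasure M1 A \<le> ennreal (c ^ (?d + 2)) * emeasure M2 E" if c: "c > 1" for c
  proof -
    obtain r0 where r0: "\<And>x. x \<in> A \<Longrightarrow> r0 x > 0" "\<And>x. x \<in> A \<Longrightarrow> ball (F x) (r0 x) \<subseteq> E"
      "\<And>x y. x \<in> A \<Longrightarrow> y \<in> A \<Longrightarrow> dist (F x) (F y) < r0 x \<Longrightarrow>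
         f y \<le> c * f x \<and> g (F x) \<le> c * g (F y) \<and> norm (S (y - x)) \<le> C * c / norm (F x) * dist (F x) (F y)"
      using local[OF _ c] by metis
    define K where "K = {(F x, r) | x r. x \<in> A \<and> 0 < r \<and> r < r0 x}"
    have ball: "emeasure M1 (X i) \<le> ennreal (c ^ (?d + 2)) * emeasure M2 (ball (fst i) (snd i))" if i: "i \<in> K" for i
    proof -
      obtain x r where xr: "i = (F x, r)" "x \<in> A" "0 < r" "r < r0 x" using i unfolding K_def by auto
      have Fx: "norm (F x) > 0" using nz[OF xr(2)] by simp
      define t where "t = C * c / norm (F x) * r"
      have t: "t \<ge> 0" using C c xr(3) Fx by (simp add: t_def)
      define El where "El = {y. norm (y + ((k - 1) * (y \<bullet> e)) *\<^sub>R e - S x) \<le> t}"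
      have Elm: "El \<in> sets borel" unfolding El_def by (intro borel_closed closed_Collect_le continuous_intros)
      have sub: "y \<in> El \<and> f y \<le> c * f x" if "y \<in> X i" for y
      proof -
        have y: "y \<in> A" "dist (F x) (F y) < r" using that by (auto simp: X_def xr)
        have "norm (S (y - x)) \<le> C * c / norm (F x) * dist (F x) (F y)" "f y \<le> c * f x"
          using r0(3)[OF xr(2) y(1)] y(2) xr(4) by auto
        moreover have "C * c / norm (F x) * dist (F x) (F y) \<le> t" unfolding t_def
          using y(2) C c Fx by (intro mult_left_mono) auto
        moreover have "S (y - x) = y + ((k - 1) * (y \<bullet> e)) *\<^sub>R e - S x"
          by (simp add: S_def algebra_simps inner_diff_left)
        ultimately show ?thesis by (simp add: El_def)
      qed
      have "emeasure M1 (X i) = (\<integral>\<^sup>+y. ennreal (indicator A y * f y) * indicator (X i) y \<partial>lborel)"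
        unfolding M1_def using Xo[of i] by (subst emeasure_density) auto
      also have "\<dots> \<le> (\<integral>\<^sup>+y. ennreal (c * f x) * indicator El y \<partial>lborel)"
        using sub by (intro nn_integral_mono) (auto simp: indicator_def X_def intro!: ennreal_leI)
      also have "\<dots> = ennreal (c * f x) * ennreal (?V * t ^ ?d / k)"
        using Elm emeasure_scaled_cball[OF e k t, of "S x"]
        by (subst nn_integral_cmult_indicator) (auto simp: El_def)
      also have "\<dots> = ennreal (c * f x * (?V * t ^ ?d / k))"
        using c fpos[OF xr(2)] by (subst ennreal_mult'[symmetric]) auto
      also have "\<dots> \<le> ennreal (c ^ (?d + 2) * (g (F x) / c * (?V * r ^ ?d)))"
      proof (rule ennreal_leI)
        have "c * f x * (?V * t ^ ?d / k) = (f x * C ^ ?d) * (c ^ Suc ?d * ?V * r ^ ?d / (k * norm (F x) ^ ?d))"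
          by (simp add: t_def power_mult_distrib power_divide field_simps)
        also have "\<dots> \<le> (k * norm (F x) ^ ?d * g (F x)) * (c ^ Suc ?d * ?V * r ^ ?d / (k * norm (F x) ^ ?d))"
          using fg[OF xr(2)] c xr(3) k Fx by (intro mult_right_mono) (auto simp: unit_ball_vol_nonneg)
        also have "\<dots> = c ^ (?d + 2) * (g (F x) / c * (?V * r ^ ?d))"
          using k Fx c by (simp add: field_simps power2_eq_square)
        finally show "c * f x * (?V * t ^ ?d / k) \<le> c ^ (?d + 2) * (g (F x) / c * (?V * r ^ ?d))" .
      qed
      also have "\<dots> = ennreal (c ^ (?d + 2)) * (ennreal (g (F x) / c) * ennreal (?V * r ^ ?d))"
      proof -
        have aux: "ennreal (a * (b * w)) = ennreal a * (ennreal b * ennreal w)" if "a \<ge> 0" "b \<ge> 0" for a b w :: real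
          using that by (simp add: ennreal_mult')
        show ?thesis by (rule aux) (use c gpos[OF xr(2)] in auto)
      qed
      also have "ennreal (g (F x) / c) * ennreal (?V * r ^ ?d) = (\<integral>\<^sup>+q. ennreal (g (F x) / c) * indicator (ball (F x) r) q \<partial>lborel)"
        using xr(3) by (subst nn_integral_cmult_indicator) (auto simp: emeasure_ball)
      also have "\<dots> \<le> (\<integral>\<^sup>+q. ennreal (indicator E q * g q) * indicator (ball (F x) r) q \<partial>lborel)"
      proof (intro nn_integral_mono)
        fix q
        show "ennreal (g (F x) / c) * indicator (ball (F x) r) q \<le> ennreal (indicator E q * g q) * indicator (ball (F x) r) q"
        proof (cases "q \<in> ball (F x) r")
          case True
          then have "q \<in> E" using r0(2)[OF xr(2)] xr(4) by auto
          then obtain y where y: "y \<in> A" "q = F y" unfolding E_def by auto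
          have "g (F x) \<le> c * g (F y)" using r0(3)[OF xr(2) y(1)] True xr(4) y(2) by auto
          then show ?thesis using True \<open>q \<in> E\<close> y c by (auto simp: field_simps intro!: ennreal_leI)
        qed simp
      qed
      also have "\<dots> = emeasure M2 (ball (fst i) (snd i))"
        unfolding M2_def by (subst emeasure_density) (auto simp: xr)
      finally show ?thesis by (simp add: mult_left_mono)
    qed
    \<comment> \<open>The Vitali balls are disjoint and cover the image up to a null set, so their
      contributions add up without any multiplicity constant.\<close>
    obtain I where I: "countable I" "I \<subseteq> K"
      "pairwise (\<lambda>i j. disjnt (ball (fst i) (snd i)) (ball (fst j) (snd j))) I"
      "negligible (E - (\<Union>i\<in>I. ball (fst i) (snd i)))"
    proof (rule Vitali_covering_theorem_balls[of E K fst snd])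
      fix p and d :: real assume p: "p \<in> E" and d: "d > 0"
      then obtain x where x: "x \<in> A" "p = F x" unfolding E_def by auto
      have "(F x, min (d / 2) (r0 x / 2)) \<in> K" using r0(1)[OF x(1)] x d unfolding K_def by auto
      then show "\<exists>i. i \<in> K \<and> p \<in> ball (fst i) (snd i) \<and> snd i < d"
        using r0(1)[OF x(1)] d x by (intro exI[of _ "(F x, min (d / 2) (r0 x / 2))"]) auto
    qed auto
    define N where "N = A - (\<Union>i\<in>I. X i)"
    have UX: "(\<Union>i\<in>I. X i) \<in> sets borel" by (intro borel_open open_UN ballI Xo)
    have Nb: "N \<in> sets borel" unfolding N_def using A Xo by (intro sets.Diff borel_open) auto
    have Ninv: "N = inv_into A F ` (E - (\<Union>i\<in>I. ball (fst i) (snd i)))" (is "_ = _ ` ?P")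
    proof -
      have "F ` N = ?P"
        unfolding N_def X_def E_def by auto
      moreover have "inv_into A F ` F ` N = N"
        by (rule inv_into_image_cancel[OF inj]) (auto simp: N_def)
      ultimately show ?thesis by simp
    qed
    \<comment> \<open>The part of the domain that is missed is the image of a null set under the
      pointwise Lipschitz inverse.\<close>
    have "negligible N" unfolding Ninv
    proof (rule negligible_locally_Lipschitz_image[OF order_refl I(4)])
      fix p assume "p \<in> ?P"
      then obtain x where x: "x \<in> A" "p = F x" unfolding E_def by auto
      show "\<exists>T B. open T \<and> p \<in> T \<and> (\<forall>q\<in>?P \<inter> T. norm (inv_into A F q - inv_into A F p) \<le> B * norm (q - p))"
      proof (intro exI[of _ "ball (F x) (r0 x)"] exI[of _ "C * c / norm (F x) / min 1 k"] conjI ballI)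
        fix q assume q: "q \<in> ?P \<inter> ball (F x) (r0 x)"
        then obtain y where y: "y \<in> A" "q = F y" unfolding E_def by auto
        have "min 1 k * norm (y - x) \<le> norm (S (y - x))" by (rule Slow)
        also have "\<dots> \<le> C * c / norm (F x) * dist (F x) (F y)"
          using r0(3)[OF x(1) y(1)] q y by auto
        finally have "norm (y - x) \<le> (C * c / norm (F x) * dist (F x) (F y)) / min 1 k"
          using k by (subst pos_le_divide_eq) (auto simp: mult.commute)
        then show "norm (inv_into A F q - inv_into A F p) \<le> C * c / norm (F x) / min 1 k * norm (q - p)"
          using x y inj by (simp add: inv_into_f_f dist_norm norm_minus_commute)
      qed (use x r0(1) in auto)
    qed
    then have "N \<in> null_sets lborel"
      using Nb by (simp add: negligible_iff_null_sets null_sets_completion_iff)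
    then have N0: "emeasure M1 N = 0"
      unfolding M1_def using Nb by (subst emeasure_density) (auto intro!: nn_integral_null_set)
    have db: "disjoint_family_on (\<lambda>i. ball (fst i) (snd i)) I"
      using I(3) unfolding disjoint_family_on_def pairwise_def disjnt_def by blast
    then have dX: "disjoint_family_on X I"
      unfolding disjoint_family_on_def X_def by blast
    have "emeasure M1 A \<le> emeasure M1 ((\<Union>i\<in>I. X i) \<union> N)"
      by (rule emeasure_mono) (use sets.Un[OF UX Nb] in \<open>auto simp: N_def\<close>)
    also have "\<dots> \<le> emeasure M1 (\<Union>i\<in>I. X i) + emeasure M1 N"
      by (rule emeasure_subadditive) (use UX Nb in auto)
    also have "\<dots> = emeasure M1 (\<Union>i\<in>I. X i)" using N0 by simp
    also have "\<dots> = (\<integral>\<^sup>+i. emeasure M1 (X i) \<partial>count_space I)"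
      using I(1) Xo dX by (intro emeasure_UN_countable) auto
    also have "\<dots> \<le> (\<integral>\<^sup>+i. ennreal (c ^ (?d + 2)) * emeasure M2 (ball (fst i) (snd i)) \<partial>count_space I)"
      using ball I(2) by (intro nn_integral_mono) auto
    also have "\<dots> = ennreal (c ^ (?d + 2)) * (\<integral>\<^sup>+i. emeasure M2 (ball (fst i) (snd i)) \<partial>count_space I)"
      by (rule nn_integral_cmult) auto
    also have "(\<integral>\<^sup>+i. emeasure M2 (ball (fst i) (snd i)) \<partial>count_space I) = emeasure M2 (\<Union>i\<in>I. ball (fst i) (snd i))"
      using I(1) db by (intro emeasure_UN_countable[symmetric]) auto
    also have "\<dots> \<le> emeasure M2 E"
    proof (rule emeasure_mono)
      show "(\<Union>i\<in>I. ball (fst i) (snd i)) \<subseteq> E"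
        using I(2) r0(2) unfolding K_def by fastforce
    qed (use E in auto)
    finally show ?thesis by (simp add: mult_left_mono)
  qed
  have "emeasure M1 A \<le> emeasure M2 E" by (rule ennreal_le_if_le_mult_powers[OF main])
  moreover have "emeasure M1 A = (\<integral>\<^sup>+x\<in>A. ennreal (f x) \<partial>lborel)"
    unfolding M1_def using A by (subst emeasure_density) (auto intro!: nn_integral_cong split: split_indicator)
  moreover have "emeasure M2 E = (\<integral>\<^sup>+p\<in>E. ennreal (g p) \<partial>lborel)"
    unfolding M2_def using E by (subst emeasure_density) (auto intro!: nn_integral_cong split: split_indicator)
  ultimately show ?thesis by (simp add: E_def)
qed

lemma open_emeasure_pos:
  fixes S :: "'a::euclidean_space set"
  assumes "open S" "S \<noteq> {}" shows "vol S \<noteq> 0"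
proof
  assume "vol S = 0"
  then have "S \<in> null_sets lborel" using assms by (auto simp: null_sets_def)
  then have "negligible S" using assms(1) by (simp add: negligible_iff_null_sets null_sets_completion_iff)
  then show False using assms open_not_negligible by blast
qed

lemma hyperplane_null:
  fixes a :: "'a::euclidean_space"
  assumes "a \<noteq> 0" shows "{x. inner a x = c} \<in> null_sets lborel"
proof -
  have "closed {x. inner a x = c}" by (intro closed_Collect_eq continuous_intros)
  then show ?thesis
    using negligible_hyperplane[of a c] assms by (simp add: negligible_iff_null_sets null_sets_completion_iff)
qed

text \<open>Slices of height 2 at unit spacing overlap, so they may be taken open, as the expansion
  estimates require; their bounds form a geometric series.\<close>

lemma volume_le_by_slices:
  fixes A :: "'a::euclidean_space set" and z :: "'a \<Rightarrow> real"
  assumes A: "open A" and z: "continuous_on UNIV z" and low: "\<And>x. x \<in> A \<Longrightarrow> c \<le> z x"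
    and D: "D \<ge> 0" and b: "b > 0"
    and slice: "\<And>S t. open S \<Longrightarrow> S \<subseteq> A \<Longrightarrow> (\<And>x. x \<in> S \<Longrightarrow> t < z x \<and> z x < t + 2) \<Longrightarrow> vol S \<le> ennreal (D * exp (- b * t))"
  shows "vol A \<le> ennreal (D * exp (- b * (c - 1)) / (1 - exp (- b)))"
proof -
  define h where "h = (\<lambda>j::nat. D * exp (- b * (c - 1 + real j)))"
  have "h = (\<lambda>j. D * exp (- b * (c - 1)) * exp (- b) ^ j)"
    by (auto simp: h_def exp_of_nat_mult[symmetric] exp_add[symmetric] algebra_simps)
  then have hs: "h sums (D * exp (- b * (c - 1)) * (1 / (1 - exp (- b))))"
    using b by (simp only:) (intro sums_mult geometric_sums, simp)
  have h0: "h j \<ge> 0" for j using D by (simp add: h_def)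
  \<comment> \<open>Starting at \<open>c - 1\<close> puts points of height exactly \<open>c\<close>
    inside the first open slice.\<close>
  define S where "S = (\<lambda>j::nat. A \<inter> {x. c - 1 + real j < z x \<and> z x < c - 1 + real j + 2})"
  have So: "open (S j)" for j
    unfolding S_def using A z by (intro open_Int open_Collect_conj open_Collect_less continuous_intros)
  have "A \<subseteq> (\<Union>j. S j)"
  proof
    fix x assume x: "x \<in> A"
    define j where "j = nat \<lfloor>z x - c\<rfloor>"
    have "real j \<le> z x - c" "z x - c < real j + 1" unfolding j_def using low[OF x] by linarith+
    then show "x \<in> (\<Union>j. S j)" using x by (auto simp: S_def intro!: exI[of _ j])
  qed
  then have "vol A \<le> vol (\<Union>j. S j)" using So by (intro emeasure_mono) auto
  also have "\<dots> \<le> (\<Sum>j. vol (S j))" using So by (intro emeasure_subadditive_countably) auto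
  also have "\<dots> \<le> (\<Sum>j. ennreal (h j))"
  proof (intro suminf_le)
    show "vol (S j) \<le> ennreal (h j)" for j
      unfolding h_def by (rule slice[OF So]) (auto simp: S_def)
  qed auto
  also have "\<dots> = ennreal (D * exp (- b * (c - 1)) * (1 / (1 - exp (- b))))"
    using suminf_ennreal2[OF h0 sums_summable[OF hs]] sums_unique[OF hs] by simp
  finally show ?thesis by simp
qed

section \<open>The map on a single beam\<close>

definition pm :: "int \<Rightarrow> real" where "pm k = (if even k then 1 else -1)"

lemma pm_simps [simp]: "pm k * pm k = 1" "pm k * (pm k * x) = x" "\<bar>pm k\<bar> = 1" "pm k \<noteq> 0"
  by (auto simp: pm_def)

lemma pm_add: "pm (k + m) = pm k * pm m" by (auto simp: pm_def)
lemma pm_diff: "pm (k - m) = pm k * pm m" by (auto simp: pm_def)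
lemma pm_cases: "pm k = 1 \<or> pm k = -1" by (auto simp: pm_def)

definition refl3 :: "R3 \<Rightarrow> R3" where
  "refl3 w = (fst w, fst (snd w), - ht w)"

definition reflp :: "int \<Rightarrow> R3 \<Rightarrow> R3" where
  "reflp k w = (if even k then w else refl3 w)"

lemma norm_triple: "norm (a::real, b::real, c::real) = sqrt (a\<^sup>2 + b\<^sup>2 + c\<^sup>2)"
  by (simp add: norm_Pair power2_eq_square[symmetric] real_sqrt_pow2 add.assoc)

lemma reflp_simps [simp]:
  "norm (reflp k w) = norm w" "dist (reflp k w) (reflp k w') = dist w w'" "reflp k w = reflp k w' \<longleftrightarrow> w = w'"
  "fst (reflp k w) = fst w" "fst (snd (reflp k w)) = fst (snd w)" "ht (reflp k w) = pm k * ht w"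
  by (cases w; cases w'; auto simp: reflp_def refl3_def norm_triple dist_Pair_Pair dist_real_def pm_def abs_minus_commute)+

lemma reflp_reflp [simp]: "reflp k (reflp k w) = w"
  by (cases w) (auto simp: reflp_def refl3_def)

section \<open>Folding, reflection and continuity of the extended map\<close>

locale zorich_map =
  fixes hh :: "(real \<times> real) \<Rightarrow> (R3)" and L lam nu :: real
  assumes L: "L \<ge> 1"
    and bilip: "bi_lipschitz_on L sqQ hh"
    and onto: "hh ` sqQ = upper_hemisphere"
    and bdry: "hh ` frontier sqQ = equator"
    and diag1: "\<And>t. t \<in> {-1..1} \<Longrightarrow> fst (hh (t, t)) = fst (snd (hh (t, t)))"
    and diag2: "\<And>t. t \<in> {-1..1} \<Longrightarrow> fst (hh (t, -t)) = - fst (snd (hh (t, -t)))"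
    and lam: "lam \<ge> 1" "lam > L ^ 5"
    and nu: "nu > 0" "nu > sqrt (2 * L / lam)"
begin

abbreviation F where "F \<equiv> zorich hh lam nu"

abbreviation in_beam :: "int \<Rightarrow> real \<Rightarrow> bool" where
  "in_beam k t \<equiv> \<bar>t - 2 * of_int k * lam\<bar> \<le> lam"

abbreviation inside_beam :: "int \<Rightarrow> real \<Rightarrow> bool" where
  "inside_beam k t \<equiv> \<bar>t - 2 * of_int k * lam\<bar> < lam"

definition Hm :: "real \<Rightarrow> real \<Rightarrow> R3" where
  "Hm s t = reflp (beam_index lam s + beam_index lam t) (hh (fold_coord lam s / lam, fold_coord lam t / lam))"

lemma lam_pos [simp]: "lam > 0" "lam \<noteq> 0" "lam \<ge> 0" using lam by auto

lemma F_eq: "F x = (nu * lam * exp (ht x)) *\<^sub>R Hm (fst x) (fst (snd x))"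
  by (auto simp: zorich_def Hm_def reflp_def refl3_def Let_def mult_ac prod_eq_iff)

lemma beam_bounds: "(2 * of_int (beam_index lam t) - 1) * lam \<le> t" "t < (2 * of_int (beam_index lam t) + 1) * lam"
proof -
  have "of_int (beam_index lam t) \<le> (t + lam) / (2 * lam)" "(t + lam) / (2 * lam) < of_int (beam_index lam t) + 1"
    unfolding beam_index_def by linarith+
  then show "(2 * of_int (beam_index lam t) - 1) * lam \<le> t" "t < (2 * of_int (beam_index lam t) + 1) * lam"
    by (auto simp: field_simps)
qed

lemma beam_index_eq: "(2 * of_int k - 1) * lam \<le> t \<Longrightarrow> t < (2 * of_int k + 1) * lam \<Longrightarrow> beam_index lam t = k"
  unfolding beam_index_def by (rule floor_unique) (auto simp: field_simps)

lemma fold_eq: "fold_coord lam t = pm (beam_index lam t) * (t - 2 * of_int (beam_index lam t) * lam)"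
  by (simp add: fold_coord_def pm_def)

text \<open>A face belongs to two closed beams, while \<open>beam_index\<close> assigns it to the
  upper one. Crossing it flips both sign and offset, so the folded coordinate is independent of the
  choice.\<close>

lemma beam_closed:
  assumes "in_beam k t"
  shows "fold_coord lam t = pm k * (t - 2 * of_int k * lam)"
    and "beam_index lam t = k \<or> beam_index lam t = k + 1 \<and> \<bar>t - 2 * of_int k * lam\<bar> = lam"
proof -
  have "fold_coord lam t = pm k * (t - 2 * of_int k * lam) \<and>
     (beam_index lam t = k \<or> beam_index lam t = k + 1 \<and> \<bar>t - 2 * of_int k * lam\<bar> = lam)"
  proof (cases "t = (2 * of_int k + 1) * lam")
    case True
    then have "beam_index lam t = k + 1" by (intro beam_index_eq) (auto simp: algebra_simps)
    with True show ?thesis by (auto simp: fold_eq pm_def algebra_simps)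
  next
    case False
    then have "beam_index lam t = k" using assms by (intro beam_index_eq) (auto simp: algebra_simps abs_le_iff)
    then show ?thesis by (simp add: fold_eq)
  qed
  then show "fold_coord lam t = pm k * (t - 2 * of_int k * lam)"
    "beam_index lam t = k \<or> beam_index lam t = k + 1 \<and> \<bar>t - 2 * of_int k * lam\<bar> = lam" by auto
qed

lemma in_own_beam: "in_beam (beam_index lam t) t"
  using beam_bounds[of t] by (auto simp: algebra_simps abs_le_iff)

lemma fold_bound: "\<bar>fold_coord lam t\<bar> \<le> lam"
  using in_own_beam[of t] by (simp add: fold_eq abs_mult)

lemma fold_le_abs: "\<bar>fold_coord lam t\<bar> \<le> \<bar>t\<bar>"
proof -
  define k where "k = beam_index lam t"
  have b: "in_beam k t" using in_own_beam k_def by simp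
  have "\<bar>t - 2 * of_int k * lam\<bar> \<le> \<bar>t\<bar>"
  proof (cases "k = 0")
    case False
    then have "\<bar>real_of_int k\<bar> \<ge> 1" by linarith
    then have "\<bar>real_of_int k\<bar> * lam \<ge> 1 * lam" by (intro mult_right_mono) auto
    then have "\<bar>2 * of_int k * lam\<bar> \<ge> 2 * lam" by (simp add: abs_mult)
    then show ?thesis using b by linarith
  qed simp
  then show ?thesis by (simp add: fold_eq k_def abs_mult)
qed

lemma L_pos [simp]: "L > 0" "L \<ge> 0" using L by auto

lemma frontier_sqQ: "y \<in> frontier sqQ \<longleftrightarrow> y \<in> sqQ \<and> (\<bar>fst y\<bar> = 1 \<or> \<bar>snd y\<bar> = 1)"
proof -
  have eq: "sqQ = cbox (-1, -1) (1, 1)" by (auto simp: sqQ_def cbox_Pair_eq abs_le_iff)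
  have "interior sqQ = box (-1, -1) (1, 1)" unfolding eq by (rule interior_cbox)
  also have "\<dots> = {y. \<bar>fst y\<bar> < 1 \<and> \<bar>snd y\<bar> < 1}"
    by (auto simp: box_def Basis_prod_def abs_less_iff)
  finally have i: "interior sqQ = {y. \<bar>fst y\<bar> < 1 \<and> \<bar>snd y\<bar> < 1}" .
  have "closed sqQ" unfolding eq by (rule closed_cbox)
  then have "frontier sqQ = sqQ - interior sqQ" by (simp add: frontier_def)
  moreover have "y \<in> sqQ \<Longrightarrow> \<bar>fst y\<bar> \<le> 1 \<and> \<bar>snd y\<bar> \<le> 1" by (simp add: sqQ_def)
  ultimately show ?thesis unfolding i by force
qed

lemma hh_hemi: "y \<in> sqQ \<Longrightarrow> norm (hh y) = 1" "y \<in> sqQ \<Longrightarrow> ht (hh y) \<ge> 0"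
  using onto by (auto simp: upper_hemisphere_def)

lemma hh_upper: "y \<in> sqQ \<Longrightarrow> z \<in> sqQ \<Longrightarrow> dist (hh y) (hh z) \<le> L * dist y z"
  and hh_lower: "y \<in> sqQ \<Longrightarrow> z \<in> sqQ \<Longrightarrow> dist y z \<le> L * dist (hh y) (hh z)"
  using bilip L by (auto simp: bi_lipschitz_on_def field_simps)

lemma hh_inj: "y \<in> sqQ \<Longrightarrow> z \<in> sqQ \<Longrightarrow> hh y = hh z \<Longrightarrow> y = z"
  using hh_lower[of y z] by simp

lemma hh_cont: "continuous_on sqQ hh"
  unfolding continuous_on_iff
proof (intro ballI allI impI)
  fix y and \<epsilon> :: real assume y: "y \<in> sqQ" and \<epsilon>: "\<epsilon> > 0"
  show "\<exists>d>0. \<forall>x'\<in>sqQ. dist x' y < d \<longrightarrow> dist (hh x') (hh y) < \<epsilon>"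
  proof (intro exI[of _ "\<epsilon> / L"] conjI ballI impI)
    fix x' assume "x' \<in> sqQ" "dist x' y < \<epsilon> / L"
    then have "L * dist x' y < \<epsilon>" by (simp add: field_simps)
    then show "dist (hh x') (hh y) < \<epsilon>" using hh_upper[OF \<open>x' \<in> sqQ\<close> y] by linarith
  qed (use \<epsilon> in simp)
qed

lemma hh_third0: "y \<in> sqQ \<Longrightarrow> ht (hh y) = 0 \<longleftrightarrow> \<bar>fst y\<bar> = 1 \<or> \<bar>snd y\<bar> = 1"
proof -
  assume y: "y \<in> sqQ"
  have "ht (hh y) = 0 \<longleftrightarrow> hh y \<in> equator" using hh_hemi(1)[OF y] by (simp add: equator_def)
  also have "\<dots> \<longleftrightarrow> y \<in> frontier sqQ"
  proof
    assume "hh y \<in> equator"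
    then obtain z where "z \<in> frontier sqQ" "hh y = hh z" using bdry by blast
    then show "y \<in> frontier sqQ" using hh_inj[OF y, of z] frontier_sqQ by auto
  next
    assume "y \<in> frontier sqQ"
    then show "hh y \<in> equator" using bdry by blast
  qed
  finally show ?thesis using y frontier_sqQ by simp
qed

lemma hh_origin: "hh (0, 0) = (0, 0, 1)"
proof -
  have 0: "(0, 0) \<in> sqQ" by (simp add: sqQ_def)
  obtain a b c where w: "hh (0, 0) = (a, b, c)" by (metis prod.exhaust)
  have "a = b" "a = - b" using diag1[of 0] diag2[of 0] w by auto
  then have "a = 0" "b = 0" by auto
  moreover have "\<bar>c\<bar> = 1" "c \<ge> 0" using hh_hemi[OF 0] w \<open>a = 0\<close> \<open>b = 0\<close> by (auto simp: norm_triple)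
  ultimately show ?thesis using w by auto
qed

text \<open>The formula extends from half-open to closed squares: where the indices differ the point
  lies on a face, its image lies on the equator, and reflection fixes it. Estimates for
  \<open>hh\<close> thus carry over to each closed beam.\<close>

lemma Hm_square:
  assumes "in_beam k s" "in_beam m t"
  shows "Hm s t = reflp (k + m) (hh (pm k * (s - 2 * of_int k * lam) / lam, pm m * (t - 2 * of_int m * lam) / lam))"
proof -
  define y where "y = (pm k * (s - 2 * of_int k * lam) / lam, pm m * (t - 2 * of_int m * lam) / lam)"
  have y: "y \<in> sqQ" using assms by (simp add: y_def sqQ_def abs_mult)
  have H: "Hm s t = reflp (beam_index lam s + beam_index lam t) (hh y)"
    unfolding Hm_def y_def by (simp add: beam_closed(1)[OF assms(1)] beam_closed(1)[OF assms(2)])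
  show ?thesis
  proof (cases "beam_index lam s = k \<and> beam_index lam t = m")
    case False
    then have "\<bar>s - 2 * of_int k * lam\<bar> = lam \<or> \<bar>t - 2 * of_int m * lam\<bar> = lam"
      using beam_closed(2)[OF assms(1)] beam_closed(2)[OF assms(2)] by auto
    then have "\<bar>fst y\<bar> = 1 \<or> \<bar>snd y\<bar> = 1" by (auto simp: y_def abs_mult)
    then have "ht (hh y) = 0" using hh_third0[OF y] by simp
    then have "reflp j (hh y) = hh y" for j by (simp add: prod_eq_iff)
    then show ?thesis using H unfolding y_def[symmetric] by simp
  qed (use H y_def in simp)
qed

lemma norm_Hm [simp]: "norm (Hm s t) = 1"
proof -
  have "(fold_coord lam s / lam, fold_coord lam t / lam) \<in> sqQ" using fold_bound by (simp add: sqQ_def)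
  then show ?thesis by (simp add: Hm_def hh_hemi)
qed

lemma norm_F: "norm (F x) = nu * lam * exp (ht x)"
  using nu by (simp add: F_eq abs_mult)

lemma F_nonzero [simp]: "F x \<noteq> 0"
  using norm_F[of x] nu by auto

lemma dist_fold_square:
  assumes "\<bar>c\<bar> = 1" "\<bar>d\<bar> = 1"
  shows "dist (c * (s - a) / lam, d * (t - b) / lam) (c * (s' - a) / lam, d * (t' - b) / lam) = dist (s, t) (s', t') / lam"
proof -
  have e: "c * (s - a) / lam - c * (s' - a) / lam = c * ((s - s') / lam)"
          "d * (t - b) / lam - d * (t' - b) / lam = d * ((t - t') / lam)" by (auto simp: field_simps)
  have "dist (c * (s - a) / lam, d * (t - b) / lam) (c * (s' - a) / lam, d * (t' - b) / lam)
      = sqrt (((s - s') / lam)\<^sup>2 + ((t - t') / lam)\<^sup>2)"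
    by (simp add: dist_Pair_Pair dist_real_def e abs_mult assms power_divide)
  also have "\<dots> = sqrt (((s - s')\<^sup>2 + (t - t')\<^sup>2) / lam\<^sup>2)" by (simp add: power_divide add_divide_distrib)
  also have "\<dots> = dist (s, t) (s', t') / lam"
    by (simp add: dist_Pair_Pair dist_real_def real_sqrt_divide)
  finally show ?thesis .
qed

lemma Hm_bilip:
  assumes "in_beam k s" "in_beam m t"
    "in_beam k s'" "in_beam m t'"
  shows "dist (Hm s t) (Hm s' t') \<le> L / lam * dist (s, t) (s', t')"
    and "dist (s, t) (s', t') \<le> lam * L * dist (Hm s t) (Hm s' t')"
proof -
  define y where "y = (pm k * (s - 2 * of_int k * lam) / lam, pm m * (t - 2 * of_int m * lam) / lam)"
  define y' where "y' = (pm k * (s' - 2 * of_int k * lam) / lam, pm m * (t' - 2 * of_int m * lam) / lam)"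
  have q: "y \<in> sqQ" "y' \<in> sqQ" using assms by (auto simp: y_def y'_def sqQ_def abs_mult)
  have d: "dist y y' = dist (s, t) (s', t') / lam"
    unfolding y_def y'_def by (rule dist_fold_square) auto
  have H: "dist (Hm s t) (Hm s' t') = dist (hh y) (hh y')"
    by (simp add: Hm_square[OF assms(1,2)] Hm_square[OF assms(3,4)] y_def y'_def)
  show "dist (Hm s t) (Hm s' t') \<le> L / lam * dist (s, t) (s', t')"
    using hh_upper[OF q] d H by simp
  show "dist (s, t) (s', t') \<le> lam * L * dist (Hm s t) (Hm s' t')"
    using hh_lower[OF q] d H by (simp add: field_simps)
qed

text \<open>No single closed beam is a neighbourhood of a point on a face, but such a point shares a
  closed beam with each point nearby. This suffices for continuity, as the Lipschitz bound compares
  only two points at a time.\<close>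

lemma common_beam:
  obtains \<delta> where "\<delta> > 0" "\<And>s. \<bar>s - t\<bar> < \<delta> \<Longrightarrow> \<exists>k. in_beam k s \<and> in_beam k t"
proof -
  define k where "k = beam_index lam t"
  have b: "(2 * of_int k - 1) * lam \<le> t" "t < (2 * of_int k + 1) * lam" using beam_bounds k_def by auto
  show thesis
  proof (cases "t = (2 * of_int k - 1) * lam")
    case True
    show thesis
    proof (rule that[of lam])
      fix s assume s: "\<bar>s - t\<bar> < lam"
      show "\<exists>k. in_beam k s \<and> in_beam k t"
        by (rule exI[of _ "if s \<ge> t then k else k - 1"]) (use s True in \<open>auto simp: algebra_simps abs_le_iff abs_less_iff\<close>)
    qed simp
  next
    case False
    show thesis
    proof (rule that[of "min (t - (2 * of_int k - 1) * lam) ((2 * of_int k + 1) * lam - t)"])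
      show "min (t - (2 * of_int k - 1) * lam) ((2 * of_int k + 1) * lam - t) > 0" using b False by auto
      fix s assume s: "\<bar>s - t\<bar> < min (t - (2 * of_int k - 1) * lam) ((2 * of_int k + 1) * lam - t)"
      show "\<exists>k. in_beam k s \<and> in_beam k t"
        by (rule exI[of _ k]) (use s b in \<open>auto simp: algebra_simps abs_le_iff abs_less_iff\<close>)
    qed
  qed
qed

lemma Hm_cont: "continuous_on UNIV (\<lambda>z. Hm (fst z) (snd z))"
  unfolding continuous_on_iff
proof (intro ballI allI impI)
  fix z :: "real \<times> real" and \<epsilon> :: real assume \<epsilon>: "\<epsilon> > 0"
  obtain s t where z: "z = (s, t)" by (cases z)
  obtain d1 where d1: "d1 > 0" "\<And>s'. \<bar>s' - s\<bar> < d1 \<Longrightarrow> \<exists>k. in_beam k s' \<and> in_beam k s"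
    using common_beam[of s] by blast
  obtain d2 where d2: "d2 > 0" "\<And>t'. \<bar>t' - t\<bar> < d2 \<Longrightarrow> \<exists>k. in_beam k t' \<and> in_beam k t"
    using common_beam[of t] by blast
  show "\<exists>d>0. \<forall>z'\<in>UNIV. dist z' z < d \<longrightarrow> dist (Hm (fst z') (snd z')) (Hm (fst z) (snd z)) < \<epsilon>"
  proof (intro exI[of _ "min (min d1 d2) (\<epsilon> * lam / L)"] conjI ballI impI)
    show "min (min d1 d2) (\<epsilon> * lam / L) > 0" using d1 d2 \<epsilon> by simp
    fix z' :: "real \<times> real" assume d: "dist z' z < min (min d1 d2) (\<epsilon> * lam / L)"
    obtain s' t' where z': "z' = (s', t')" by (cases z')
    have "\<bar>s' - s\<bar> \<le> dist z' z" "\<bar>t' - t\<bar> \<le> dist z' z"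
      using dist_fst_le[of z' z] dist_snd_le[of z' z] by (auto simp: z z' dist_real_def)
    then obtain k m where k: "in_beam k s'" "in_beam k s"
      and m: "in_beam m t'" "in_beam m t"
      using d1(2)[of s'] d2(2)[of t'] d by auto
    have "dist (Hm s' t') (Hm s t) \<le> L / lam * dist (s', t') (s, t)"
      by (rule Hm_bilip(1)[OF k(1) m(1) k(2) m(2)])
    also have "\<dots> < \<epsilon>" using d by (simp add: z z' field_simps)
    finally show "dist (Hm (fst z') (snd z')) (Hm (fst z) (snd z)) < \<epsilon>" by (simp add: z z')
  qed
qed

lemma Hm_cont': "continuous_on S f \<Longrightarrow> continuous_on S g \<Longrightarrow> continuous_on S (\<lambda>x. Hm (f x) (g x))"
  using continuous_on_compose2[OF Hm_cont, of S "\<lambda>x. (f x, g x)"] by (simp add: continuous_on_Pair)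

lemma F_cont: "continuous_on S F"
proof -
  have "F = (\<lambda>x. (nu * lam * exp (ht x)) *\<^sub>R Hm (fst x) (fst (snd x)))" using F_eq by auto
  then show ?thesis by (simp only:) (intro continuous_intros Hm_cont')
qed

section \<open>Tiles\<close>

lemma diag: "\<sigma> \<in> {1, -1} \<Longrightarrow> \<bar>t\<bar> \<le> 1 \<Longrightarrow> fst (hh (t, \<sigma> * t)) = \<sigma> * fst (snd (hh (t, \<sigma> * t)))"
  using diag1[of t] diag2[of t] by (auto simp: abs_le_iff)

lemma hemi_eqI:
  assumes "norm w = 1" "norm w' = 1" "ht w \<ge> 0" "ht w' \<ge> 0"
    "fst w = fst w'" "fst (snd w) = fst (snd w')"
  shows "w = (w' :: R3)"
proof -
  obtain a b c a' b' c' where w: "w = (a, b, c)" "w' = (a', b', c')" by (metis prod.exhaust)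
  have "a\<^sup>2 + b\<^sup>2 + c\<^sup>2 = 1" "a'\<^sup>2 + b'\<^sup>2 + c'\<^sup>2 = 1" using assms w by (auto simp: norm_triple)
  moreover have "a = a'" "b = b'" using assms w by auto
  ultimately have "c\<^sup>2 = c'\<^sup>2" by simp
  then have "c = c'" using assms w by (intro power2_eq_imp_eq[of c c']) auto
  then show ?thesis using assms w by simp
qed

lemma diag_corner:
  assumes \<sigma>: "\<sigma> \<in> {1, -1}" and t: "\<bar>t\<bar> = 1"
  shows "2 * (fst (hh (t, \<sigma> * t)))\<^sup>2 = 1"
proof -
  have y: "(t, \<sigma> * t) \<in> sqQ" using \<sigma> t by (auto simp: sqQ_def)
  obtain a b c where w: "hh (t, \<sigma> * t) = (a, b, c)" by (metis prod.exhaust)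
  have "c = 0" using hh_third0[OF y] t w by simp
  moreover have "a = \<sigma> * b" using diag[OF \<sigma>, of t] t w by simp
  moreover have "a\<^sup>2 + b\<^sup>2 + c\<^sup>2 = 1" using hh_hemi(1)[OF y] w by (simp add: norm_triple)
  ultimately show ?thesis using w \<sigma> by auto
qed

text \<open>Both corners go to points of the equator in the same vertical plane. There are only two
  such points, opposite to each other, and injectivity separates the corners.\<close>

lemma diag_corner_ne:
  assumes \<sigma>: "\<sigma> \<in> {1, -1}"
  shows "fst (hh (-1, - \<sigma>)) = - fst (hh (1, \<sigma>))" "fst (hh (1, \<sigma>)) \<noteq> 0"
proof -
  have c: "2 * (fst (hh (1, \<sigma>)))\<^sup>2 = 1" "2 * (fst (hh (-1, -\<sigma>)))\<^sup>2 = 1"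
    using diag_corner[OF \<sigma>, of 1] diag_corner[OF \<sigma>, of "-1"] by auto
  then show "fst (hh (1, \<sigma>)) \<noteq> 0" by auto
  have q: "(1, \<sigma>) \<in> sqQ" "(-1, -\<sigma>) \<in> sqQ" using \<sigma> by (auto simp: sqQ_def)
  have "fst (hh (-1, - \<sigma>)) \<noteq> fst (hh (1, \<sigma>))"
  proof
    assume eq: "fst (hh (-1, - \<sigma>)) = fst (hh (1, \<sigma>))"
    have "fst (snd (hh (-1, - \<sigma>))) = fst (snd (hh (1, \<sigma>)))"
      using eq diag[OF \<sigma>, of 1] diag[OF \<sigma>, of "-1"] \<sigma> by auto
    then have "hh (-1, - \<sigma>) = hh (1, \<sigma>)"
      using q eq by (intro hemi_eqI) (auto simp: hh_hemi)
    then show False using hh_inj[OF q(2) q(1)] by simp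
  qed
  moreover have "(fst (hh (-1, - \<sigma>)))\<^sup>2 = (fst (hh (1, \<sigma>)))\<^sup>2" using c by simp
  ultimately show "fst (hh (-1, - \<sigma>)) = - fst (hh (1, \<sigma>))" by (simp add: power2_eq_iff)
qed

text \<open>By the intermediate value theorem the image of a diagonal is the full great semicircle, so
  by injectivity nothing else is mapped into the corresponding plane.\<close>

lemma diag_conv:
  assumes \<sigma>: "\<sigma> \<in> {1, -1}" and y: "y \<in> sqQ" and w: "fst (hh y) = \<sigma> * fst (snd (hh y))"
  shows "snd y = \<sigma> * fst y"
proof -
  define p where "p = (\<lambda>t. fst (hh (t, \<sigma> * t)))"
  obtain a b c where abc: "hh y = (a, b, c)" by (metis prod.exhaust)
  have "a\<^sup>2 + b\<^sup>2 + c\<^sup>2 = 1" "a = \<sigma> * b" using hh_hemi(1)[OF y] abc w by (auto simp: norm_triple)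
  then have "2 * a\<^sup>2 + c\<^sup>2 = 1" using \<sigma> by auto
  then have a2: "2 * a\<^sup>2 \<le> 1" using zero_le_power2[of c] by linarith
  have p1: "2 * (p 1)\<^sup>2 = 1" "p (-1) = - p 1"
    using diag_corner[OF \<sigma>, of 1] diag_corner_ne(1)[OF \<sigma>] by (auto simp: p_def)
  have "a\<^sup>2 \<le> (p 1)\<^sup>2" using a2 p1 by simp
  then have ap: "\<bar>a\<bar> \<le> \<bar>p 1\<bar>" by (simp add: abs_le_square_iff)
  have "continuous_on {-1..1} p"
    unfolding p_def using \<sigma>
    by (intro continuous_on_fst continuous_on_compose2[OF hh_cont] continuous_intros) (auto simp: sqQ_def)
  then have conn: "connected (p ` {-1..1})" by (intro connected_continuous_image) auto
  have mem: "p 1 \<in> p ` {-1..1}" "p (-1) \<in> p ` {-1..1}" by auto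
  have "a \<in> p ` {-1..1}"
  proof (cases "p 1 \<ge> 0")
    case True
    then show ?thesis using connectedD_interval[OF conn mem(2) mem(1), of a] ap p1(2) by auto
  next
    case False
    then show ?thesis using connectedD_interval[OF conn mem(1) mem(2), of a] ap p1(2) by auto
  qed
  then obtain t where t: "\<bar>t\<bar> \<le> 1" "a = p t" by (auto simp: abs_le_iff)
  have q: "(t, \<sigma> * t) \<in> sqQ" using \<sigma> t by (auto simp: sqQ_def)
  have "hh (t, \<sigma> * t) = hh y"
  proof (rule hemi_eqI)
    show "fst (snd (hh (t, \<sigma> * t))) = fst (snd (hh y))"
      using diag[OF \<sigma> t(1)] t(2) w abc \<sigma> by (auto simp: p_def)
  qed (use q y abc t hh_hemi[OF y] hh_hemi[OF q] in \<open>auto simp: p_def\<close>)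
  then have "y = (t, \<sigma> * t)" using hh_inj[OF q y] by simp
  then show ?thesis by simp
qed

text \<open>By \<open>diag_conv\<close> the linear form on the left vanishes only on a diagonal.
  Each side of that diagonal is convex, so the sign is constant there by connectedness; the images
  of the corners \<open>(1, \<sigma>)\<close> and \<open>(-1, -\<sigma>)\<close> are opposite, so
  the two signs differ.\<close>

lemma hh_signs:
  assumes \<sigma>: "\<sigma> \<in> {1, -1}"
  obtains \<eta> where "\<eta> \<in> {1, -1 :: real}"
    "\<And>y. y \<in> sqQ \<Longrightarrow> sgn (fst (hh y) + \<sigma> * fst (snd (hh y))) = \<eta> * sgn (fst y + \<sigma> * snd y)"
proof -
  define g where "g = (\<lambda>y. fst (hh y) + \<sigma> * fst (snd (hh y)))"
  define l where "l = (\<lambda>y::real \<times> real. fst y + \<sigma> * snd y)"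
  have \<sigma>': "- \<sigma> \<in> {1, -1}" using \<sigma> by auto
  have zero: "l y = 0" if "y \<in> sqQ" "g y = 0" for y
    using diag_conv[OF \<sigma>' that(1)] that(2) \<sigma> by (auto simp: g_def l_def)
  have zero': "g y = 0" if "y \<in> sqQ" "l y = 0" for y
  proof -
    obtain t t' where y: "y = (t, t')" by (cases y)
    have "t' = - \<sigma> * t" "\<bar>t\<bar> \<le> 1" using that \<sigma> y by (auto simp: l_def sqQ_def)
    then show ?thesis using diag[OF \<sigma>', of t] y \<sigma> by (auto simp: g_def)
  qed
  have same: "sgn (g y) = sgn (g z)" if y: "y \<in> sqQ" "s * l y > 0" and z: "z \<in> sqQ" "s * l z > 0" for s y z
  proof -
    define S where "S = sqQ \<inter> {y. s * l y > 0}"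
    have "convex sqQ"
    proof -
      have "sqQ = cbox (-1, -1) (1, 1)" by (auto simp: sqQ_def cbox_Pair_eq abs_le_iff)
      then show ?thesis by (metis convex_box(1))
    qed
    moreover have "convex {y. s * l y > 0}"
    proof -
      have "{y. s * l y > 0} = {y. inner (s, s * \<sigma>) y > 0}" by (auto simp: l_def inner_prod_def algebra_simps)
      then show ?thesis using convex_halfspace_gt[of 0 "(s, s * \<sigma>)"] by simp
    qed
    ultimately have "connected S" unfolding S_def by (intro convex_connected convex_Int)
    moreover have "continuous_on S g"
      unfolding g_def S_def by (intro continuous_intros continuous_on_subset[OF hh_cont]) auto
    ultimately have conn: "connected (g ` S)" by (rule connected_continuous_image[rotated])
    have n0: "0 \<notin> g ` S" using zero by (auto simp: S_def)
    have m: "g y \<in> g ` S" "g z \<in> g ` S" using that by (auto simp: S_def)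
    show ?thesis
    proof (rule ccontr)
      assume "sgn (g y) \<noteq> sgn (g z)"
      then have "g y \<le> 0 \<and> 0 \<le> g z \<or> g z \<le> 0 \<and> 0 \<le> g y" by (auto simp: sgn_if split: if_splits)
      then show False using connectedD_interval[OF conn] m n0 by blast
    qed
  qed
  define \<eta> where "\<eta> = sgn (fst (hh (1, \<sigma>)))"
  have q: "(1, \<sigma>) \<in> sqQ" "(-1, -\<sigma>) \<in> sqQ" using \<sigma> by (auto simp: sqQ_def)
  have g1: "g (1, \<sigma>) = 2 * fst (hh (1, \<sigma>))" "g (-1, -\<sigma>) = 2 * fst (hh (-1, -\<sigma>))"
    using diag[OF \<sigma>, of 1] diag[OF \<sigma>, of "-1"] \<sigma> by (auto simp: g_def)
  have sg: "sgn (g (1, \<sigma>)) = \<eta>" "sgn (g (-1, -\<sigma>)) = - \<eta>"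
    using g1 diag_corner_ne[OF \<sigma>] by (auto simp: \<eta>_def sgn_mult sgn_minus)
  have l1: "l (1, \<sigma>) = 2" "l (-1, -\<sigma>) = -2" using \<sigma> by (auto simp: l_def)
  show thesis
  proof (rule that[of \<eta>])
    show "\<eta> \<in> {1, -1}" using diag_corner_ne(2)[OF \<sigma>] by (auto simp: \<eta>_def sgn_if)
    fix y assume y: "y \<in> sqQ"
    consider "l y > 0" | "l y < 0" | "l y = 0" by linarith
    then have "sgn (g y) = \<eta> * sgn (l y)"
    proof cases
      case 1
      then show ?thesis using same[of y 1 "(1, \<sigma>)"] y q sg l1 by simp
    next
      case 2
      then show ?thesis using same[of y "-1" "(-1, -\<sigma>)"] y q sg l1 by simp
    next
      case 3
      then show ?thesis using zero'[OF y] by simp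
    qed
    then show "sgn (fst (hh y) + \<sigma> * fst (snd (hh y))) = \<eta> * sgn (fst y + \<sigma> * snd y)"
      by (simp add: g_def l_def)
  qed
qed

text \<open>\<open>etau\<close> and \<open>etav\<close> record which side of the square goes to
  which side of the two vertical planes; they are carried along as parameters.\<close>

definition etau :: real where
  "etau = (SOME \<eta>. \<eta> \<in> {1, -1} \<and> (\<forall>y\<in>sqQ. sgn (fst (hh y) + fst (snd (hh y))) = \<eta> * sgn (fst y + snd y)))"
definition etav :: real where
  "etav = (SOME \<eta>. \<eta> \<in> {1, -1} \<and> (\<forall>y\<in>sqQ. sgn (fst (hh y) - fst (snd (hh y))) = \<eta> * sgn (fst y - snd y)))"

lemma etau: "etau \<in> {1, -1}" "y \<in> sqQ \<Longrightarrow> sgn (fst (hh y) + fst (snd (hh y))) = etau * sgn (fst y + snd y)"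
proof -
  have "\<exists>\<eta>. \<eta> \<in> {1, -1} \<and> (\<forall>y\<in>sqQ. sgn (fst (hh y) + fst (snd (hh y))) = \<eta> * sgn (fst y + snd y))"
    by (rule hh_signs[of 1]) auto
  from someI_ex[OF this, folded etau_def]
  show "etau \<in> {1, -1}" "y \<in> sqQ \<Longrightarrow> sgn (fst (hh y) + fst (snd (hh y))) = etau * sgn (fst y + snd y)" by blast+
qed

lemma etav: "etav \<in> {1, -1}" "y \<in> sqQ \<Longrightarrow> sgn (fst (hh y) - fst (snd (hh y))) = etav * sgn (fst y - snd y)"
proof -
  have "\<exists>\<eta>. \<eta> \<in> {1, -1} \<and> (\<forall>y\<in>sqQ. sgn (fst (hh y) - fst (snd (hh y))) = \<eta> * sgn (fst y - snd y))"
    by (rule hh_signs[of "-1"]) auto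
  from someI_ex[OF this, folded etav_def]
  show "etav \<in> {1, -1}" "y \<in> sqQ \<Longrightarrow> sgn (fst (hh y) - fst (snd (hh y))) = etav * sgn (fst y - snd y)" by blast+
qed

lemma Hm_param:
  assumes "(y1, y2) \<in> sqQ" "s = lam * (2 * of_int k + pm k * y1)" "t = lam * (2 * of_int m + pm m * y2)"
  shows "Hm s t = reflp (k + m) (hh (y1, y2))"
proof -
  have "s - 2 * of_int k * lam = lam * (pm k * y1)" "t - 2 * of_int m * lam = lam * (pm m * y2)"
    using assms by (auto simp: algebra_simps)
  moreover have "\<bar>lam * (pm k * y1)\<bar> \<le> lam" "\<bar>lam * (pm m * y2)\<bar> \<le> lam"
    using assms(1) by (auto simp: abs_mult sqQ_def)
  ultimately show ?thesis using Hm_square[of s k t m] by simp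
qed

lemma Hm_rep:
  obtains k m y1 y2 where "(y1, y2) \<in> sqQ" "s = lam * (2 * of_int k + pm k * y1)"
    "t = lam * (2 * of_int m + pm m * y2)" "Hm s t = reflp (k + m) (hh (y1, y2))"
proof -
  define k m where "k = beam_index lam s" and "m = beam_index lam t"
  define y1 y2 where "y1 = pm k * ((s - 2 * of_int k * lam) / lam)" and "y2 = pm m * ((t - 2 * of_int m * lam) / lam)"
  have "(y1, y2) \<in> sqQ" using in_own_beam[of s] in_own_beam[of t]
    by (simp add: y1_def y2_def sqQ_def abs_mult k_def m_def)
  moreover have "s = lam * (2 * of_int k + pm k * y1)" "t = lam * (2 * of_int m + pm m * y2)"
  proof -
    have "pm k * y1 = (s - 2 * of_int k * lam) / lam" "pm m * y2 = (t - 2 * of_int m * lam) / lam"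
      by (simp_all add: y1_def y2_def)
    then show "s = lam * (2 * of_int k + pm k * y1)" "t = lam * (2 * of_int m + pm m * y2)"
      by (simp_all add: field_simps)
  qed
  ultimately show thesis using that Hm_param by blast
qed

text \<open>A square whose parity disagrees with the sign of the height can only represent a point
  of height 0. Such a point lies on a face, and the neighbouring square across it has the other
  parity.\<close>

lemma Hm_rep_parity:
  assumes "b \<Longrightarrow> ht (Hm s t) \<ge> 0" "\<not> b \<Longrightarrow> ht (Hm s t) \<le> 0"
  obtains k m y1 y2 where "(y1, y2) \<in> sqQ" "s = lam * (2 * of_int k + pm k * y1)"
    "t = lam * (2 * of_int m + pm m * y2)" "Hm s t = reflp (k + m) (hh (y1, y2))" "even (k + m) = b"
proof -
  obtain k m y1 y2 where r: "(y1, y2) \<in> sqQ" "s = lam * (2 * of_int k + pm k * y1)"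
    "t = lam * (2 * of_int m + pm m * y2)" "Hm s t = reflp (k + m) (hh (y1, y2))"
    by (rule Hm_rep)
  show thesis
  proof (cases "even (k + m) = b")
    case False
    have "ht (Hm s t) = pm (k + m) * ht (hh (y1, y2))" using r by simp
    then have "ht (hh (y1, y2)) \<le> 0" using assms False by (auto simp: pm_def split: if_splits)
    then have 0: "ht (hh (y1, y2)) = 0" using hh_hemi(2)[OF r(1)] by simp
    then have R: "reflp j (hh (y1, y2)) = hh (y1, y2)" for j by (simp add: prod_eq_iff)
    from 0 consider "\<bar>y1\<bar> = 1" | "\<bar>y2\<bar> = 1" using hh_third0[OF r(1)] by auto
    then show thesis
    proof cases
      case 1
      \<comment> \<open>\<open>j\<close> is the side on which the face lies. Passing to beam
        \<open>k + j\<close> keeps \<open>y1\<close>, since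
        \<open>2 * j - pm k * y1 = pm k * y1\<close>.\<close>
      define j where "j = (if pm k * y1 = 1 then 1 else (-1::int))"
      have j: "of_int j = pm k * y1" using 1 pm_cases[of k] by (auto simp: j_def)
      have "odd j" by (simp add: j_def)
      then have "pm (k + j) = - pm k" "even (k + j + m) = b" using False by (auto simp: pm_def)
      then show thesis using r R j by (intro that[of y1 y2 "k + j" m]) (auto simp: algebra_simps)
    next
      case 2
      define j where "j = (if pm m * y2 = 1 then 1 else (-1::int))"
      have j: "of_int j = pm m * y2" using 2 pm_cases[of m] by (auto simp: j_def)
      have "odd j" by (simp add: j_def)
      then have "pm (m + j) = - pm m" "even (k + (m + j)) = b" using False by (auto simp: pm_def)
      then show thesis using r R j by (intro that[of y1 y2 k "m + j"]) (auto simp: algebra_simps)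
    qed
  qed (use r that in blast)
qed

text \<open>In rotated coordinates, a square with two opposite vertices at centres of squares of the
  grid and the other two at corners of the grid. It consists of one quarter from each of two
  adjacent squares, glued along their common face.\<close>

definition tile :: "int \<Rightarrow> int \<Rightarrow> (real \<times> real) set" where
  "tile a b = {x. 2 * lam * of_int a \<le> fst x + snd x \<and> fst x + snd x \<le> 2 * lam * of_int (a + 1) \<and>
                  2 * lam * of_int b \<le> fst x - snd x \<and> fst x - snd x \<le> 2 * lam * of_int (b + 1)}"

text \<open>The midpoint \<open>2 * lam * of_int n\<close> lies in the interval. As a multiple of
  \<open>2 * lam\<close> it must be an endpoint, and then both points coincide with it.\<close>

lemma tile_endpoint:
  assumes "2 * lam * of_int a \<le> p" "p \<le> 2 * lam * of_int (a + 1)" "2 * lam * of_int a \<le> q" "q \<le> 2 * lam * of_int (a + 1)"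
    "p + q = 4 * lam * of_int n"
  shows "p = q"
proof -
  have e: "2 * lam * of_int (a + 1) = 2 * (lam * of_int (a + 1))" "2 * lam * of_int a = 2 * (lam * of_int a)"
    "4 * lam * of_int n = 4 * (lam * of_int n)" by auto
  have "lam * of_int a \<le> lam * of_int n" "lam * of_int n \<le> lam * of_int (a + 1)"
    using assms unfolding e by linarith+
  then have "real_of_int a \<le> of_int n" "real_of_int n \<le> of_int (a + 1)"
    by (simp_all only: mult_le_cancel_left_pos[OF lam_pos(1)])
  then have "n = a \<or> n = a + 1" by linarith
  then show ?thesis using assms by (auto simp: algebra_simps)
qed

lemma tile_close:
  assumes "2 * lam * of_int a \<le> p" "p \<le> 2 * lam * of_int (a + 1)" "2 * lam * of_int a \<le> q" "q \<le> 2 * lam * of_int (a + 1)"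
    "p - q = 4 * lam * of_int n"
  shows "n = 0"
proof (rule ccontr)
  assume "n \<noteq> 0"
  then have "\<bar>real_of_int n\<bar> \<ge> 1" by linarith
  then have "4 * lam * \<bar>real_of_int n\<bar> \<ge> 4 * lam * 1" by (intro mult_left_mono) auto
  then have "\<bar>p - q\<bar> \<ge> 4 * lam" using assms(5) by (simp add: abs_mult)
  moreover have "2 * lam * of_int (a + 1) = 2 * lam * of_int a + 2 * lam" by (simp add: algebra_simps)
  then have "\<bar>p - q\<bar> \<le> 2 * lam" using assms(1-4) by linarith
  ultimately show False using lam_pos(1) by linarith
qed

text \<open>Represented with equal parity, two points with the same image differ by a translation or
  by a half-turn. In the coordinates \<open>s + t\<close>, \<open>s - t\<close> the translations are
  multiples of \<open>4 * lam\<close>, too long for a tile, and the half-turns have centres at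
  multiples of \<open>2 * lam\<close>, so they can only fix a vertex.\<close>

lemma tile_inj:
  assumes x: "(s, t) \<in> tile a b" and x': "(s', t') \<in> tile a b" and eq: "Hm s t = Hm s' t'"
  shows "s = s' \<and> t = t'"
proof -
  define \<beta> where "\<beta> \<longleftrightarrow> ht (Hm s t) \<ge> 0"
  obtain k m y1 y2 where r: "(y1, y2) \<in> sqQ" "s = lam * (2 * of_int k + pm k * y1)"
    "t = lam * (2 * of_int m + pm m * y2)" "Hm s t = reflp (k + m) (hh (y1, y2))" "even (k + m) = \<beta>"
    using Hm_rep_parity[of \<beta> s t] unfolding \<beta>_def by (metis linear)
  obtain k' m' y1' y2' where r': "(y1', y2') \<in> sqQ" "s' = lam * (2 * of_int k' + pm k' * y1')"
    "t' = lam * (2 * of_int m' + pm m' * y2')" "Hm s' t' = reflp (k' + m') (hh (y1', y2'))" "even (k' + m') = \<beta>"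
    using Hm_rep_parity[of \<beta> s' t'] unfolding \<beta>_def eq by (metis linear)
  have "reflp (k' + m') w = reflp (k + m) w" for w using r(5) r'(5) by (auto simp: reflp_def)
  then have "hh (y1, y2) = hh (y1', y2')" using eq r(4) r'(4) by simp
  then have y: "y1' = y1" "y2' = y2" using hh_inj[OF r(1) r'(1)] by auto
  note tl = x[unfolded tile_def, simplified] x'[unfolded tile_def, simplified]
  show ?thesis
  proof (cases "even (k - k')")
    case True
    then have "even (m - m')" using r(5) r'(5) by auto
    then obtain i j where ij: "k = k' + 2 * i" "m = m' + 2 * j" using True by (metis add.commute diff_add_cancel evenE)
    then have p: "pm k = pm k'" "pm m = pm m'" by (auto simp: pm_def)
    have "(s + t) - (s' + t') = 4 * lam * of_int (i + j)" "(s - t) - (s' - t') = 4 * lam * of_int (i - j)"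
      using r(2,3) r'(2,3) y p ij by (auto simp: algebra_simps)
    then have "i + j = 0" "i - j = 0"
      using tl tile_close[of a "s + t" "s' + t'" "i + j"] tile_close[of b "s - t" "s' - t'" "i - j"] by simp_all
    then have "i = 0" "j = 0" by auto
    then show ?thesis using r(2,3) r'(2,3) y ij by simp
  next
    case False
    have o: "odd (m - m')" using False r(5) r'(5) by auto
    have p: "pm k' = - pm k" "pm m' = - pm m" using False o by (auto simp: pm_def)
    have "even (k + k' + m + m')" "even (k + k' - m - m')" using False o by presburger+
    then obtain n n' where n: "k + k' + m + m' = 2 * n" "k + k' - m - m' = 2 * n'" by (meson evenE)
    have n': "real_of_int k + k' + m + m' = 2 * real_of_int n" "real_of_int k + k' - m - m' = 2 * real_of_int n'"
      using n by linarith+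
    have "(s + t) + (s' + t') = 2 * lam * (real_of_int k + k' + m + m')"
         "(s - t) + (s' - t') = 2 * lam * (real_of_int k + k' - m - m')"
      using r(2,3) r'(2,3) y p by (auto simp: algebra_simps)
    then have "(s + t) + (s' + t') = 4 * lam * of_int n" "(s - t) + (s' - t') = 4 * lam * of_int n'"
      unfolding n' by auto
    then have "s + t = s' + t'" "s - t = s' - t'"
      using tl by (auto intro!: tile_endpoint[of a "s + t" "s' + t'" n] tile_endpoint[of b "s - t" "s' - t'" n'])
    then show ?thesis by linarith
  qed
qed

text \<open>The tile \<open>(a, b)\<close> meets two neighbouring squares, of opposite parity; \<open>om a b * pm b\<close> and
  \<open>om a b * pm a\<close> are the signs of \<open>y1 + y2\<close> and \<open>y1 - y2\<close> on the folded tile.\<close>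

definition om :: "int \<Rightarrow> int \<Rightarrow> real" where "om a b = pm (a div 2 + b div 2)"

text \<open>The required square is centred at a vertex of the tile: \<open>k + m\<close> is the
  member of \<open>{a, a + 1}\<close> and \<open>k - m\<close> the member of
  \<open>{b, b + 1}\<close> that is even if \<open>\<beta>\<close> holds and odd otherwise. Solving
  for \<open>k\<close> and \<open>m\<close> gives the witnesses.\<close>

lemma tile_surj:
  fixes \<beta> :: bool and a b :: int and y1 y2 :: real
  assumes y: "(y1, y2) \<in> sqQ" and s1: "om a b * pm b * (y1 + y2) \<ge> 0" and s2: "om a b * pm a * (y1 - y2) \<ge> 0"
  defines "c \<equiv> (if \<beta> then (a + 1) div 2 else a div 2)" and "d \<equiv> (if \<beta> then (b + 1) div 2 else b div 2)"
  defines "k \<equiv> (if \<beta> then c + d else c + d + 1)" and "m \<equiv> c - d"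
  shows "even (k + m) = \<beta>" "(lam * (2 * of_int k + pm k * y1), lam * (2 * of_int m + pm m * y2)) \<in> tile a b"
proof -
  have km: "k + m = (if \<beta> then 2 * c else 2 * c + 1)" "k - m = (if \<beta> then 2 * d else 2 * d + 1)"
    by (auto simp: k_def m_def)
  show "even (k + m) = \<beta>" by (simp add: km(1))
  have yb: "\<bar>y1 + y2\<bar> \<le> 2" "\<bar>y1 - y2\<bar> \<le> 2" using y by (auto simp: sqQ_def abs_le_iff)
  define A B where "A = 2 * real_of_int k + pm k * y1" and "B = 2 * real_of_int m + pm m * y2"
  obtain \<alpha> where \<alpha>: "a = 2 * \<alpha> \<or> a = 2 * \<alpha> + 1" by (metis evenE oddE)
  obtain \<gamma> where \<gamma>: "b = 2 * \<gamma> \<or> b = 2 * \<gamma> + 1" by (metis evenE oddE)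
  have pmv: "pm (2 * j) = 1" "pm (2 * j + 1) = -1" "pm (j + 1) = - pm j" "pm 1 = -1" for j by (auto simp: pm_def)
  have dv: "(2 * j + 1) div 2 = j" "(2 * j + 1 + 1) div 2 = j + 1" "2 * j div 2 = j" for j :: int by auto
  define sc :: real where "sc = (if \<beta> \<and> odd a then -1 else 1)"
  define sd :: real where "sd = (if \<beta> \<and> odd b then -1 else 1)"
  define w1 w2 where "w1 = pm \<alpha> * pm \<gamma> * (y1 + y2)" and "w2 = pm \<alpha> * pm \<gamma> * (y1 - y2)"
  have cd: "a = 2 * \<alpha> \<and> c = \<alpha> \<and> sc = 1 \<and> pm a = 1 \<or> a = 2 * \<alpha> + 1 \<and> c = (if \<beta> then \<alpha> + 1 else \<alpha>) \<and> sc = (if \<beta> then -1 else 1) \<and> pm a = -1"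
           "b = 2 * \<gamma> \<and> d = \<gamma> \<and> sd = 1 \<and> pm b = 1 \<or> b = 2 * \<gamma> + 1 \<and> d = (if \<beta> then \<gamma> + 1 else \<gamma>) \<and> sd = (if \<beta> then -1 else 1) \<and> pm b = -1"
    using \<alpha> \<gamma> unfolding c_def d_def sc_def sd_def by (auto simp: pmv)
  have pc: "pm c * pm d = sc * sd * (pm \<alpha> * pm \<gamma>)" using cd by (auto simp: pmv)
  have "pm k = (if \<beta> then pm c * pm d else - (pm c * pm d))" "pm m = pm c * pm d"
    by (auto simp: k_def m_def pm_add pm_diff pmv)
  then have pk: "pm k = (if \<beta> then sc * sd * (pm \<alpha> * pm \<gamma>) else - (sc * sd * (pm \<alpha> * pm \<gamma>)))"
    "pm m = sc * sd * (pm \<alpha> * pm \<gamma>)" using pc by auto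
  \<comment> \<open>In an odd square \<open>pm k = - pm m\<close>, so the folded sum and difference
    exchange their roles.\<close>
  have AB: "A + B = 4 * real_of_int c + (if \<beta> then sc * sd * w1 else 2 - sc * sd * w2)"
      "A - B = 4 * real_of_int d + (if \<beta> then sc * sd * w2 else 2 - sc * sd * w1)"
    unfolding A_def B_def pk w1_def w2_def by (auto simp: k_def m_def algebra_simps)
  have o: "om a b = pm \<alpha> * pm \<gamma>" using \<alpha> \<gamma> by (auto simp: om_def pm_add)
  have w: "pm b * w1 \<ge> 0" "pm a * w2 \<ge> 0"
    using s1 s2 unfolding o w1_def w2_def by (simp_all only: mult_ac)
  have "\<bar>w1\<bar> \<le> 2" "\<bar>w2\<bar> \<le> 2" unfolding w1_def w2_def using yb by (simp_all add: abs_mult)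
  then have wb: "w1 \<le> 2" "-2 \<le> w1" "w2 \<le> 2" "-2 \<le> w2" by auto
  have "2 * real_of_int a \<le> A + B \<and> A + B \<le> 2 * real_of_int (a + 1) \<and>
        2 * real_of_int b \<le> A - B \<and> A - B \<le> 2 * real_of_int (b + 1)"
    using cd w wb unfolding AB by (cases \<beta>; elim disjE conjE; simp)
  then have "lam * (2 * real_of_int a) \<le> lam * (A + B)" "lam * (A + B) \<le> lam * (2 * real_of_int (a + 1))"
        "lam * (2 * real_of_int b) \<le> lam * (A - B)" "lam * (A - B) \<le> lam * (2 * real_of_int (b + 1))"
    by (auto intro!: mult_left_mono)
  then show "(lam * (2 * of_int k + pm k * y1), lam * (2 * of_int m + pm m * y2)) \<in> tile a b"
    unfolding A_def[symmetric] B_def[symmetric] tile_def by (simp add: algebra_simps)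
qed

end

section \<open>Iterates of a ball meet the planes\<close>

text \<open>After division by \<open>exp (a + b)\<close> this is the inequality
  \<open>\<bar>sinh h\<bar> \<ge> \<bar>h\<bar>\<close> with \<open>h = (a - b) / 2\<close>.\<close>

lemma exp_diff_lower:
  fixes a b :: real
  shows "(a - b)\<^sup>2 * (exp a * exp b) \<le> (exp a - exp b)\<^sup>2"
proof -
  define h where "h = (a - b) / 2"
  have "\<bar>h\<bar> \<le> \<bar>(exp h - inverse (exp h)) / 2\<bar>" by (rule real_le_abs_sinh)
  then have "\<bar>2 * h\<bar> \<le> \<bar>exp h - exp (- h)\<bar>" by (simp add: exp_minus)
  then have "(2 * h)\<^sup>2 \<le> (exp h - exp (- h))\<^sup>2" by (simp only: abs_le_square_iff)
  moreover have "2 * h = a - b" by (simp add: h_def)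
  ultimately have "(a - b)\<^sup>2 \<le> (exp h - exp (- h))\<^sup>2" by simp
  then have "(a - b)\<^sup>2 * exp ((a + b) / 2) ^ 2 \<le> (exp h - exp (- h))\<^sup>2 * exp ((a + b) / 2) ^ 2"
    by (intro mult_right_mono) auto
  also have "\<dots> = (exp h * exp ((a + b) / 2) - exp (- h) * exp ((a + b) / 2))\<^sup>2"
    by (simp add: power_mult_distrib[symmetric] left_diff_distrib)
  also have "\<dots> = (exp a - exp b)\<^sup>2"
    by (simp add: exp_add[symmetric] h_def field_simps add_divide_distrib[symmetric] diff_divide_distrib[symmetric])
  finally show ?thesis by (simp add: exp_add[symmetric] power2_eq_square)
qed

text \<open>By the law of cosines the squared distance splits exactly into a radial and an angular
  part. Measured by height and direction, the exponential thus expands at least by the geometric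
  mean of the radii.\<close>

lemma polar_dist_lower:
  fixes u v :: "'a::real_inner"
  assumes "norm u = 1" "norm v = 1" "c > 0"
  shows "(c * exp a) * (c * exp b) * ((a - b)\<^sup>2 + (dist u v)\<^sup>2) \<le> (dist ((c * exp a) *\<^sub>R u) ((c * exp b) *\<^sub>R v))\<^sup>2"
proof -
  have 1: "inner u u = 1" "inner v v = 1" using assms by (auto simp: norm_eq_1)
  have d: "(dist u v)\<^sup>2 = 2 - 2 * inner u v"
    by (simp add: dist_norm power2_norm_eq_inner inner_diff_left inner_diff_right 1 inner_commute)
  have "(dist (r *\<^sub>R u) (s *\<^sub>R v))\<^sup>2 = (r - s)\<^sup>2 + r * s * (dist u v)\<^sup>2" for r s
    unfolding d by (simp add: dist_norm power2_norm_eq_inner inner_diff_left inner_diff_right 1 inner_commute)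
       (simp add: power2_eq_square algebra_simps)
  moreover have "(c * exp a - c * exp b)\<^sup>2 \<ge> (c * exp a) * (c * exp b) * (a - b)\<^sup>2"
    using mult_left_mono[OF exp_diff_lower[of a b], of "c\<^sup>2"]
    by (simp add: power2_eq_square algebra_simps)
  ultimately show ?thesis by (simp add: algebra_simps)
qed

context zorich_map begin

text \<open>Stretching the vertical direction by \<open>lam * L\<close> gives it the same constant
  as the horizontal ones, which lose \<open>lam * L\<close> through \<open>Hm\<close>. Volume
  estimates then lose \<open>(lam * L)\<^sup>2\<close> instead of the cube.\<close>

lemma F_est:
  assumes "in_beam k (fst x)" "in_beam m (fst (snd x))"
    "in_beam k (fst y)" "in_beam m (fst (snd y))"
  shows "((fst y - fst x)\<^sup>2 + (fst (snd y) - fst (snd x))\<^sup>2 + (lam * L * (ht y - ht x))\<^sup>2) *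
     (norm (F x) * norm (F y)) \<le> (lam * L * dist (F x) (F y))\<^sup>2"
proof -
  define D where "D = dist (Hm (fst x) (fst (snd x))) (Hm (fst y) (fst (snd y)))"
  define Z where "Z = ht y - ht x"
  have "(fst y - fst x)\<^sup>2 + (fst (snd y) - fst (snd x))\<^sup>2 = (dist (base x) (base y))\<^sup>2"
    by (simp add: dist_Pair_Pair dist_real_def power2_commute)
  also have "\<dots> \<le> (lam * L * D)\<^sup>2"
    unfolding D_def by (intro power_mono Hm_bilip(2)[OF assms]) auto
  finally have "(fst y - fst x)\<^sup>2 + (fst (snd y) - fst (snd x))\<^sup>2 + (lam * L * Z)\<^sup>2 \<le> (lam * L)\<^sup>2 * (Z\<^sup>2 + D\<^sup>2)"
    by (simp add: power_mult_distrib algebra_simps)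
  then have "((fst y - fst x)\<^sup>2 + (fst (snd y) - fst (snd x))\<^sup>2 + (lam * L * Z)\<^sup>2) * (norm (F x) * norm (F y))
     \<le> (lam * L)\<^sup>2 * (Z\<^sup>2 + D\<^sup>2) * (norm (F x) * norm (F y))"
    by (intro mult_right_mono) auto
  also have "\<dots> = (lam * L)\<^sup>2 * (norm (F x) * norm (F y) * (Z\<^sup>2 + D\<^sup>2))" by simp
  also have "\<dots> \<le> (lam * L)\<^sup>2 * (dist (F x) (F y))\<^sup>2"
    using polar_dist_lower[of "Hm (fst x) (fst (snd x))" "Hm (fst y) (fst (snd y))" "nu * lam" "ht x" "ht y"] nu
    by (intro mult_left_mono) (auto simp: norm_F F_eq[symmetric] D_def Z_def power2_commute)
  finally show ?thesis by (simp add: Z_def power_mult_distrib)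
qed

lemma open_square_local:
  assumes "inside_beam k (fst x)" "inside_beam m (fst (snd x))"
  obtains \<delta> where "\<delta> > 0" "\<And>y :: R3. dist x y < \<delta> \<Longrightarrow>
      inside_beam k (fst y) \<and> inside_beam m (fst (snd y))"
proof -
  have "open {y :: R3. inside_beam k (fst y) \<and> inside_beam m (fst (snd y))}"
    by (intro open_Collect_conj open_Collect_less continuous_intros)
  then obtain \<delta> where "\<delta> > 0" and sub: "ball x \<delta> \<subseteq> {y. inside_beam k (fst y) \<and> inside_beam m (fst (snd y))}"
    using openE[of _ x] assms by blast
  show thesis
  proof (rule that[OF \<open>\<delta> > 0\<close>])
    fix y assume "dist x y < \<delta>"
    then have "y \<in> ball x \<delta>" by simp
    then show "inside_beam k (fst y) \<and> inside_beam m (fst (snd y))" using sub by blast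
  qed
qed

lemma F_expand:
  assumes A: "open A" and inj: "inj_on F A"
    and sq: "\<And>x. x \<in> A \<Longrightarrow> \<exists>k m. inside_beam k (fst x) \<and> inside_beam m (fst (snd x))"
    and f: "continuous_on A f" and g: "continuous_on (F ` A) g"
    and pos: "\<And>x. x \<in> A \<Longrightarrow> f x > 0" "\<And>x. x \<in> A \<Longrightarrow> g (F x) > 0"
    and fg: "\<And>x. x \<in> A \<Longrightarrow> f x * (lam * L)\<^sup>2 \<le> norm (F x) ^ 3 * g (F x)"
  shows "(\<integral>\<^sup>+x\<in>A. ennreal (f x) \<partial>lborel) \<le> (\<integral>\<^sup>+p\<in>F ` A. ennreal (g p) \<partial>lborel)"
proof (rule expansion_nn_integral_le[where e = "(0, 0, 1)" and k = "lam * L" and C = "lam * L"])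
  show "(0, 0, 1) \<in> (Basis :: (R3) set)" by (simp add: Basis_prod_def)
  fix x assume x: "x \<in> A"
  show "f x * (lam * L) ^ DIM(R3) \<le> lam * L * norm (F x) ^ DIM(R3) * g (F x)"
    using mult_left_mono[OF fg[OF x], of "lam * L"] by (simp add: power3_eq_cube power2_eq_square mult_ac)
  obtain k m where km: "inside_beam k (fst x)" "inside_beam m (fst (snd x))"
    using sq[OF x] by blast
  obtain \<delta> where \<delta>: "\<delta> > 0" "\<And>y :: R3. dist x y < \<delta> \<Longrightarrow>
      inside_beam k (fst y) \<and> inside_beam m (fst (snd y))"
    using open_square_local[OF km] by blast
  show "\<exists>\<delta>>0. \<forall>y\<in>A. dist x y < \<delta> \<longrightarrow>
       norm (y - x + ((lam * L - 1) * inner (y - x) (0, 0, 1)) *\<^sub>R (0, 0, 1)) * sqrt (norm (F x) * norm (F y))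
         \<le> lam * L * dist (F x) (F y)"
  proof (intro exI[of _ \<delta>] conjI ballI impI)
    fix y assume "dist x y < \<delta>"
    then have *: "in_beam k (fst y)" "in_beam m (fst (snd y))"
      using \<delta>(2)[of y] by auto
    have eq: "y - x + ((lam * L - 1) * inner (y - x) (0, 0, 1)) *\<^sub>R (0, 0, 1)
        = (fst y - fst x, fst (snd y) - fst (snd x), lam * L * (ht y - ht x))"
      by (simp add: prod_eq_iff inner_prod_def algebra_simps)
    have "(norm (y - x + ((lam * L - 1) * inner (y - x) (0, 0, 1)) *\<^sub>R (0, 0, 1)) * sqrt (norm (F x) * norm (F y)))\<^sup>2
        \<le> (lam * L * dist (F x) (F y))\<^sup>2"
      using F_est[of x k m y] km * unfolding eq norm_triple by (simp add: power_mult_distrib)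
    then show "norm (y - x + ((lam * L - 1) * inner (y - x) (0, 0, 1)) *\<^sub>R (0, 0, 1)) * sqrt (norm (F x) * norm (F y))
         \<le> lam * L * dist (F x) (F y)" by (rule power2_le_imp_le) simp
  qed (rule \<delta>(1))
qed (use assms F_cont in auto)

section \<open>The distance to the vertical axis under one step\<close>

definition rho :: "R3 \<Rightarrow> real" where "rho x = norm (base x)"

lemma rho_nonneg [simp]: "rho x \<ge> 0" by (simp add: rho_def)

lemma rho_cont [continuous_intros]: "continuous_on S g \<Longrightarrow> continuous_on S (\<lambda>x. rho (g x))"
  unfolding rho_def by (intro continuous_intros)

lemma norm_rho: "(norm x)\<^sup>2 = (rho x)\<^sup>2 + (ht x)\<^sup>2"
  by (cases x) (simp add: rho_def norm_Pair)

lemma norm_le_rho: "norm x \<le> rho x + \<bar>ht x\<bar>"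
  by (rule power2_le_imp_le) (auto simp: norm_rho power2_sum)

lemma third_le_norm: "\<bar>ht x\<bar> \<le> norm (x :: R3)"
  by (rule power2_le_imp_le) (auto simp: norm_rho)

lemma rho_scale: "rho (c *\<^sub>R x) = \<bar>c\<bar> * rho x"
  by (metis (mono_tags, lifting) fst_scaleR norm_scaleR rho_def scaleR_Pair snd_scaleR)

lemma rho_F: "rho (F x) = norm (F x) * rho (hh (fold_coord lam (fst x) / lam, fold_coord lam (fst (snd x)) / lam))"
proof -
  have "rho (reflp j w) = rho w" for j w by (simp add: rho_def)
  then show ?thesis using nu by (subst F_eq) (simp add: rho_scale Hm_def norm_F abs_mult)
qed

lemma rho_hemi:
  assumes w: "norm w = 1" "ht w \<ge> 0"
  shows "rho w \<le> dist w (0, 0, 1)" "dist w (0, 0, 1) \<le> 2 * rho w"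
proof -
  obtain a b c where abc: "w = (a, b, c)" by (metis prod.exhaust)
  have n: "a\<^sup>2 + b\<^sup>2 + c\<^sup>2 = 1" using w abc by (simp add: norm_triple)
  have r: "(rho w)\<^sup>2 = a\<^sup>2 + b\<^sup>2" by (simp add: rho_def abc norm_Pair)
  have d: "(dist w (0, 0, 1))\<^sup>2 = a\<^sup>2 + b\<^sup>2 + (c - 1)\<^sup>2" by (simp add: abc dist_Pair_Pair dist_real_def)
  show "rho w \<le> dist w (0, 0, 1)" by (rule power2_le_imp_le) (auto simp: r d)
  have "c\<^sup>2 \<le> 1" using n zero_le_power2[of a] zero_le_power2[of b] by linarith
  then have c: "c \<le> 1" "c \<ge> 0" using w abc power2_le_imp_le[of c 1] by auto
  \<comment> \<open>For \<open>0 \<le> c \<le> 1\<close>, \<open>(1 - c)\<^sup>2\<close> is at most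
    \<open>1 - c\<^sup>2\<close>, which equals \<open>(rho w)\<^sup>2\<close>.\<close>
  then have "(1 - c) * (1 - c) \<le> (1 - c) * (1 + c)" by (intro mult_left_mono) auto
  then have "(c - 1)\<^sup>2 \<le> a\<^sup>2 + b\<^sup>2" using n by (simp add: power2_eq_square algebra_simps)
  note c1 = this
  show "dist w (0, 0, 1) \<le> 2 * rho w"
  proof (rule power2_le_imp_le[of _ "2 * rho w"])
    show "(dist w (0, 0, 1))\<^sup>2 \<le> (2 * rho w)\<^sup>2"
    proof -
      have four: "(2::real)\<^sup>2 = 4" by simp
      show ?thesis unfolding d power_mult_distrib r four distrib_left
        using c1 zero_le_power2[of a] zero_le_power2[of b] by linarith
    qed
  qed simp
qed

text \<open>The Lipschitz bound for \<open>hh\<close> at the centre, whose image is the pole. It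
  holds in all beams because folding never increases the distance from 0.\<close>

lemma rho_upper: "rho (F x) \<le> L / lam * norm (F x) * rho x"
proof -
  define y where "y = (fold_coord lam (fst x) / lam, fold_coord lam (fst (snd x)) / lam)"
  have y: "y \<in> sqQ" using fold_bound by (simp add: y_def sqQ_def)
  have 0: "(0, 0) \<in> sqQ" by (simp add: sqQ_def)
  have "rho (hh y) \<le> dist (hh y) (hh (0, 0))" using rho_hemi(1)[OF hh_hemi[OF y]] by (simp add: hh_origin)
  also have "\<dots> \<le> L * dist y (0, 0)" by (rule hh_upper[OF y 0])
  also have "dist y (0, 0) \<le> rho x / lam"
  proof -
    have "(fold_coord lam t / lam)\<^sup>2 \<le> t\<^sup>2 / lam\<^sup>2" for t
      using fold_le_abs[of t] by (simp add: power_divide divide_right_mono abs_le_square_iff)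
    then have "(dist y (0, 0))\<^sup>2 \<le> (rho x / lam)\<^sup>2"
      by (simp add: y_def rho_def dist_Pair_Pair norm_Pair power_divide add_divide_distrib add_mono)
    then show ?thesis by (rule power2_le_imp_le) simp
  qed
  finally have "rho (hh y) \<le> L / lam * rho x" by (simp add: mult_left_mono)
  then have "norm (F x) * rho (hh y) \<le> norm (F x) * (L / lam * rho x)" by (intro mult_left_mono) auto
  then show ?thesis unfolding rho_F y_def[symmetric] by (simp add: mult_ac)
qed

lemma central_beam:
  assumes "rho x < lam"
  shows "beam_index lam (fst x) = 0" "beam_index lam (fst (snd x)) = 0"
proof -
  have "\<bar>fst x\<bar> < lam" "\<bar>fst (snd x)\<bar> < lam"
    using assms norm_fst_le[of "fst x" "fst (snd x)"] norm_snd_le[of "fst (snd x)" "fst x"] by (auto simp: rho_def)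
  then show "beam_index lam (fst x) = 0" "beam_index lam (fst (snd x)) = 0"
    by (auto intro!: beam_index_eq)
qed

lemma central_third:
  assumes "rho x < lam" shows "ht (F x) \<ge> 0"
proof -
  define y where "y = (fold_coord lam (fst x) / lam, fold_coord lam (fst (snd x)) / lam)"
  have y: "y \<in> sqQ" using fold_bound by (simp add: y_def sqQ_def)
  show ?thesis using nu hh_hemi(2)[OF y] central_beam[OF assms] by (simp add: F_eq Hm_def y_def reflp_def)
qed

text \<open>The source of repulsion: in the central beam, at heights with
  \<open>nu * exp (ht x) \<ge> 2 * L\<close>, the distance to the axis does not decrease.\<close>

lemma rho_lower:
  assumes "rho x < lam"
  shows "nu * exp (ht x) / (2 * L) * rho x \<le> rho (F x)"
proof -
  define y where "y = (fst x / lam, fst (snd x) / lam)"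
  have fd: "fold_coord lam (fst x) = fst x" "fold_coord lam (fst (snd x)) = fst (snd x)"
    using central_beam[OF assms] by (auto simp: fold_eq pm_def)
  have y: "y \<in> sqQ" using fold_bound[of "fst x"] fold_bound[of "fst (snd x)"] by (simp add: y_def sqQ_def fd)
  have 0: "(0, 0) \<in> sqQ" by (simp add: sqQ_def)
  have "rho x / lam = dist y (0, 0)"
    by (simp add: y_def rho_def dist_Pair_Pair norm_Pair power_divide add_divide_distrib[symmetric] real_sqrt_divide)
  also have "\<dots> \<le> L * dist (hh y) (hh (0, 0))" by (rule hh_lower[OF y 0])
  also have "\<dots> \<le> L * (2 * rho (hh y))"
    using rho_hemi(2)[OF hh_hemi[OF y]] by (intro mult_left_mono) (auto simp: hh_origin)
  finally have "rho x / lam / (2 * L) \<le> rho (hh y)" by (simp add: field_simps)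
  then have "norm (F x) * (rho x / lam / (2 * L)) \<le> norm (F x) * rho (hh y)" by (intro mult_left_mono) auto
  also have "\<dots> = rho (F x)" by (simp add: rho_F fd y_def)
  finally show ?thesis by (simp add: norm_F mult_ac)
qed

lemma a_gt_1: "nu * lam > 1"
proof -
  have "sqrt (2 * L / lam) * lam = sqrt (2 * L / lam) * sqrt (lam * lam)" by simp
  also have "\<dots> = sqrt (2 * L * lam)" by (subst real_sqrt_mult[symmetric]) simp
  finally have "sqrt (2 * L * lam) < nu * lam" using nu by (metis lam_pos(1) mult_strict_right_mono)
  moreover have "L * lam \<ge> 1 * 1" using L lam by (intro mult_mono) auto
  then have "sqrt (2 * L * lam) \<ge> 1" by simp
  ultimately show ?thesis by linarith
qed

text \<open>The alternative of being low is eventually impossible, so the orbit stays in the central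
  beam with distance to the axis tending to 0. Its height then grows without bound, and
  \<open>rho_lower\<close> keeps the distance away from 0.\<close>

lemma orbit_contradiction:
  fixes y :: "nat \<Rightarrow> R3" and \<theta> :: real
  assumes y: "\<And>n. y (Suc n) = F (y n)" and pos: "\<And>n. rho (y n) > 0"
    and \<theta>: "0 < \<theta>" "\<theta> < 1"
    and ev: "\<And>n. n \<ge> N \<Longrightarrow> rho (y n) \<le> \<theta> ^ n \<or> ht (y n) \<le> - (nu * lam)"
  shows False
proof -
  define a where "a = nu * lam"
  have a: "a > 1" using a_gt_1 by (simp add: a_def)
  have nF: "norm (y (Suc n)) = a * exp (ht (y n))" for n by (simp add: y norm_F a_def)
  have "(\<lambda>n. \<theta> ^ n) \<longlonglongrightarrow> 0" using \<theta> by (intro LIMSEQ_realpow_zero) auto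
  then have "eventually (\<lambda>n. \<theta> ^ n < min (1/2) lam) sequentially"
    by (rule order_tendstoD) simp
  then obtain N1 where N1: "\<And>n. n \<ge> N1 \<Longrightarrow> \<theta> ^ n < min (1/2) lam" by (auto simp: eventually_sequentially)
  define N2 where "N2 = max N N1"
  \<comment> \<open>A low point has norm at least \<open>a\<close>, so its predecessor has
    nonnegative height and is itself close to the axis. But the central beam is mapped into the
    upper half-space.\<close>
  have small: "rho (y (Suc n)) \<le> \<theta> ^ Suc n" if n: "n \<ge> N2" for n
  proof (rule ccontr)
    assume c: "\<not> rho (y (Suc n)) \<le> \<theta> ^ Suc n"
    then have z: "ht (y (Suc n)) \<le> - a" using ev[of "Suc n"] n by (auto simp: N2_def a_def)
    then have "norm (y (Suc n)) \<ge> a" using third_le_norm[of "y (Suc n)"] by linarith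
    then have "exp (ht (y n)) \<ge> 1" using a by (simp add: nF)
    then have "ht (y n) \<ge> 0" by simp
    then have "rho (y n) \<le> \<theta> ^ n" using ev[of n] n a by (auto simp: N2_def a_def)
    then have "rho (y n) < lam" using N1[of n] n by (auto simp: N2_def)
    then have "ht (y (Suc n)) \<ge> 0" unfolding y by (rule central_third)
    then show False using z a by linarith
  qed
  have cen: "rho (y (Suc n)) < lam" "rho (y (Suc n)) < 1 / 2" if "n \<ge> N2" for n
    using small[OF that] N1[of "Suc n"] that by (auto simp: N2_def)
  have z0: "ht (y (Suc (Suc n))) \<ge> 0" if "n \<ge> N2" for n
    using central_third[OF cen(1)[OF that]] by (simp add: y)
  define z where "z = (\<lambda>k. ht (y (Suc (Suc (N2 + k)))))"
  \<comment> \<open>Since \<open>a * exp z \<ge> 1 + z\<close>, the new norm exceeds the old height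
    by at least 1, and at most \<open>1 / 2\<close> of it is horizontal.\<close>
  have zs: "z (Suc k) \<ge> z k + 1 / 2" for k
  proof -
    let ?n = "Suc (Suc (N2 + k))"
    have z: "z (Suc k) \<ge> 0" "z k \<ge> 0" using z0[of "N2 + Suc k"] z0[of "N2 + k"] by (auto simp: z_def)
    have "1 + z k = 1 * (1 + z k)" by simp
    also have "\<dots> \<le> a * (1 + z k)" using z(2) a by (intro mult_right_mono) auto
    also have "\<dots> \<le> norm (y (Suc ?n))"
      unfolding nF using exp_ge_add_one_self[of "z k"] a by (simp add: z_def)
    also have "\<dots> \<le> rho (y (Suc ?n)) + \<bar>ht (y (Suc ?n))\<bar>" by (rule norm_le_rho)
    also have "\<bar>ht (y (Suc ?n))\<bar> = z (Suc k)" using z by (simp add: z_def)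
    also have "rho (y (Suc ?n)) \<le> 1 / 2" using cen(2)[of ?n] by simp
    finally show ?thesis by linarith
  qed
  have zk: "z k \<ge> real k / 2" for k
  proof (induction k)
    case 0
    show ?case using z0[of N2] by (simp add: z_def)
  next
    case (Suc k)
    then show ?case using zs[of k] by (simp add: field_simps)
  qed
  \<comment> \<open>From this time on, the factor in \<open>rho_lower\<close> is at least 1.\<close>
  obtain K where K: "real K / 2 \<ge> 2 * L / nu" using real_arch_simple[of "2 * (2 * L / nu)"] by (auto simp: field_simps)
  have mono: "rho (y (Suc (Suc (N2 + K + k)))) \<ge> rho (y (Suc (Suc (N2 + K))))" for k
  proof (induction k)
    case (Suc k)
    let ?n = "Suc (Suc (N2 + K + k))"
    have "2 * L / nu \<le> z (K + k)" using zk[of "K + k"] K by (simp add: add_divide_distrib)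
    also have "\<dots> \<le> exp (z (K + k))" using exp_ge_add_one_self[of "z (K + k)"] by linarith
    finally have "1 \<le> nu * exp (z (K + k)) / (2 * L)" using nu by (simp add: field_simps)
    then have "1 * rho (y ?n) \<le> nu * exp (z (K + k)) / (2 * L) * rho (y ?n)" by (intro mult_right_mono) auto
    also have "\<dots> \<le> rho (y (Suc ?n))"
      using rho_lower[OF cen(1), of "Suc (N2 + K + k)"] by (simp add: y z_def add.assoc)
    finally show ?case using Suc by simp
  qed simp
  have "(\<lambda>n. \<theta> ^ n) \<longlonglongrightarrow> 0" using \<theta> by (intro LIMSEQ_realpow_zero) auto
  then have "eventually (\<lambda>n. \<theta> ^ n < rho (y (Suc (Suc (N2 + K))))) sequentially"
    by (rule order_tendstoD) (rule pos)
  then obtain M where M: "\<And>n. n \<ge> M \<Longrightarrow> \<theta> ^ n < rho (y (Suc (Suc (N2 + K))))" by (auto simp: eventually_sequentially)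
  have "rho (y (Suc (Suc (N2 + K + M)))) \<le> \<theta> ^ (Suc (Suc (N2 + K + M)))" by (rule small) simp
  then show False using mono[of M] M[of "Suc (Suc (N2 + K + M))"] by simp
qed

section \<open>Beams over tiles and the volume they can carry\<close>

definition otile :: "int \<Rightarrow> int \<Rightarrow> (R3) set" where
  "otile a b = {x. 2 * lam * of_int a < fst x + fst (snd x) \<and> fst x + fst (snd x) < 2 * lam * of_int (a + 1) \<and>
                   2 * lam * of_int b < fst x - fst (snd x) \<and> fst x - fst (snd x) < 2 * lam * of_int (b + 1)}"

text \<open>This is the grid of planes through the diagonals of all squares, the preimage of the two
  planes \<open>x1 = \<plusminus>x2\<close>; its complement is the union of the open beams over
  tiles.\<close>

definition planes :: "(R3) set" where
  "planes = {x. \<exists>j::int. fst x + fst (snd x) = 2 * lam * of_int j \<or> fst x - fst (snd x) = 2 * lam * of_int j}"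

lemma otile_tile: "x \<in> otile a b \<Longrightarrow> base x \<in> tile a b"
  by (auto simp: otile_def tile_def)

lemma connected_avoiding_multiples:
  fixes f :: "'a::topological_space \<Rightarrow> real"
  assumes "connected S" "continuous_on S f" "S \<noteq> {}" "c > 0" and av: "\<And>x (j::int). x \<in> S \<Longrightarrow> f x \<noteq> c * of_int j"
  obtains a :: int where "\<And>x. x \<in> S \<Longrightarrow> c * of_int a < f x \<and> f x < c * of_int (a + 1)"
proof -
  obtain x0 where x0: "x0 \<in> S" using assms by auto
  define a where "a = \<lfloor>f x0 / c\<rfloor>"
  have "of_int a \<le> f x0 / c" "f x0 / c < of_int a + 1" unfolding a_def by linarith+
  then have a: "c * of_int a \<le> f x0" "f x0 < c * of_int (a + 1)" using \<open>c > 0\<close> by (auto simp: field_simps)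
  have conn: "connected (f ` S)" using assms by (intro connected_continuous_image)
  show thesis
  proof (rule that[of a])
    fix x assume x: "x \<in> S"
    have "c * of_int a < f x"
    proof (rule ccontr)
      assume "\<not> c * of_int a < f x"
      then have "c * of_int a \<in> f ` S"
        using connectedD_interval[OF conn, of "f x" "f x0" "c * of_int a"] x x0 a by auto
      then show False using av by (metis imageE)
    qed
    moreover have "f x < c * of_int (a + 1)"
    proof (rule ccontr)
      assume "\<not> f x < c * of_int (a + 1)"
      then have "c * of_int (a + 1) \<in> f ` S"
        using connectedD_interval[OF conn, of "f x0" "f x" "c * of_int (a + 1)"] x x0 a by auto
      then show False using av by (metis imageE)
    qed
    ultimately show "c * of_int a < f x \<and> f x < c * of_int (a + 1)" by simp
  qed
qed

lemma connected_in_otile: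
  assumes "connected S" "S \<noteq> {}" "S \<inter> planes = {}"
  obtains a b where "S \<subseteq> otile a b"
proof -
  have n: "\<And>x (j::int). x \<in> S \<Longrightarrow> fst x + fst (snd x) \<noteq> 2 * lam * of_int j"
    "\<And>x (j::int). x \<in> S \<Longrightarrow> fst x - fst (snd x) \<noteq> 2 * lam * of_int j"
    using assms by (auto simp: planes_def)
  have c: "continuous_on S (\<lambda>x. fst x + fst (snd x))" "continuous_on S (\<lambda>x. fst x - fst (snd x))"
    by (intro continuous_intros)+
  have p: "2 * lam > 0" by simp
  obtain a where a: "\<And>x. x \<in> S \<Longrightarrow> 2 * lam * of_int a < fst x + fst (snd x) \<and> fst x + fst (snd x) < 2 * lam * of_int (a + 1)"
    using connected_avoiding_multiples[OF assms(1) c(1) assms(2) p n(1)] by blast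
  obtain b where b: "\<And>x. x \<in> S \<Longrightarrow> 2 * lam * of_int b < fst x - fst (snd x) \<and> fst x - fst (snd x) < 2 * lam * of_int (b + 1)"
    using connected_avoiding_multiples[OF assms(1) c(2) assms(2) p n(2)] by blast
  show thesis using a b by (intro that[of a b]) (auto simp: otile_def)
qed

lemma F_eqD:
  assumes "F x = F y"
  shows "ht x = ht y" "Hm (fst x) (fst (snd x)) = Hm (fst y) (fst (snd y))"
proof -
  have "norm (F x) = norm (F y)" using assms by simp
  then show 1: "ht x = ht y" using nu by (simp add: norm_F)
  show "Hm (fst x) (fst (snd x)) = Hm (fst y) (fst (snd y))" using assms nu by (simp add: F_eq 1)
qed

lemma F_inj_tile: "inj_on F {x. base x \<in> tile a b}"
proof (rule inj_onI)
  fix x y assume "x \<in> {x. base x \<in> tile a b}" "y \<in> {x. base x \<in> tile a b}" "F x = F y"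
  then show "x = y" using F_eqD[of x y] tile_inj[of "fst x" "fst (snd x)" a b "fst y" "fst (snd y)"] by (auto simp: prod_eq_iff)
qed

definition mirrors :: "(R3) set" where
  "mirrors = {x. \<exists>k::int. fst x = (2 * of_int k + 1) * lam \<or> fst (snd x) = (2 * of_int k + 1) * lam}"

lemma off_mirrors: "x \<notin> mirrors \<longleftrightarrow> (\<exists>k m. inside_beam k (fst x) \<and> inside_beam m (fst (snd x)))"
proof
  assume x: "x \<notin> mirrors"
  have "inside_beam (beam_index lam t) t" if "\<And>k::int. t \<noteq> (2 * of_int k + 1) * lam" for t
  proof -
    have "t \<noteq> (2 * of_int (beam_index lam t - 1) + 1) * lam" by (rule that)
    then have "t \<noteq> (2 * of_int (beam_index lam t) - 1) * lam" by (simp add: algebra_simps)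
    then show ?thesis using beam_bounds[of t] by (auto simp: algebra_simps abs_less_iff)
  qed
  then show "\<exists>k m. inside_beam k (fst x) \<and> inside_beam m (fst (snd x))"
    using x unfolding mirrors_def by blast
next
  have no: False if "inside_beam k t" "t = (2 * of_int j + 1) * lam" for t and j k :: int
  proof -
    have "t - 2 * of_int k * lam = of_int (2 * (j - k) + 1) * lam" using that(2) by (simp add: algebra_simps)
    then have "\<bar>real_of_int (2 * (j - k) + 1)\<bar> * lam < 1 * lam" using that(1) by (simp add: abs_mult)
    then have "\<bar>real_of_int (2 * (j - k) + 1)\<bar> < 1" by (simp only: mult_less_cancel_right_pos[OF lam_pos(1)])
    then have "2 * (j - k) + 1 = 0" by linarith
    then show False by presburger
  qed
  assume "\<exists>k m. inside_beam k (fst x) \<and> inside_beam m (fst (snd x))"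
  then show "x \<notin> mirrors" using no unfolding mirrors_def by blast
qed

lemma mirrors_closed: "closed mirrors"
proof -
  have "open (- mirrors)"
  proof -
    have "- mirrors = (\<Union>k::int. \<Union>m::int. {x. inside_beam k (fst x) \<and> inside_beam m (fst (snd x))})"
      (is "_ = ?U")
    proof (rule set_eqI)
      show "x \<in> - mirrors \<longleftrightarrow> x \<in> ?U" for x using off_mirrors[of x] by simp
    qed
    then show ?thesis by (auto intro!: open_UN open_Collect_conj open_Collect_less continuous_intros)
  qed
  then show ?thesis by (simp add: closed_def)
qed

lemma mirrors_null: "mirrors \<in> null_sets lborel"
proof -
  have h: "{x :: R3. fst x = c} \<in> null_sets lborel" "{x :: R3. fst (snd x) = c} \<in> null_sets lborel" for c
    using hyperplane_null[of "(1, 0, 0) :: R3" c] hyperplane_null[of "(0, 1, 0) :: R3" c]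
    by (simp_all add: zero_prod_def inner_prod_def)
  have "mirrors = (\<Union>k::int. {x. fst x = (2 * of_int k + 1) * lam} \<union> {x. fst (snd x) = (2 * of_int k + 1) * lam})"
    by (auto simp: mirrors_def)
  then show ?thesis by (auto intro!: null_sets_UN null_sets.Un h)
qed

lemma nn_integral_minus_null:
  fixes N :: "'a::euclidean_space set"
  assumes "N \<in> null_sets lborel"
  shows "(\<integral>\<^sup>+x\<in>A. f x \<partial>lborel) = (\<integral>\<^sup>+x\<in>A - N. f x \<partial>lborel)"
proof (rule nn_integral_cong_AE)
  show "AE x in lborel. f x * indicator A x = f x * indicator (A - N) x"
    using AE_not_in[OF assms] by eventually_elim (auto simp: indicator_def)
qed

lemma F_expand_tile:
  assumes A: "open A" and ti: "A \<subseteq> otile a b"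
    and f: "continuous_on A f" and g: "continuous_on (F ` A) g"
    and pos: "\<And>x. x \<in> A \<Longrightarrow> f x > 0" "\<And>x. x \<in> A \<Longrightarrow> g (F x) > 0"
    and fg: "\<And>x. x \<in> A \<Longrightarrow> f x * (lam * L)\<^sup>2 \<le> norm (F x) ^ 3 * g (F x)"
  shows "(\<integral>\<^sup>+x\<in>A. ennreal (f x) \<partial>lborel) \<le> (\<integral>\<^sup>+p\<in>F ` A. ennreal (g p) \<partial>lborel)"
proof -
  have "(\<integral>\<^sup>+x\<in>A. ennreal (f x) \<partial>lborel) = (\<integral>\<^sup>+x\<in>A - mirrors. ennreal (f x) \<partial>lborel)"
    by (rule nn_integral_minus_null[OF mirrors_null])
  also have "\<dots> \<le> (\<integral>\<^sup>+p\<in>F ` (A - mirrors). ennreal (g p) \<partial>lborel)"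
  proof (rule F_expand)
    show "open (A - mirrors)" using A mirrors_closed by (rule open_Diff)
    show "inj_on F (A - mirrors)" using ti otile_tile by (intro inj_on_subset[OF F_inj_tile[of a b]]) blast
    show "\<exists>k m. inside_beam k (fst x) \<and> inside_beam m (fst (snd x))" if "x \<in> A - mirrors" for x
      using that off_mirrors[of x] by auto
  qed (use assms in \<open>auto intro: continuous_on_subset\<close>)
  also have "\<dots> \<le> (\<integral>\<^sup>+p\<in>F ` A. ennreal (g p) \<partial>lborel)"
    by (intro nn_integral_mono) (auto simp: indicator_def)
  finally show ?thesis .
qed

lemma F_open: "open A \<Longrightarrow> A \<subseteq> otile a b \<Longrightarrow> open (F ` A)"
  by (rule invariance_of_domain[OF F_cont _ inj_on_subset[OF F_inj_tile[of a b]]]) (use otile_tile in blast)+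

text \<open>A beam meets a ball of radius \<open>r\<close> in volume of order \<open>r\<close>
  rather than \<open>r ^ 3\<close>; this is the gain that bounds volumes at great heights.\<close>

lemma otile_slab_volume:
  assumes "r \<ge> 0"
  shows "vol (otile a b \<inter> {x. norm x \<le> r}) \<le> ennreal (8 * lam\<^sup>2 * r)"
proof -
  define A B where "A = lam * of_int a" and "B = lam * of_int b"
  define l u :: R3 where
    "l = (A + B, A - B - lam, - r)" and "u = (A + B + 2 * lam, A - B + lam, r)"
  have le: "\<And>c. c \<in> Basis \<Longrightarrow> inner l c \<le> inner u c"
    using assms by (auto simp: Basis_prod_def l_def u_def inner_prod_def)
  have "otile a b \<inter> {x. norm x \<le> r} \<subseteq> cbox l u"
  proof
    fix x assume x: "x \<in> otile a b \<inter> {x. norm x \<le> r}"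
    obtain p q z where pqz: "x = (p, q, z)" by (metis prod.exhaust)
    have "2 * A < p + q" "p + q < 2 * A + 2 * lam" "2 * B < p - q" "p - q < 2 * B + 2 * lam"
      using x by (auto simp: pqz otile_def A_def B_def algebra_simps)
    moreover have "\<bar>z\<bar> \<le> r" using x third_le_norm[of x] by (auto simp: pqz)
    ultimately show "x \<in> cbox l u" by (simp add: pqz l_def u_def cbox_Pair_eq abs_le_iff)
  qed
  then have "vol (otile a b \<inter> {x. norm x \<le> r}) \<le> vol (cbox l u)"
    by (rule emeasure_mono) simp
  also have "\<dots> = ennreal (\<Prod>c\<in>Basis. inner (u - l) c)" by (rule emeasure_lborel_cbox[OF le])
  also have "(\<Prod>c\<in>Basis. inner (u - l) c) = (2 * lam) * ((2 * lam) * (2 * r))"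
  proof -
    have "(\<Prod>c\<in>(Basis :: (R3) set). inner (u - l) c) = (\<Prod>c\<in>{(1,0,0),(0,1,0),(0,0,1)}. inner (u - l) c)"
      by (rule prod.cong) (auto simp: Basis_prod_def zero_prod_def)
    then show ?thesis by (simp add: l_def u_def inner_prod_def algebra_simps)
  qed
  finally show ?thesis by (simp add: power2_eq_square algebra_simps)
qed

text \<open>The image of the slice lies in one beam between radii \<open>r\<close> and
  \<open>r * exp 2\<close>, hence in volume of order \<open>r\<close>, while \<open>F\<close>
  expands volume by order \<open>r ^ 3\<close>. With \<open>r\<close> proportional to
  \<open>exp t\<close> this leaves \<open>exp (- 2 * t)\<close>.\<close>

lemma slice_volume:
  assumes A: "open A" "A \<subseteq> otile a b" and FA: "F ` A \<subseteq> otile a' b'" and z: "\<And>x. x \<in> A \<Longrightarrow> t < ht x \<and> ht x < t + 2"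
  shows "vol A \<le> ennreal (8 * lam\<^sup>2 * (lam * L)\<^sup>2 * exp 2 / (nu * lam)\<^sup>2 * exp (- 2 * t))"
proof -
  define r where "r = nu * lam * exp t"
  have r: "r > 0" using nu by (simp add: r_def)
  have nF: "r \<le> norm (F x)" "norm (F x) \<le> r * exp 2" if "x \<in> A" for x
  proof -
    show "r \<le> norm (F x)" using z[OF that] nu by (simp add: norm_F r_def)
    have "r * exp 2 = nu * lam * exp (t + 2)" by (simp add: r_def exp_add)
    then show "norm (F x) \<le> r * exp 2" using z[OF that] nu by (simp add: norm_F)
  qed
  have "vol A = (\<integral>\<^sup>+x\<in>A. ennreal 1 \<partial>lborel)" using A by simp
  also have "\<dots> \<le> (\<integral>\<^sup>+p\<in>F ` A. ennreal ((lam * L)\<^sup>2 / norm p ^ 3) \<partial>lborel)"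
    by (rule F_expand_tile[OF A]) (auto intro!: continuous_intros divide_pos_pos zero_less_power)
  also have "\<dots> \<le> (\<integral>\<^sup>+p. ennreal ((lam * L)\<^sup>2 / r ^ 3) * indicator (otile a' b' \<inter> {x. norm x \<le> r * exp 2}) p \<partial>lborel)"
  proof (intro nn_integral_mono)
    fix p
    show "ennreal ((lam * L)\<^sup>2 / norm p ^ 3) * indicator (F ` A) p
      \<le> ennreal ((lam * L)\<^sup>2 / r ^ 3) * indicator (otile a' b' \<inter> {x. norm x \<le> r * exp 2}) p"
    proof (cases "p \<in> F ` A")
      case True
      then have "r \<le> norm p" "norm p \<le> r * exp 2" "p \<in> otile a' b'" using nF FA by auto
      moreover have "(lam * L)\<^sup>2 / norm p ^ 3 \<le> (lam * L)\<^sup>2 / r ^ 3"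
        using \<open>r \<le> norm p\<close> r by (intro divide_left_mono power_mono mult_pos_pos zero_less_power) auto
      ultimately show ?thesis using True by (auto intro!: ennreal_leI)
    qed simp
  qed
  also have "\<dots> = ennreal ((lam * L)\<^sup>2 / r ^ 3) * vol (otile a' b' \<inter> {x. norm x \<le> r * exp 2})"
  proof (rule nn_integral_cmult_indicator)
    have "open (otile a' b')" unfolding otile_def by (intro open_Collect_conj open_Collect_less continuous_intros)
    then show "otile a' b' \<inter> {x. norm x \<le> r * exp 2} \<in> sets lborel"
      by (auto intro!: sets.Int borel_open borel_closed closed_Collect_le continuous_intros)
  qed
  also have "\<dots> \<le> ennreal ((lam * L)\<^sup>2 / r ^ 3) * ennreal (8 * lam\<^sup>2 * (r * exp 2))"
    using r by (intro mult_left_mono otile_slab_volume) auto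
  also have "\<dots> = ennreal ((lam * L)\<^sup>2 / r ^ 3 * (8 * lam\<^sup>2 * (r * exp 2)))"
    using r by (intro ennreal_mult[symmetric]) auto
  also have "(lam * L)\<^sup>2 / r ^ 3 * (8 * lam\<^sup>2 * (r * exp 2)) = 8 * lam\<^sup>2 * (lam * L)\<^sup>2 * exp 2 / r\<^sup>2"
    using r by (simp add: power3_eq_cube power2_eq_square field_simps)
  also have "r\<^sup>2 = (nu * lam)\<^sup>2 * exp (2 * t)" by (simp add: r_def power_mult_distrib exp_double)
  finally show ?thesis by (simp add: exp_minus field_simps)
qed

text \<open>Sum of the slices above height \<open>- Z\<close>. The bound is uniform in the set and
  in the tiles, so it serves all iterates at once.\<close>

lemma upper_volume:
  obtains C where "C \<ge> 0" "\<And>A a b a' b'. open A \<Longrightarrow> A \<subseteq> otile a b \<Longrightarrow> F ` A \<subseteq> otile a' b' \<Longrightarrow>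
     (\<And>x. x \<in> A \<Longrightarrow> ht x > - Z) \<Longrightarrow> vol A \<le> ennreal C"
proof -
  define D where "D = 8 * lam\<^sup>2 * (lam * L)\<^sup>2 * exp 2 / (nu * lam)\<^sup>2"
  show thesis
  proof (rule that[of "D * exp (- 2 * (- Z - 1)) / (1 - exp (- 2))"])
    fix A a b a' b' assume A: "open A" "A \<subseteq> otile a b" "F ` A \<subseteq> otile a' b'" "\<And>x. x \<in> A \<Longrightarrow> ht x > - Z"
    show "vol A \<le> ennreal (D * exp (- 2 * (- Z - 1)) / (1 - exp (- 2)))"
    proof (rule volume_le_by_slices[OF A(1), where z = "\<lambda>x. ht x"])
      fix S t assume S: "open S" "S \<subseteq> A" "\<And>x. x \<in> S \<Longrightarrow> t < ht x \<and> ht x < t + 2"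
      have "S \<subseteq> otile a b" "F ` S \<subseteq> otile a' b'" using A(2,3) S(2) by blast+
      then show "vol S \<le> ennreal (D * exp (- 2 * t))" unfolding D_def using S by (intro slice_volume)
    qed (use A(4) in \<open>auto simp: D_def less_imp_le intro!: continuous_intros\<close>)
  qed (simp add: D_def)
qed

lemma rho_pos: "x \<notin> planes \<Longrightarrow> rho x > 0"
proof (rule ccontr)
  assume x: "x \<notin> planes" and "\<not> rho x > 0"
  then have "rho x = 0" using rho_nonneg[of x] by linarith
  then have "norm (base x) = 0" unfolding rho_def .
  then have "fst x = 0" "fst (snd x) = 0" by (auto simp: zero_prod_def)
  then show False using x unfolding planes_def by (auto intro: exI[of _ 0])
qed

lemma otile_planes: "x \<in> otile a b \<Longrightarrow> x \<notin> planes"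
proof
  assume x: "x \<in> otile a b" "x \<in> planes"
  have no: False if "2 * lam * of_int a < 2 * lam * of_int j" "2 * lam * of_int j < 2 * lam * of_int (a + 1)" for a j :: int
    using that by auto
  show False using x no unfolding otile_def planes_def by fastforce
qed

section \<open>Weighted expansion and Borel-Cantelli\<close>

definition wt :: "R3 \<Rightarrow> ennreal" where "wt x = ennreal (1 / rho x ^ 3)"

lemma wt_measurable [measurable]: "wt \<in> borel_measurable borel"
proof -
  have [measurable]: "rho \<in> borel_measurable borel"
    by (intro borel_measurable_continuous_onI rho_cont continuous_on_id)
  show ?thesis unfolding wt_def by measurable
qed

abbreviation wmass :: "R3 set \<Rightarrow> ennreal" where
  "wmass A \<equiv> \<integral>\<^sup>+x\<in>A. wt x \<partial>lborel"

lemma weighted_expand: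
  assumes A: "open A" "A \<subseteq> otile a b" and FA: "F ` A \<inter> planes = {}"
  shows "wmass A \<le> ennreal (L ^ 5 / lam) * wmass (F ` A)"
proof -
  have r: "rho x > 0" "rho (F x) > 0" if "x \<in> A" for x
    using that A(2) FA otile_planes rho_pos by blast+
  have "wmass A = (\<integral>\<^sup>+x\<in>A. ennreal (1 / rho x ^ 3) \<partial>lborel)" by (simp add: wt_def)
  also have "\<dots> \<le> (\<integral>\<^sup>+p\<in>F ` A. ennreal (L ^ 5 / lam * (1 / rho p ^ 3)) \<partial>lborel)"
  proof (rule F_expand_tile[OF A])
    fix x assume x: "x \<in> A"
    have "rho (F x) ^ 3 \<le> (L / lam * norm (F x) * rho x) ^ 3" by (intro power_mono rho_upper) simp
    then have "(lam * L)\<^sup>2 * rho (F x) ^ 3 \<le> (lam * L)\<^sup>2 * (L / lam * norm (F x) * rho x) ^ 3"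
      by (intro mult_left_mono) auto
    also have "\<dots> = L ^ 5 / lam * (norm (F x) ^ 3 * rho x ^ 3)"
      by (simp add: power2_eq_square power3_eq_cube field_simps eval_nat_numeral)
    finally show "1 / rho x ^ 3 * (lam * L)\<^sup>2 \<le> norm (F x) ^ 3 * (L ^ 5 / lam * (1 / rho (F x) ^ 3))"
      using r[OF x] by (simp add: field_simps)
  qed (use r in \<open>fastforce intro!: continuous_intros\<close>)+
  also have "\<dots> = (\<integral>\<^sup>+p. ennreal (L ^ 5 / lam) * (wt p * indicator (F ` A) p) \<partial>lborel)"
    unfolding wt_def by (subst ennreal_mult) (auto simp: mult.assoc)
  also have "\<dots> = ennreal (L ^ 5 / lam) * wmass (F ` A)"
    using F_open[OF A] by (intro nn_integral_cmult) simp
  finally show ?thesis .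
qed

lemma funpow_F_cont: "continuous_on S (F ^^ n)"
proof (induction n)
  case (Suc n)
  then show ?case using continuous_on_compose[OF Suc F_cont] by (simp add: o_def)
qed simp

lemma iterates_hit_planes:
  assumes r: "r > 0"
  shows "\<exists>n. \<exists>x\<in>ball c r. (F ^^ n) x \<in> planes"
proof (rule ccontr)
  assume "\<not> ?thesis"
  then have av: "(F ^^ n) x \<notin> planes" if "x \<in> ball c r" for n x using that by blast
  define B where "B = (\<lambda>n. (F ^^ n) ` ball c r)"
  have BS: "B (Suc n) = F ` B n" for n by (auto simp: B_def image_image)
  have "\<exists>a b. B n \<subseteq> otile a b" for n
  proof -
    have "connected (B n)" unfolding B_def by (intro connected_continuous_image funpow_F_cont) simp
    moreover have "B n \<noteq> {}" using r by (auto simp: B_def)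
    moreover have "B n \<inter> planes = {}" using av by (auto simp: B_def)
    ultimately show ?thesis using connected_in_otile by metis
  qed
  then obtain a b where ab: "\<And>n. B n \<subseteq> otile (a n) (b n)" by metis
  define q where "q = L ^ 5 / lam"
  have q: "0 < q" "q < 1" using lam by (auto simp: q_def)
  \<comment> \<open>Each iterate of the ball lies in a single tile, so \<open>F\<close> is injective
    on it and the one-step inequalities can be chained.\<close>
  have iter: "open ((F ^^ n) ` A) \<and> wmass A \<le> ennreal (q ^ n) * wmass ((F ^^ n) ` A)"
    if A: "open A" "A \<subseteq> ball c r" for n A
  proof (induction n)
    case 0
    then show ?case using A by simp
  next
    case (Suc n)
    have sub: "(F ^^ n) ` A \<subseteq> otile (a n) (b n)" using A(2) ab[of n] by (auto simp: B_def)
    have eq: "(F ^^ Suc n) ` A = F ` (F ^^ n) ` A" by (auto simp: image_image)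
    have nop: "F ` (F ^^ n) ` A \<inter> planes = {}" using av[of _ "Suc n"] A(2) by auto
    have "wmass A \<le> ennreal (q ^ n) * wmass ((F ^^ n) ` A)" using Suc by simp
    also have "\<dots> \<le> ennreal (q ^ n) * (ennreal q * wmass (F ` (F ^^ n) ` A))"
      unfolding q_def using Suc sub nop by (intro mult_left_mono weighted_expand) auto
    also have "\<dots> = ennreal (q ^ Suc n) * wmass (F ` (F ^^ n) ` A)"
      using q by (simp add: ennreal_mult mult_ac)
    finally show ?case unfolding eq using Suc F_open[OF _ sub] by simp
  qed
  obtain C where C: "C \<ge> 0" "\<And>A a b a' b'. open A \<Longrightarrow> A \<subseteq> otile a b \<Longrightarrow> F ` A \<subseteq> otile a' b' \<Longrightarrow>
     (\<And>x. x \<in> A \<Longrightarrow> ht x > - (nu * lam)) \<Longrightarrow> vol A \<le> ennreal C"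
    using upper_volume[of "nu * lam"] by blast
  \<comment> \<open>The sixth root divides the gain \<open>q ^ n = \<theta> ^ (6 * n)\<close>
    equally: off the axis the weight costs at most \<open>\<theta> ^ (- 3 * n)\<close>, and
    \<open>\<theta> ^ (3 * n)\<close> remains for summability.\<close>
  define \<theta> where "\<theta> = root 6 q"
  have \<theta>6: "\<theta> ^ 6 = q" unfolding \<theta>_def using q by (intro real_root_pow_pos2) auto
  have \<theta>: "0 < \<theta>" "\<theta> < 1" using q by (auto simp: \<theta>_def)
  \<comment> \<open>Points whose \<open>n\<close>-th iterate is neither close to the axis nor low,
    the negation of the alternative in \<open>orbit_contradiction\<close>.\<close>
  define A where "A = (\<lambda>n. ball c r \<inter> (F ^^ n) -` {x. \<theta> ^ n < rho x \<and> - (nu * lam) < ht x})"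
  have Ao: "open (A n)" for n
    unfolding A_def by (rule continuous_open_preimage[OF funpow_F_cont])
       (auto intro!: open_Collect_conj open_Collect_less continuous_intros)
  have Ab: "A n \<subseteq> ball c r" for n by (auto simp: A_def)
  have mA: "wmass (A n) \<le> ennreal (C * (\<theta> ^ 3) ^ n)" for n
  proof -
    have FAo: "open ((F ^^ n) ` A n)" using iter[OF Ao Ab] by blast
    have sub: "(F ^^ n) ` A n \<subseteq> B n" using Ab by (auto simp: B_def)
    have "F ` (F ^^ n) ` A n \<subseteq> B (Suc n)" unfolding BS using sub by blast
    then have vol: "vol ((F ^^ n) ` A n) \<le> ennreal C"
      using sub ab by (intro C(2)[OF FAo, of "a n" "b n" "a (Suc n)" "b (Suc n)"]) (auto simp: A_def)
    have "wmass (A n) \<le> ennreal (q ^ n) * wmass ((F ^^ n) ` A n)"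
      using iter[OF Ao Ab] by blast
    also have "wmass ((F ^^ n) ` A n) \<le> (\<integral>\<^sup>+x. ennreal (1 / (\<theta> ^ n) ^ 3) * indicator ((F ^^ n) ` A n) x \<partial>lborel)"
    proof (intro nn_integral_mono)
      fix x
      show "wt x * indicator ((F ^^ n) ` A n) x \<le> ennreal (1 / (\<theta> ^ n) ^ 3) * indicator ((F ^^ n) ` A n) x"
      proof (cases "x \<in> (F ^^ n) ` A n")
        case True
        then have "\<theta> ^ n < rho x" by (auto simp: A_def)
        then have "1 / rho x ^ 3 \<le> 1 / (\<theta> ^ n) ^ 3"
          using \<theta> by (intro divide_left_mono power_mono mult_pos_pos zero_less_power) (auto intro: less_trans[OF zero_less_power])
        then show ?thesis using True by (auto simp: wt_def intro!: ennreal_leI)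
      qed simp
    qed
    also have "\<dots> = ennreal (1 / (\<theta> ^ n) ^ 3) * vol ((F ^^ n) ` A n)"
      using FAo by (intro nn_integral_cmult_indicator) auto
    also have "\<dots> \<le> ennreal (1 / (\<theta> ^ n) ^ 3) * ennreal C" by (intro mult_left_mono vol) auto
    also have "ennreal (q ^ n) * (ennreal (1 / (\<theta> ^ n) ^ 3) * ennreal C) = ennreal (q ^ n * (1 / (\<theta> ^ n) ^ 3 * C))"
    proof -
      have "ennreal (u * (v * w)) = ennreal u * (ennreal v * ennreal w)" if "u \<ge> 0" "v \<ge> 0" for u v w :: real
        using that by (simp add: ennreal_mult')
      then show ?thesis using q \<theta> by (simp only: zero_le_power zero_le_divide_1_iff less_imp_le)
    qed
    also have "q ^ n * (1 / (\<theta> ^ n) ^ 3 * C) = C * (\<theta> ^ 3) ^ n"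
    proof -
      have "q ^ n = (\<theta> ^ n) ^ 3 * (\<theta> ^ 3) ^ n"
        by (simp add: \<theta>6[symmetric] power_mult[symmetric] power_add[symmetric])
      then show ?thesis using \<theta> by simp
    qed
    finally show ?thesis by (simp add: mult_left_mono)
  qed
  define M where "M = density lborel wt"
  have eM: "emeasure M (A n) = wmass (A n)" for n
    unfolding M_def using Ao by (subst emeasure_density) auto
  have "AE x in M. eventually (\<lambda>n. x \<in> space M - A n) sequentially"
  proof (rule borel_cantelli_AE1)
    show "A n \<in> sets M" for n using Ao by (simp add: M_def)
    show "emeasure M (A n) < \<infinity>" for n using mA[of n] unfolding eM
      by (simp add: le_less_trans)
    show "summable (\<lambda>n. measure M (A n))"
    proof (rule summable_comparison_test')
      have "\<theta> ^ 3 < 1" using \<theta> by (simp add: power_less_one_iff)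
      then show "summable (\<lambda>n. C * (\<theta> ^ 3) ^ n)" using \<theta> by (intro summable_mult summable_geometric) auto
      fix n
      show "norm (measure M (A n)) \<le> C * (\<theta> ^ 3) ^ n"
        using mA[of n] C(1) \<theta> unfolding measure_def eM by (simp add: enn2real_leI)
    qed
  qed
  then have ae: "AE x in lborel. wt x > 0 \<longrightarrow> eventually (\<lambda>n. x \<notin> A n) sequentially"
    unfolding M_def by (subst (asm) AE_density) auto
  \<comment> \<open>An almost everywhere statement yields a point of the ball, because the ball has
    positive volume. Its weight is positive as the ball avoids \<open>planes\<close>.\<close>
  have "\<exists>x\<in>ball c r. wt x > 0 \<longrightarrow> eventually (\<lambda>n. x \<notin> A n) sequentially"
  proof (rule ccontr)
    assume "\<not> ?thesis"
    then have "AE x in lborel. x \<notin> ball c r" using ae by (auto elim: eventually_mono)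
    then have "ball c r \<in> null_sets lborel" by (subst AE_iff_null_sets) auto
    then show False using open_emeasure_pos[of "ball c r"] r by auto
  qed
  then obtain x where x: "x \<in> ball c r" "wt x > 0 \<Longrightarrow> eventually (\<lambda>n. x \<notin> A n) sequentially" by blast
  have rp: "rho ((F ^^ n) x) > 0" for n using av[OF x(1)] rho_pos by blast
  have "wt x > 0" using rp[of 0] by (simp add: wt_def)
  then obtain N where N: "\<And>n. n \<ge> N \<Longrightarrow> x \<notin> A n" using x(2) by (auto simp: eventually_sequentially)
  show False
  proof (rule orbit_contradiction[where y = "\<lambda>n. (F ^^ n) x" and N = N, OF _ rp \<theta>])
    fix n assume "n \<ge> N"
    then show "rho ((F ^^ n) x) \<le> \<theta> ^ n \<or> ht ((F ^^ n) x) \<le> - (nu * lam)"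
      using N[of n] x(1) by (auto simp: A_def)
  qed simp
qed

section \<open>The diagonal planes\<close>

text \<open>The factor \<open>sqrt 2\<close> makes the parametrisation of the plane
  \<open>x2 = \<sigma> * x1\<close> isometric, so that areas are Lebesgue measures and norms are
  preserved.\<close>

definition emb :: "real \<Rightarrow> real \<times> real \<Rightarrow> R3" where
  "emb \<sigma> p = (fst p / sqrt 2, \<sigma> * (fst p / sqrt 2), snd p)"

definition G :: "real \<Rightarrow> real \<times> real \<Rightarrow> real \<times> real" where
  "G \<sigma> p = (sqrt 2 * fst (F (emb \<sigma> p)), ht (F (emb \<sigma> p)))"

text \<open>A diagonal plane crosses only squares with indices \<open>(k, k)\<close> or
  \<open>(k, - k)\<close>, all of even parity. No reflection in the range occurs, and the images
  have nonnegative height.\<close>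

lemma Hm_diag:
  assumes \<sigma>: "\<sigma> \<in> {1, -1}"
  obtains y where "\<bar>y\<bar> \<le> 1" "Hm t (\<sigma> * t) = hh (y, \<sigma> * y)"
proof -
  define k where "k = beam_index lam t"
  define m where "m = (if \<sigma> = 1 then k else - k)"
  have m: "of_int m = \<sigma> * of_int k" using \<sigma> by (auto simp: m_def)
  have b: "in_beam k t" using in_own_beam k_def by simp
  have e: "\<sigma> * t - 2 * of_int m * lam = \<sigma> * (t - 2 * of_int k * lam)" unfolding m by (simp add: algebra_simps)
  then have b': "in_beam m (\<sigma> * t)" using b \<sigma> by (auto simp: abs_minus_commute)
  have pm: "pm m = pm k" "reflp (k + m) w = w" for w by (auto simp: m_def pm_def reflp_def)
  show thesis
  proof (rule that)
    show "\<bar>pm k * (t - 2 * of_int k * lam) / lam\<bar> \<le> 1" using b by (simp add: abs_mult)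
    show "Hm t (\<sigma> * t) = hh (pm k * (t - 2 * of_int k * lam) / lam, \<sigma> * (pm k * (t - 2 * of_int k * lam) / lam))"
      unfolding Hm_square[OF b b'] pm e by (simp add: mult.left_commute)
  qed
qed

lemma F_emb:
  assumes \<sigma>: "\<sigma> \<in> {1, -1}"
  shows "emb \<sigma> (G \<sigma> p) = F (emb \<sigma> p)" "snd (G \<sigma> p) \<ge> 0"
proof -
  obtain y where y: "\<bar>y\<bar> \<le> 1" "Hm (fst p / sqrt 2) (\<sigma> * (fst p / sqrt 2)) = hh (y, \<sigma> * y)"
    using Hm_diag[OF \<sigma>] by blast
  have F: "F (emb \<sigma> p) = (nu * lam * exp (snd p)) *\<^sub>R hh (y, \<sigma> * y)" by (simp only: F_eq emb_def fst_conv snd_conv y(2))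
  have q: "(y, \<sigma> * y) \<in> sqQ" using y \<sigma> by (auto simp: sqQ_def)
  show "snd (G \<sigma> p) \<ge> 0" using hh_hemi(2)[OF q] nu by (simp add: G_def F)
  have "fst (hh (y, \<sigma> * y)) = \<sigma> * fst (snd (hh (y, \<sigma> * y)))" by (rule diag[OF \<sigma> y(1)])
  then have "fst (snd (F (emb \<sigma> p))) = \<sigma> * fst (F (emb \<sigma> p))" using \<sigma> by (auto simp: F)
  then show "emb \<sigma> (G \<sigma> p) = F (emb \<sigma> p)" by (simp add: emb_def G_def prod_eq_iff)
qed

lemma dist_emb:
  assumes \<sigma>: "\<sigma> \<in> {1, -1}"
  shows "dist (emb \<sigma> p) (emb \<sigma> q) = dist p q" "norm (emb \<sigma> p) = norm p"
proof -
  have s: "(\<sigma> * x)\<^sup>2 = x\<^sup>2" for x using \<sigma> by (auto simp: power_mult_distrib)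
  have "(dist (emb \<sigma> p) (emb \<sigma> q))\<^sup>2 = (dist p q)\<^sup>2"
  proof -
    have "fst p / sqrt 2 - fst q / sqrt 2 = (fst p - fst q) / sqrt 2" by (simp add: diff_divide_distrib)
    moreover have "\<sigma> * (fst p / sqrt 2) - \<sigma> * (fst q / sqrt 2) = \<sigma> * ((fst p - fst q) / sqrt 2)"
      by (simp add: algebra_simps diff_divide_distrib)
    ultimately show ?thesis
      by (cases p; cases q) (simp add: emb_def dist_Pair_Pair dist_real_def s power_divide)
  qed
  then show "dist (emb \<sigma> p) (emb \<sigma> q) = dist p q" by (simp add: power2_eq_iff_nonneg)
  have "(norm (emb \<sigma> p))\<^sup>2 = (norm p)\<^sup>2" by (cases p) (simp add: emb_def norm_Pair s power_divide)
  then show "norm (emb \<sigma> p) = norm p" by (simp add: power2_eq_iff_nonneg)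
qed

lemma emb_inj: "\<sigma> \<in> {1, -1} \<Longrightarrow> emb \<sigma> p = emb \<sigma> q \<longleftrightarrow> p = q"
  using dist_emb(1)[of \<sigma> p q] by (metis dist_eq_0_iff)

lemma G_funpow: "\<sigma> \<in> {1, -1} \<Longrightarrow> emb \<sigma> ((G \<sigma> ^^ n) p) = (F ^^ n) (emb \<sigma> p)"
  by (induction n) (auto simp: F_emb)

lemma norm_G: "\<sigma> \<in> {1, -1} \<Longrightarrow> norm (G \<sigma> p) = nu * lam * exp (snd p)"
  using dist_emb(2)[of \<sigma> "G \<sigma> p"] by (simp add: F_emb(1) norm_F) (simp add: emb_def)

lemma emb_cont [continuous_intros]: "continuous_on S g \<Longrightarrow> continuous_on S (\<lambda>x. emb \<sigma> (g x))"
  unfolding emb_def by (intro continuous_intros) auto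

lemma F_cont' [continuous_intros]: "continuous_on S g \<Longrightarrow> continuous_on S (\<lambda>x. F (g x))"
  by (rule continuous_on_compose2[OF F_cont[of UNIV]]) auto

lemma G_cont: "continuous_on S (G \<sigma>)"
  unfolding G_def by (intro continuous_intros)

lemma G_funpow_cont: "continuous_on S (G \<sigma> ^^ n)"
proof (induction n)
  case (Suc n)
  then show ?case using continuous_on_compose[OF Suc G_cont] by (simp add: o_def)
qed simp

lemma F_inj_square:
  assumes "in_beam k (fst x)" "in_beam m (fst (snd x))"
    "in_beam k (fst y)" "in_beam m (fst (snd y))"
    and "F x = F y"
  shows "x = y"
proof -
  have "dist (base x) (base y) \<le> lam * L * dist (Hm (fst x) (fst (snd x))) (Hm (fst y) (fst (snd y)))"
    by (rule Hm_bilip(2)[OF assms(1-4)])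
  then show ?thesis using F_eqD[OF assms(5)] by (simp add: prod_eq_iff)
qed

lemma emb_square:
  assumes \<sigma>: "\<sigma> \<in> {1, -1}"
  obtains m where "\<And>p. \<bar>fst (emb \<sigma> p) - 2 * of_int k * lam\<bar> = \<bar>fst p / sqrt 2 - 2 * of_int k * lam\<bar> \<and>
    \<bar>fst (snd (emb \<sigma> p)) - 2 * of_int m * lam\<bar> = \<bar>fst p / sqrt 2 - 2 * of_int k * lam\<bar>"
proof (rule that[of "if \<sigma> = 1 then k else - k"])
  fix p
  show "\<bar>fst (emb \<sigma> p) - 2 * of_int k * lam\<bar> = \<bar>fst p / sqrt 2 - 2 * of_int k * lam\<bar> \<and>
    \<bar>fst (snd (emb \<sigma> p)) - 2 * of_int (if \<sigma> = 1 then k else - k) * lam\<bar> = \<bar>fst p / sqrt 2 - 2 * of_int k * lam\<bar>"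
    using \<sigma> abs_minus_commute[of "fst p / sqrt 2" "2 * of_int k * lam"] by (auto simp: emb_def)
qed

text \<open>Half strips end at the beam edges, along which \<open>G\<close> folds; the strips below
  end at the axes. Up to an edge, a strip consists of halves of two consecutive half strips.\<close>

definition hstrip :: "int \<Rightarrow> (real \<times> real) set" where
  "hstrip k = {p. inside_beam k (fst p / sqrt 2)}"

lemma hstrip_open: "open (hstrip k)"
  unfolding hstrip_def by (intro open_Collect_less continuous_intros) auto

lemma G_inj: "\<sigma> \<in> {1, -1} \<Longrightarrow> inj_on (G \<sigma>) (hstrip k)"
proof (rule inj_onI)
  fix p q assume \<sigma>: "\<sigma> \<in> {1, -1}" and pq: "p \<in> hstrip k" "q \<in> hstrip k" "G \<sigma> p = G \<sigma> q"
  obtain m where m: "\<And>p. \<bar>fst (emb \<sigma> p) - 2 * of_int k * lam\<bar> = \<bar>fst p / sqrt 2 - 2 * of_int k * lam\<bar> \<and>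
    \<bar>fst (snd (emb \<sigma> p)) - 2 * of_int m * lam\<bar> = \<bar>fst p / sqrt 2 - 2 * of_int k * lam\<bar>"
    using emb_square[OF \<sigma>] by blast
  have "F (emb \<sigma> p) = F (emb \<sigma> q)" using pq(3) F_emb(1)[OF \<sigma>] by metis
  then have "emb \<sigma> p = emb \<sigma> q"
    by (rule F_inj_square[of _ k m, rotated 4]) (use pq m in \<open>auto simp: hstrip_def\<close>)
  then show "p = q" using emb_inj[OF \<sigma>] by simp
qed

text \<open>Only one horizontal direction is left in the plane, so the area loses
  \<open>lam * L\<close> only once.\<close>

lemma G_expand:
  assumes \<sigma>: "\<sigma> \<in> {1, -1}" and A: "open A" "A \<subseteq> hstrip k" and c: "c > 0"
    and low: "\<And>p. p \<in> A \<Longrightarrow> c \<le> norm (G \<sigma> p)"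
  shows "vol A \<le> ennreal (lam * L / c\<^sup>2) * vol (G \<sigma> ` A)"
proof -
  have inj: "inj_on (G \<sigma>) A" using A(2) G_inj[OF \<sigma>] by (rule inj_on_subset[rotated])
  have Go: "open (G \<sigma> ` A)" by (rule invariance_of_domain[OF G_cont A(1) inj])
  have nz: "G \<sigma> p \<noteq> 0" for p using norm_G[OF \<sigma>, of p] nu by auto
  obtain m where m: "\<And>p. \<bar>fst (emb \<sigma> p) - 2 * of_int k * lam\<bar> = \<bar>fst p / sqrt 2 - 2 * of_int k * lam\<bar> \<and>
    \<bar>fst (snd (emb \<sigma> p)) - 2 * of_int m * lam\<bar> = \<bar>fst p / sqrt 2 - 2 * of_int k * lam\<bar>"
    using emb_square[OF \<sigma>] by blast
  have mA: "in_beam k (fst (emb \<sigma> p)) \<and> in_beam m (fst (snd (emb \<sigma> p)))" if "p \<in> A" for p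
  proof -
    have "inside_beam k (fst p / sqrt 2)" using A(2) that unfolding hstrip_def by blast
    then show ?thesis using m[of p] by simp
  qed
  have "vol A = (\<integral>\<^sup>+x\<in>A. ennreal 1 \<partial>lborel)" using A by simp
  also have "\<dots> \<le> (\<integral>\<^sup>+p\<in>G \<sigma> ` A. ennreal (lam * L / c\<^sup>2) \<partial>lborel)"
  proof (rule expansion_nn_integral_le[where e = "(0, 1)" and k = "lam * L" and C = "lam * L"])
    show "(0, 1) \<in> (Basis :: (real \<times> real) set)" by (simp add: Basis_prod_def)
    fix x assume x: "x \<in> A"
    have "c\<^sup>2 \<le> (norm (G \<sigma> x))\<^sup>2" using low[OF x] c by (intro power_mono) auto
    then have "(lam * L)\<^sup>2 * c\<^sup>2 \<le> (lam * L)\<^sup>2 * (norm (G \<sigma> x))\<^sup>2" by (intro mult_left_mono) auto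
    then show "1 * (lam * L) ^ DIM(real \<times> real) \<le> lam * L * norm (G \<sigma> x) ^ DIM(real \<times> real) * (lam * L / c\<^sup>2)"
      using c by (simp add: field_simps power2_eq_square)
    show "\<exists>\<delta>>0. \<forall>y\<in>A. dist x y < \<delta> \<longrightarrow>
       norm (y - x + ((lam * L - 1) * inner (y - x) (0, 1)) *\<^sub>R (0, 1)) * sqrt (norm (G \<sigma> x) * norm (G \<sigma> y))
         \<le> lam * L * dist (G \<sigma> x) (G \<sigma> y)"
    \<comment> \<open>The set lies in one half strip and hence over one beam, so the estimate holds
      for all pairs and the radius 1 is arbitrary.\<close>
    proof (intro exI[of _ 1] conjI ballI impI)
      fix y assume y: "y \<in> A"
      have eq: "y - x + ((lam * L - 1) * inner (y - x) (0, 1)) *\<^sub>R (0, 1) = (fst y - fst x, lam * L * (snd y - snd x))"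
        by (simp add: prod_eq_iff inner_prod_def algebra_simps)
      have sq: "(fst (emb \<sigma> y) - fst (emb \<sigma> x))\<^sup>2 + (fst (snd (emb \<sigma> y)) - fst (snd (emb \<sigma> x)))\<^sup>2 = (fst y - fst x)\<^sup>2"
      proof -
        have "(fst (emb \<sigma> y) - fst (emb \<sigma> x)) = (fst y - fst x) / sqrt 2"
          "(fst (snd (emb \<sigma> y)) - fst (snd (emb \<sigma> x))) = \<sigma> * ((fst y - fst x) / sqrt 2)"
          by (auto simp: emb_def diff_divide_distrib algebra_simps)
        then show ?thesis using \<sigma> by (auto simp: power_divide power_mult_distrib)
      qed
      have "((fst (emb \<sigma> y) - fst (emb \<sigma> x))\<^sup>2 + (fst (snd (emb \<sigma> y)) - fst (snd (emb \<sigma> x)))\<^sup>2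
         + (lam * L * (ht (emb \<sigma> y) - ht (emb \<sigma> x)))\<^sup>2) * (norm (F (emb \<sigma> x)) * norm (F (emb \<sigma> y)))
         \<le> (lam * L * dist (F (emb \<sigma> x)) (F (emb \<sigma> y)))\<^sup>2"
        using mA[OF x] mA[OF y] by (intro F_est[of _ k m]) auto
      then have "(norm (y - x + ((lam * L - 1) * inner (y - x) (0, 1)) *\<^sub>R (0, 1)) * sqrt (norm (G \<sigma> x) * norm (G \<sigma> y)))\<^sup>2
         \<le> (lam * L * dist (G \<sigma> x) (G \<sigma> y))\<^sup>2"
        unfolding eq sq F_emb(1)[OF \<sigma>, symmetric] dist_emb[OF \<sigma>]
        by (simp add: emb_def norm_Pair power_mult_distrib)
      then show "norm (y - x + ((lam * L - 1) * inner (y - x) (0, 1)) *\<^sub>R (0, 1)) * sqrt (norm (G \<sigma> x) * norm (G \<sigma> y))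
         \<le> lam * L * dist (G \<sigma> x) (G \<sigma> y)" by (rule power2_le_imp_le) simp
    qed simp
  qed (use A c inj G_cont nz in \<open>auto intro!: continuous_intros\<close>)
  also have "\<dots> = ennreal (lam * L / c\<^sup>2) * vol (G \<sigma> ` A)"
    using Go by (intro nn_integral_cmult_indicator) auto
  finally show ?thesis .
qed

definition strip :: "int \<Rightarrow> (real \<times> real) set" where
  "strip a = {p. 2 * lam * of_int a < fst p / sqrt 2 \<and> fst p / sqrt 2 < 2 * lam * of_int (a + 1)}"

lemma strip_open: "open (strip a)"
  unfolding strip_def by (intro open_Collect_conj open_Collect_less continuous_intros) auto

lemma strip_slab_volume:
  assumes "r \<ge> 0"
  shows "vol (strip a \<inter> {p. norm p \<le> r}) \<le> ennreal (8 * lam * r)"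
proof -
  define A where "A = sqrt 2 * (2 * lam * of_int a)"
  define l u :: "real \<times> real" where "l = (A, - r)" and "u = (A + sqrt 2 * (2 * lam), r)"
  have le: "\<And>c. c \<in> Basis \<Longrightarrow> inner l c \<le> inner u c"
    using assms by (auto simp: Basis_prod_def l_def u_def inner_prod_def)
  have "strip a \<inter> {p. norm p \<le> r} \<subseteq> cbox l u"
  proof
    fix p assume p: "p \<in> strip a \<inter> {p. norm p \<le> r}"
    obtain s z where sz: "p = (s, z)" by (cases p)
    have "A < s" "s < A + sqrt 2 * (2 * lam)" using p by (auto simp: sz strip_def A_def field_simps)
    moreover have "\<bar>z\<bar> \<le> r" using p norm_snd_le[of z s] by (auto simp: sz)
    ultimately show "p \<in> cbox l u" by (simp add: sz l_def u_def cbox_Pair_eq abs_le_iff)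
  qed
  then have "vol (strip a \<inter> {p. norm p \<le> r}) \<le> vol (cbox l u)"
    by (rule emeasure_mono) simp
  also have "\<dots> = ennreal (\<Prod>c\<in>Basis. inner (u - l) c)" by (rule emeasure_lborel_cbox[OF le])
  also have "(\<Prod>c\<in>Basis. inner (u - l) c) = (sqrt 2 * (2 * lam)) * (2 * r)"
  proof -
    have "(\<Prod>c\<in>(Basis :: (real \<times> real) set). inner (u - l) c) = (\<Prod>c\<in>{(1,0),(0,1)}. inner (u - l) c)"
      by (rule prod.cong) (auto simp: Basis_prod_def)
    then show ?thesis by (simp add: l_def u_def inner_prod_def algebra_simps)
  qed
  also have "\<dots> \<le> 8 * lam * r"
  proof -
    have "sqrt 2 \<le> sqrt (2\<^sup>2)" by (intro real_sqrt_le_mono) simp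
    then have "sqrt 2 * (4 * lam * r) \<le> 2 * (4 * lam * r)" using assms by (intro mult_right_mono) auto
    then show ?thesis by simp
  qed
  finally show ?thesis by (simp add: ennreal_leI)
qed

text \<open>One dimension lower than \<open>slice_volume\<close>: the image has area of order
  \<open>r\<close>, the expansion is of order \<open>r\<^sup>2\<close>, so \<open>exp (- t)\<close>
  remains.\<close>

lemma slice_volume2:
  assumes \<sigma>: "\<sigma> \<in> {1, -1}" and A: "open A" "A \<subseteq> hstrip k" and GA: "G \<sigma> ` A \<subseteq> strip a"
    and z: "\<And>p. p \<in> A \<Longrightarrow> t < snd p \<and> snd p < t + 2"
  shows "vol A \<le> ennreal (8 * lam * (lam * L) * exp 2 / (nu * lam) * exp (- t))"
proof -
  define r where "r = nu * lam * exp t"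
  have r: "r > 0" using nu by (simp add: r_def)
  have nG: "r \<le> norm (G \<sigma> p)" "norm (G \<sigma> p) \<le> r * exp 2" if "p \<in> A" for p
  proof -
    show "r \<le> norm (G \<sigma> p)" using z[OF that] nu by (simp add: norm_G[OF \<sigma>] r_def)
    have "r * exp 2 = nu * lam * exp (t + 2)" by (simp add: r_def exp_add)
    then show "norm (G \<sigma> p) \<le> r * exp 2" using z[OF that] nu by (simp add: norm_G[OF \<sigma>])
  qed
  have "vol A \<le> ennreal (lam * L / r\<^sup>2) * vol (G \<sigma> ` A)"
    by (rule G_expand[OF \<sigma> A r nG(1)])
  also have "vol (G \<sigma> ` A) \<le> vol (strip a \<inter> {p. norm p \<le> r * exp 2})"
    using GA nG(2) strip_open
    by (intro emeasure_mono) (auto intro!: sets.Int borel_open borel_closed closed_Collect_le continuous_intros)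
  also have "\<dots> \<le> ennreal (8 * lam * (r * exp 2))" using r by (intro strip_slab_volume) auto
  also have "ennreal (lam * L / r\<^sup>2) * ennreal (8 * lam * (r * exp 2)) = ennreal (lam * L / r\<^sup>2 * (8 * lam * (r * exp 2)))"
    using r by (intro ennreal_mult[symmetric]) auto
  also have "lam * L / r\<^sup>2 * (8 * lam * (r * exp 2)) = 8 * lam * (lam * L) * exp 2 / r"
    using r by (simp add: power2_eq_square field_simps)
  also have "\<dots> = 8 * lam * (lam * L) * exp 2 / (nu * lam) * exp (- t)"
    by (simp add: r_def exp_minus field_simps)
  finally show ?thesis by (simp add: mult_left_mono)
qed

text \<open>The vertical lines over the centres of all squares; \<open>F\<close> maps each of them
  into the \<open>x3\<close>-axis.\<close>

definition axes :: "(R3) set" where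
  "axes = {x. \<exists>i j::int. fst x = 2 * lam * of_int i \<and> fst (snd x) = 2 * lam * of_int j}"

lemma hstrips_null: "- (\<Union>k. hstrip k) \<in> null_sets lborel"
proof -
  have h: "{p :: real \<times> real. fst p / sqrt 2 = c} \<in> null_sets lborel" for c
    using hyperplane_null[of "(1 / sqrt 2, 0) :: real \<times> real" c] by (simp add: zero_prod_def inner_prod_def)
  have "- (\<Union>k. hstrip k) \<subseteq> (\<Union>k::int. {p. fst p / sqrt 2 = (2 * of_int k - 1) * lam})"
  proof
    fix p assume "p \<in> - (\<Union>k. hstrip k)"
    then have "p \<notin> hstrip (beam_index lam (fst p / sqrt 2))" by auto
    then have "fst p / sqrt 2 = (2 * of_int (beam_index lam (fst p / sqrt 2)) - 1) * lam"
      using beam_bounds[of "fst p / sqrt 2"] by (auto simp: hstrip_def algebra_simps abs_less_iff)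
    then show "p \<in> (\<Union>k::int. {p. fst p / sqrt 2 = (2 * of_int k - 1) * lam})" by blast
  qed
  moreover have "(\<Union>k::int. {p :: real \<times> real. fst p / sqrt 2 = (2 * of_int k - 1) * lam}) \<in> null_sets lborel"
    by (intro null_sets_UN h)
  moreover have "closed (- (\<Union>k. hstrip k))" using hstrip_open by auto
  ultimately show ?thesis by (intro null_sets_subset[of _ lborel "- (\<Union>k. hstrip k)"]) auto
qed

lemma strip_halves: "strip a \<inter> (\<Union>k. hstrip k) \<subseteq> hstrip a \<union> hstrip (a + 1)"
proof
  fix p assume p: "p \<in> strip a \<inter> (\<Union>k. hstrip k)"
  define x where "x = fst p / sqrt 2"
  define A where "A = lam * of_int a"
  have b: "2 * A < x" "x < 2 * A + 2 * lam" using p by (auto simp: strip_def x_def A_def algebra_simps)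
  obtain k where k: "inside_beam k x" using p by (auto simp: hstrip_def x_def)
  have "(2 * of_int a - 1) * lam < (2 * of_int k + 1) * lam" "(2 * of_int k - 1) * lam < (2 * of_int a + 2 + 1) * lam"
    using k b by (auto simp: A_def algebra_simps abs_less_iff)
  then have "2 * real_of_int a - 1 < 2 * of_int k + 1" "2 * real_of_int k - 1 < 2 * of_int a + 2 + 1"
    by (simp_all only: mult_less_cancel_right_pos[OF lam_pos(1)])
  then have "k = a \<or> k = a + 1" by linarith
  then show "p \<in> hstrip a \<union> hstrip (a + 1)" using k by (auto simp: hstrip_def x_def)
qed

lemma half_volume_bound:
  assumes \<sigma>: "\<sigma> \<in> {1, -1}"
  obtains C where "C \<ge> 0" "\<And>A k a. open A \<Longrightarrow> A \<subseteq> hstrip k \<Longrightarrow> G \<sigma> ` A \<subseteq> strip a \<Longrightarrow>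
     (\<And>p. p \<in> A \<Longrightarrow> snd p \<ge> 0) \<Longrightarrow> vol A \<le> ennreal C"
proof -
  define D where "D = 8 * lam * (lam * L) * exp 2 / (nu * lam)"
  have D: "D \<ge> 0" using nu by (simp add: D_def)
  show thesis
  proof (rule that[of "D * exp (- 1 * (0 - 1)) / (1 - exp (- 1))"])
    fix A k a assume A: "open A" "A \<subseteq> hstrip k" "G \<sigma> ` A \<subseteq> strip a" "\<And>p. p \<in> A \<Longrightarrow> snd p \<ge> 0"
    show "vol A \<le> ennreal (D * exp (- 1 * (0 - 1)) / (1 - exp (- 1)))"
    proof (rule volume_le_by_slices[OF A(1), where z = snd])
      fix S t assume S: "open S" "S \<subseteq> A" "\<And>p. p \<in> S \<Longrightarrow> t < snd p \<and> snd p < t + 2"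
      have "S \<subseteq> hstrip k" "G \<sigma> ` S \<subseteq> strip a" using A(2,3) S(2) by blast+
      then have "vol S \<le> ennreal (D * exp (- t))" unfolding D_def using S by (intro slice_volume2[OF \<sigma>])
      then show "vol S \<le> ennreal (D * exp (- 1 * t))" by simp
    qed (use A(4) D in \<open>auto intro!: continuous_intros\<close>)
  qed (use D in simp)
qed

text \<open>On a diagonal plane the map folds along the images of the edges, hence is two-to-one on a
  strip; the area expansion factor \<open>nu\<^sup>2 * lam / L > 2\<close> still beats this.\<close>

lemma planar_iterates_hit_axes:
  assumes \<sigma>: "\<sigma> \<in> {1, -1}" and r: "r > 0"
  shows "\<exists>n. \<exists>p\<in>ball c r. emb \<sigma> ((G \<sigma> ^^ n) p) \<in> axes"
proof (rule ccontr)
  assume "\<not> ?thesis"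
  then have av: "emb \<sigma> ((G \<sigma> ^^ n) p) \<notin> axes" if "p \<in> ball c r" for n p using that by blast
  have "\<exists>a. (G \<sigma> ^^ n) ` ball c r \<subseteq> strip a" for n
  proof -
    let ?S = "(G \<sigma> ^^ n) ` ball c r"
    have conn: "connected ?S" by (intro connected_continuous_image G_funpow_cont) simp
    have cont: "continuous_on ?S (\<lambda>p. fst p / sqrt 2)" by (intro continuous_intros) auto
    have ne: "?S \<noteq> {}" using r by auto
    have no: "fst p / sqrt 2 \<noteq> 2 * lam * of_int j" if "p \<in> ?S" for p and j :: int
    proof
      assume e: "fst p / sqrt 2 = 2 * lam * of_int j"
      have "emb \<sigma> p \<in> axes" unfolding axes_def emb_def using e \<sigma>
        by (auto intro!: exI[of _ j] exI[of _ "if \<sigma> = 1 then j else - j"])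
      then show False using that av by auto
    qed
    obtain a where "\<And>p. p \<in> ?S \<Longrightarrow> 2 * lam * of_int a < fst p / sqrt 2 \<and> fst p / sqrt 2 < 2 * lam * of_int (a + 1)"
      using connected_avoiding_multiples[OF conn cont ne _ no] by (metis lam_pos(1) mult_pos_pos zero_less_numeral)
    then have "?S \<subseteq> strip a" unfolding strip_def by blast
    then show ?thesis by blast
  qed
  then obtain a where a: "\<And>n. (G \<sigma> ^^ n) ` ball c r \<subseteq> strip (a n)" by metis
  \<comment> \<open>Images of open sets need not stay open at the folding edges. These form a null
    set and are discarded at every step.\<close>
  define D where "D = rec_nat (ball c r) (\<lambda>_ S. G \<sigma> ` (S \<inter> (\<Union>k. hstrip k)))"
  have D0: "D 0 = ball c r" and DS: "D (Suc n) = G \<sigma> ` (D n \<inter> (\<Union>k. hstrip k))" for n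
    by (auto simp: D_def)
  have Go: "open (G \<sigma> ` A)" if "open A" "A \<subseteq> hstrip k" for A k
    using that G_inj[OF \<sigma>, of k] by (intro invariance_of_domain[OF G_cont]) (auto intro: inj_on_subset)
  have Do: "open (D n)" for n
  proof (induction n)
    case (Suc n)
    have "D (Suc n) = (\<Union>k. G \<sigma> ` (D n \<inter> hstrip k))" by (auto simp: DS)
    then show ?case using Suc hstrip_open by (auto intro!: open_UN Go)
  qed (simp add: D0)
  have DG: "D n \<subseteq> (G \<sigma> ^^ n) ` ball c r" for n
  proof (induction n)
    case (Suc n)
    then show ?case by (auto simp: DS image_image)
  qed (simp add: D0)
  have Dst: "D n \<subseteq> strip (a n)" for n using DG a by blast
  have Dz: "p \<in> D (Suc n) \<Longrightarrow> snd p \<ge> 0" for p n using F_emb(2)[OF \<sigma>] by (auto simp: DS)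
  \<comment> \<open>One strip meets only two half strips. Adding the bounds for both is where the
    factor 2 enters.\<close>
  have Dh: "vol (D n) \<le> vol (D n \<inter> hstrip (a n)) + vol (D n \<inter> hstrip (a n + 1))" for n
  proof -
    have "D n \<inter> (\<Union>k. hstrip k) \<subseteq> (D n \<inter> hstrip (a n)) \<union> (D n \<inter> hstrip (a n + 1))"
      using strip_halves[of "a n"] Dst[of n] by blast
    then have "D n \<subseteq> ((D n \<inter> hstrip (a n)) \<union> (D n \<inter> hstrip (a n + 1))) \<union> (- (\<Union>k. hstrip k))" by blast
    then have "vol (D n) \<le> vol (((D n \<inter> hstrip (a n)) \<union> (D n \<inter> hstrip (a n + 1))) \<union> (- (\<Union>k. hstrip k)))"
      using Do hstrip_open hstrips_null by (intro emeasure_mono) auto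
    also have "\<dots> = vol ((D n \<inter> hstrip (a n)) \<union> (D n \<inter> hstrip (a n + 1)))"
      using Do hstrip_open hstrips_null by (intro emeasure_Un_null_set) auto
    also have "\<dots> \<le> vol (D n \<inter> hstrip (a n)) + vol (D n \<inter> hstrip (a n + 1))"
      using Do hstrip_open by (intro emeasure_subadditive) auto
    finally show ?thesis .
  qed
  obtain C where C: "C \<ge> 0" "\<And>A k a. open A \<Longrightarrow> A \<subseteq> hstrip k \<Longrightarrow> G \<sigma> ` A \<subseteq> strip a \<Longrightarrow>
     (\<And>p. p \<in> A \<Longrightarrow> snd p \<ge> 0) \<Longrightarrow> vol A \<le> ennreal C"
    using half_volume_bound[OF \<sigma>] by blast
  have GD: "G \<sigma> ` (D n \<inter> hstrip k) \<subseteq> D (Suc n)" for n k by (auto simp: DS)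
  \<comment> \<open>Only from index 1 on are all heights known to be nonnegative, since
    \<open>G\<close> takes values of nonnegative height.\<close>
  have bound: "vol (D (Suc n)) \<le> ennreal (2 * C)" for n
  proof -
    have "vol (D (Suc n) \<inter> hstrip k) \<le> ennreal C" for k
    proof (rule C(2))
      show "G \<sigma> ` (D (Suc n) \<inter> hstrip k) \<subseteq> strip (a (Suc (Suc n)))" using GD Dst by blast
    qed (use Do hstrip_open Dz in auto)
    then have "vol (D (Suc n)) \<le> ennreal C + ennreal C"
      using Dh[of "Suc n"] by (meson add_mono order_trans)
    then show ?thesis using C(1) by (simp flip: ennreal_plus)
  qed
  \<comment> \<open>Twice the reciprocal of the least area expansion at nonnegative height;
    \<open>\<kappa> < 1\<close> is the hypothesis \<open>nu > sqrt (2 * L / lam)\<close>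
    squared.\<close>
  define \<kappa> where "\<kappa> = 2 * (lam * L / (nu * lam)\<^sup>2)"
  have \<kappa>: "\<kappa> \<ge> 0" "\<kappa> < 1"
  proof -
    have "sqrt (2 * L / lam) ^ 2 < nu ^ 2" using nu L by (intro power_strict_mono) auto
    then have "2 * L / lam < nu\<^sup>2" using L by simp
    then show "\<kappa> < 1" using nu by (simp add: \<kappa>_def field_simps power2_eq_square)
  qed (simp add: \<kappa>_def)
  have step: "vol (D (Suc n)) \<le> ennreal \<kappa> * vol (D (Suc (Suc n)))" for n
  proof -
    have "vol (D (Suc n) \<inter> hstrip k) \<le> ennreal (lam * L / (nu * lam)\<^sup>2) * vol (D (Suc (Suc n)))" for k
    proof -
      have "vol (D (Suc n) \<inter> hstrip k)
          \<le> ennreal (lam * L / (nu * lam)\<^sup>2) * vol (G \<sigma> ` (D (Suc n) \<inter> hstrip k))"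
      proof (rule G_expand[OF \<sigma>])
        fix p assume "p \<in> D (Suc n) \<inter> hstrip k"
        then have "snd p \<ge> 0" using Dz by blast
        then show "nu * lam \<le> norm (G \<sigma> p)" using nu by (simp add: norm_G[OF \<sigma>])
      qed (use Do hstrip_open nu in auto)
      also have "\<dots> \<le> ennreal (lam * L / (nu * lam)\<^sup>2) * vol (D (Suc (Suc n)))"
        using GD Do by (intro mult_left_mono emeasure_mono) auto
      finally show ?thesis .
    qed
    then have "vol (D (Suc n)) \<le> ennreal (lam * L / (nu * lam)\<^sup>2) * vol (D (Suc (Suc n)))
       + ennreal (lam * L / (nu * lam)\<^sup>2) * vol (D (Suc (Suc n)))"
      using Dh[of "Suc n"] by (meson add_mono order_trans)
    also have "\<dots> = (ennreal (lam * L / (nu * lam)\<^sup>2) + ennreal (lam * L / (nu * lam)\<^sup>2)) * vol (D (Suc (Suc n)))"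
      by (simp add: distrib_right)
    also have "ennreal (lam * L / (nu * lam)\<^sup>2) + ennreal (lam * L / (nu * lam)\<^sup>2) = ennreal \<kappa>"
      unfolding \<kappa>_def by (subst ennreal_plus[symmetric]) auto
    finally show ?thesis .
  qed
  have iter: "vol (D (Suc 0)) \<le> ennreal (\<kappa> ^ n) * vol (D (Suc n))" for n
  proof (induction n)
    case (Suc n)
    have "ennreal (\<kappa> ^ n) * vol (D (Suc n)) \<le> ennreal (\<kappa> ^ n) * (ennreal \<kappa> * vol (D (Suc (Suc n))))"
      by (intro mult_left_mono step) auto
    also have "\<dots> = ennreal (\<kappa> ^ Suc n) * vol (D (Suc (Suc n)))"
      using \<kappa> by (simp add: ennreal_mult mult_ac)
    finally show ?case using Suc by simp
  qed simp
  have "vol (D (Suc 0)) \<le> ennreal (\<kappa> ^ n * (2 * C))" for n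
  proof -
    have "vol (D (Suc 0)) \<le> ennreal (\<kappa> ^ n) * ennreal (2 * C)"
      using iter[of n] bound[of n] by (meson mult_left_mono order_trans zero_le)
    then show ?thesis using \<kappa> by (simp add: ennreal_mult')
  qed
  moreover have "(\<lambda>n. ennreal (\<kappa> ^ n * (2 * C))) \<longlonglongrightarrow> ennreal (0 * (2 * C))"
    using \<kappa> by (intro tendsto_ennrealI tendsto_intros LIMSEQ_realpow_zero) auto
  ultimately have "vol (D (Suc 0)) \<le> ennreal (0 * (2 * C))"
    by (intro LIMSEQ_le_const) auto
  then have "D (Suc 0) = {}" using open_emeasure_pos[OF Do] by auto
  then have "ball c r \<inter> (\<Union>k. hstrip k) = {}" unfolding DS D0 by (simp only: image_is_empty)
  then have "ball c r \<subseteq> - (\<Union>k. hstrip k)" by blast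
  then have "ball c r \<in> null_sets lborel" using hstrips_null by (intro null_sets_subset[of _ _ "ball c r"]) simp_all
  then show False using open_emeasure_pos[of "ball c r"] r by auto
qed

section \<open>From an arbitrary open set to the axes\<close>

lemma square_strip:
  fixes i k1 :: int
  assumes k1: "k1 = (i + 1) div 2" and s: "lam * of_int i < s" "s < lam * of_int (i + 1)"
  shows "inside_beam k1 s"
proof -
  have "i = 2 * k1 \<or> i = 2 * k1 - 1" using k1 by linarith
  then have "real_of_int i = 2 * of_int k1 \<or> real_of_int i = 2 * of_int k1 - 1" by linarith
  then have "lam * of_int i = 2 * of_int k1 * lam \<or> lam * of_int i = 2 * of_int k1 * lam - lam"
  proof (elim disjE)
    assume e: "real_of_int i = 2 * of_int k1"
    show ?thesis unfolding e by simp
  next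
    assume e: "real_of_int i = 2 * of_int k1 - 1"
    show ?thesis unfolding e by (simp add: algebra_simps)
  qed
  then have "2 * of_int k1 * lam - lam < s" "s < 2 * of_int k1 * lam + lam"
    using s lam_pos(1) unfolding of_int_add of_int_1 distrib_left mult_1_right by (elim disjE; linarith)+
  then show ?thesis by (simp add: abs_less_iff)
qed

text \<open>Up to the first time at which the ball meets \<open>planes\<close> its images lie in
  open tiles and stay open. The image at that time contains a relatively open piece of one plane,
  which one further step sends to an open piece of a diagonal plane.\<close>

lemma iterates_hit_axes:
  assumes U: "open U" "U \<noteq> {}"
  obtains n x where "x \<in> U" "(F ^^ n) x \<in> axes"
proof -
  obtain c r where cr: "r > 0" "ball c r \<subseteq> U" using U by (meson all_not_in_conv openE)
  define P where "P = (\<lambda>n. \<exists>x\<in>ball c r. (F ^^ n) x \<in> planes)"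
  define n where "n = (LEAST n. P n)"
  have "\<exists>n. P n" using iterates_hit_planes[OF cr(1)] unfolding P_def .
  then have Pn: "P n" and least: "\<And>m. m < n \<Longrightarrow> \<not> P m" unfolding n_def by (auto intro: LeastI_ex dest: not_less_Least)
  define B where "B = (\<lambda>n. (F ^^ n) ` ball c r)"
  have "m \<le> n \<Longrightarrow> open (B m)" for m
  proof (induction m)
    case (Suc m)
    have "connected (B m)" unfolding B_def by (intro connected_continuous_image funpow_F_cont) simp
    moreover have "B m \<noteq> {}" using cr by (auto simp: B_def)
    moreover have "B m \<inter> planes = {}" using least[of m] Suc by (auto simp: B_def P_def)
    ultimately obtain a b where "B m \<subseteq> otile a b" using connected_in_otile by metis
    moreover have "B (Suc m) = F ` B m" by (auto simp: B_def image_image)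
    ultimately show ?case using Suc F_open by simp
  qed (simp add: B_def)
  then have Bo: "open (B n)" by simp
  obtain y where y: "y \<in> B n" "y \<in> planes" using Pn unfolding P_def B_def by blast
  obtain \<tau> and j :: int where \<tau>: "\<tau> \<in> {1, -1}" "fst y + \<tau> * fst (snd y) = 2 * lam * of_int j"
  proof -
    obtain j :: int where "fst y + fst (snd y) = 2 * lam * of_int j \<or> fst y - fst (snd y) = 2 * lam * of_int j"
      using y(2) by (auto simp: planes_def)
    then show thesis using that[of 1 j] that[of "-1" j] by auto
  qed
  \<comment> \<open>A parametrisation of the plane \<open>x1 + \<tau> * x2 = 2 * lam * j\<close>
    that contains \<open>y\<close>.\<close>
  define Q where "Q = (\<lambda>q::real \<times> real. (lam * of_int j + fst q, \<tau> * (lam * of_int j - fst q), snd q))"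
  have Qc: "continuous_on S Q" for S unfolding Q_def by (intro continuous_intros)
  define v0 where "v0 = (fst y - \<tau> * fst (snd y)) / 2"
  have Qy: "Q (v0, ht y) = y"
    using \<tau> by (auto simp: Q_def v0_def prod_eq_iff field_simps)
  define k where "k = \<lfloor>v0 / lam\<rfloor>"
  have "of_int k \<le> v0 / lam" "v0 / lam < of_int k + 1" unfolding k_def by linarith+
  then have k: "lam * of_int k \<le> v0" "v0 < lam * of_int (k + 1)" by (auto simp: field_simps)
  \<comment> \<open>The parameter is restricted between consecutive multiples of \<open>lam\<close>,
    so that the piece stays over the interior of one square.\<close>
  define W where "W = (Q -` B n) \<inter> {q. lam * of_int k < fst q \<and> fst q < lam * of_int (k + 1)}"
  have oQ: "open (Q -` B n)" using Qc Bo by (intro open_vimage) auto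
  have Wo: "open W" unfolding W_def
    by (intro open_Int oQ open_Collect_conj open_Collect_less continuous_intros)
  have "W \<noteq> {}"
  proof -
    have "(v0, ht y) \<in> Q -` B n" using Qy y(1) by simp
    then obtain e where e: "e > 0" "ball (v0, ht y) e \<subseteq> Q -` B n" using oQ openE by blast
    define d where "d = min (e / 2) ((lam * of_int (k + 1) - v0) / 2)"
    have d: "d > 0" "d < e" "v0 + d < lam * of_int (k + 1)" using e k by (auto simp: d_def min_def field_simps)
    have "(v0 + d, ht y) \<in> ball (v0, ht y) e" using d by (simp add: dist_Pair_Pair dist_real_def)
    then have "(v0 + d, ht y) \<in> W" using e k d by (auto simp: W_def)
    then show ?thesis by auto
  qed
  define k1 where "k1 = (j + k + 1) div 2"
  define k3 where "k3 = (j - k) div 2"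
  define k2 where "k2 = (if \<tau> = 1 then k3 else - k3)"
  have sq: "inside_beam k1 (fst (Q q))" "inside_beam k2 (fst (snd (Q q)))" if q: "q \<in> W" for q
  proof -
    have kq: "lam * of_int k < fst q" "fst q < lam * of_int (k + 1)" using q by (auto simp: W_def)
    show "inside_beam k1 (fst (Q q))"
      by (rule square_strip[of _ "j + k"]) (use kq in \<open>auto simp: k1_def Q_def algebra_simps\<close>)
    have "inside_beam k3 (lam * of_int j - fst q)"
      by (rule square_strip[of _ "j - k - 1"]) (use kq in \<open>auto simp: k3_def algebra_simps\<close>)
    then show "inside_beam k2 (fst (snd (Q q)))"
      using \<tau>(1) abs_minus_commute[of "lam * of_int j - fst q" "2 * of_int k3 * lam"] by (auto simp: k2_def Q_def)
  qed
  \<comment> \<open>In the folded coordinates of square \<open>(k1, k2)\<close> the plane becomes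
    the diagonal \<open>y2 = \<sigma> * y1\<close>.\<close>
  define \<sigma> where "\<sigma> = - \<tau> * pm (k1 + k2)"
  have \<sigma>: "\<sigma> \<in> {1, -1}" using \<tau> pm_cases[of "k1 + k2"] by (auto simp: \<sigma>_def)
  have FQ: "fst (snd (F (Q q))) = \<sigma> * fst (F (Q q))" if q: "q \<in> W" for q
  proof -
    define y1 y2 where "y1 = pm k1 * ((fst (Q q) - 2 * of_int k1 * lam) / lam)"
      and "y2 = pm k2 * ((fst (snd (Q q)) - 2 * of_int k2 * lam) / lam)"
    have yb: "\<bar>y1\<bar> < 1" "\<bar>y2\<bar> < 1" using sq[OF q] by (auto simp: y1_def y2_def abs_mult)
    have H: "Hm (fst (Q q)) (fst (snd (Q q))) = reflp (k1 + k2) (hh (y1, y2))"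
      using Hm_square[of "fst (Q q)" k1 "fst (snd (Q q))" k2] sq[OF q] by (simp add: y1_def y2_def)
    \<comment> \<open>Relative to the centre of the square the plane sits at level
      \<open>2 * m\<close>. Interior points satisfy
      \<open>\<bar>y1\<bar> + \<bar>y2\<bar> < 2\<close>, so only the diagonal \<open>m = 0\<close>
      is possible.\<close>
    define m where "m = (if \<tau> = 1 then j - k1 - k2 else j - k1 + k2)"
    have m: "real_of_int m = of_int j - of_int k1 - \<tau> * of_int k2" using \<tau>(1) by (auto simp: m_def)
    have "lam * (pm k1 * y1 + \<tau> * (pm k2 * y2)) = fst (Q q) + \<tau> * fst (snd (Q q)) - 2 * lam * (of_int k1 + \<tau> * of_int k2)"
      using \<tau>(1) by (auto simp: y1_def y2_def algebra_simps add_divide_distrib diff_divide_distrib)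
    also have "\<dots> = lam * (2 * of_int m)" using \<tau>(1) unfolding m by (auto simp: Q_def algebra_simps)
    finally have e: "pm k1 * y1 + \<tau> * (pm k2 * y2) = 2 * of_int m" by simp
    have "\<bar>pm k1 * y1 + \<tau> * (pm k2 * y2)\<bar> \<le> \<bar>pm k1 * y1\<bar> + \<bar>\<tau> * (pm k2 * y2)\<bar>" by (rule abs_triangle_ineq)
    also have "\<dots> = \<bar>y1\<bar> + \<bar>y2\<bar>" using \<tau>(1) by (auto simp: abs_mult)
    finally have "\<bar>2 * real_of_int m\<bar> < 2" using yb unfolding e by linarith
    then have "m = 0" by linarith
    then have "y2 = \<sigma> * y1"
      using e \<tau>(1) pm_cases[of k1] pm_cases[of k2] by (auto simp: \<sigma>_def pm_add)
    then have "fst (hh (y1, y2)) = \<sigma> * fst (snd (hh (y1, y2)))" using diag[OF \<sigma>, of y1] yb by simp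
    then show ?thesis using \<sigma> by (auto simp: F_eq H)
  qed
  \<comment> \<open>\<open>F\<close> on the piece, read in the coordinates of
    \<open>emb \<sigma>\<close>; injectivity and invariance of domain make its image open in the
    plane.\<close>
  define E where "E = (\<lambda>q. (sqrt 2 * fst (F (Q q)), ht (F (Q q))))"
  have Ec: "continuous_on W E" unfolding E_def by (intro continuous_intros Qc)
  have embE: "emb \<sigma> (E q) = F (Q q)" if "q \<in> W" for q
    using FQ[OF that] by (simp add: emb_def E_def prod_eq_iff)
  have "inj_on E W"
  proof (rule inj_onI)
    fix p q assume pq: "p \<in> W" "q \<in> W" "E p = E q"
    then have "F (Q p) = F (Q q)" using embE by metis
    then have "Q p = Q q"
      by (rule F_inj_square[of _ k1 k2, rotated 4]) (use sq[OF pq(1)] sq[OF pq(2)] in auto)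
    then show "p = q" by (simp add: Q_def prod_eq_iff)
  qed
  then have "open (E ` W)" using Ec Wo by (intro invariance_of_domain)
  moreover obtain c' where "c' \<in> E ` W" using \<open>W \<noteq> {}\<close> by blast
  ultimately obtain r' where cr': "r' > 0" "ball c' r' \<subseteq> E ` W" by (rule openE)
  obtain m p where mp: "p \<in> ball c' r'" "emb \<sigma> ((G \<sigma> ^^ m) p) \<in> axes"
    using planar_iterates_hit_axes[OF \<sigma> cr'(1)] by blast
  obtain q where q: "q \<in> W" "p = E q" using mp cr' by auto
  have "Q q \<in> B n" using q by (simp add: W_def)
  then obtain x where x: "x \<in> ball c r" "Q q = (F ^^ n) x" unfolding B_def by blast
  have "emb \<sigma> ((G \<sigma> ^^ m) p) = (F ^^ m) (emb \<sigma> p)" by (rule G_funpow[OF \<sigma>])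
  also have "\<dots> = (F ^^ m) (F ((F ^^ n) x))" using q embE x by simp
  also have "\<dots> = (F ^^ (m + Suc n)) x" by (simp only: funpow_add funpow.simps(2) o_apply)
  finally show thesis using mp x cr by (intro that[of x "m + Suc n"]) auto
qed

end

section \<open>Inverse branches and periodic points\<close>

lemma mult_signs:
  fixes s x y :: real
  assumes "e \<in> {1, -1}" "s \<in> {1, -1}" "sgn x = e * sgn y"
  shows "e * s * x \<ge> 0 \<longleftrightarrow> s * y \<ge> 0"
proof -
  have "sgn (e * s * x) = sgn (s * y)" using assms by (auto simp: sgn_mult)
  then show ?thesis by (metis sgn_less not_le)
qed

context zorich_map begin

section \<open>Closed quadrants as images of closed tiles\<close>

definition quad :: "real \<Rightarrow> real \<Rightarrow> (R3) set" where
  "quad s1 s2 = {p. s1 * (fst p + fst (snd p)) \<ge> 0 \<and> s2 * (fst p - fst (snd p)) \<ge> 0}"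

text \<open>The signs of the closed quadrant onto which the tile \<open>(a, b)\<close> is mapped.\<close>

definition su :: "int \<Rightarrow> int \<Rightarrow> real" where "su a b = etau * (om a b * pm b)"
definition sv :: "int \<Rightarrow> int \<Rightarrow> real" where "sv a b = etav * (om a b * pm a)"

lemma om_cases: "om a b * pm c \<in> {1, -1}"
  using pm_cases[of "a div 2 + b div 2"] pm_cases[of c] by (auto simp: om_def)

text \<open>The origin is omitted because \<open>F\<close> never takes the value 0.\<close>

abbreviation sector :: "int \<Rightarrow> int \<Rightarrow> R3 set" where
  "sector a b \<equiv> quad (su a b) (sv a b) - {0}"

lemma su_sv: "su a b \<in> {1, -1}" "sv a b \<in> {1, -1}"
  using om_cases[of a b b] om_cases[of a b a] etau(1) etav(1) by (auto simp: su_def sv_def)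

lemma quad_hh:
  assumes "(y1, y2) \<in> sqQ" "r > 0"
  shows "r *\<^sub>R reflp j (hh (y1, y2)) \<in> quad (su a b) (sv a b) \<longleftrightarrow>
     om a b * pm b * (y1 + y2) \<ge> 0 \<and> om a b * pm a * (y1 - y2) \<ge> 0"
proof -
  let ?w = "hh (y1, y2)"
  have "s * (r * x) \<ge> 0 \<longleftrightarrow> s * x \<ge> 0" for s x :: real
    using assms(2) by (simp add: zero_le_mult_iff mult_le_0_iff)
  note R = this
  have "r *\<^sub>R reflp j ?w \<in> quad (su a b) (sv a b) \<longleftrightarrow>
      su a b * (fst ?w + fst (snd ?w)) \<ge> 0 \<and> sv a b * (fst ?w - fst (snd ?w)) \<ge> 0"
    using R[of "su a b" "fst ?w + fst (snd ?w)"] R[of "sv a b" "fst ?w - fst (snd ?w)"]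
    by (simp add: quad_def distrib_left right_diff_distrib)
  also have "su a b * (fst ?w + fst (snd ?w)) \<ge> 0 \<longleftrightarrow> om a b * pm b * (y1 + y2) \<ge> 0"
    unfolding su_def using etau(1) om_cases etau(2)[OF assms(1)] by (intro mult_signs) auto
  also have "sv a b * (fst ?w - fst (snd ?w)) \<ge> 0 \<longleftrightarrow> om a b * pm a * (y1 - y2) \<ge> 0"
    unfolding sv_def using etav(1) om_cases etav(2)[OF assms(1)] by (intro mult_signs) auto
  finally show ?thesis .
qed

text \<open>\<open>w1\<close> and \<open>w2\<close> are rotated offsets from the centre of an even
  square, which in these coordinates is the diamond \<open>w\<close>. One even square fills half of
  the tile; any other meets it at most in a vertex, where one offset is 2 in absolute value and the
  diamond forces the other to vanish.\<close>

lemma sign_aux: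
  fixes w1 w2 :: real
  assumes w: "\<bar>w1\<bar> + \<bar>w2\<bar> \<le> 2"
    and 1: "2 * of_int a \<le> 4 * of_int c + w1" "4 * of_int c + w1 \<le> 2 * of_int a + 2"
    and 2: "2 * of_int b \<le> 4 * of_int d + w2" "4 * of_int d + w2 \<le> 2 * of_int b + 2"
  shows "om a b * pm b * (pm (c + d) * w1) \<ge> 0 \<and> om a b * pm a * (pm (c + d) * w2) \<ge> 0"
proof -
  define \<alpha> \<gamma> where "\<alpha> = a div 2" and "\<gamma> = b div 2"
  define i j where "i = c - \<alpha>" and "j = d - \<gamma>"
  have c: "4 * real_of_int c = 4 * of_int \<alpha> + 4 * of_int i" "4 * real_of_int d = 4 * of_int \<gamma> + 4 * of_int j" by (auto simp: i_def j_def)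
  have wb: "\<bar>w1\<bar> \<le> 2" "\<bar>w2\<bar> \<le> 2" using w by linarith+
  have a: "(real_of_int a = 2 * of_int \<alpha> \<and> pm a = 1) \<or> (real_of_int a = 2 * of_int \<alpha> + 1 \<and> pm a = -1)"
  proof -
    have "a = 2 * \<alpha> \<or> a = 2 * \<alpha> + 1" unfolding \<alpha>_def by presburger
    then show ?thesis by (auto simp: pm_def)
  qed
  have b: "(real_of_int b = 2 * of_int \<gamma> \<and> pm b = 1) \<or> (real_of_int b = 2 * of_int \<gamma> + 1 \<and> pm b = -1)"
  proof -
    have "b = 2 * \<gamma> \<or> b = 2 * \<gamma> + 1" unfolding \<gamma>_def by presburger
    then show ?thesis by (auto simp: pm_def)
  qed
  have "-1 < real_of_int i" "real_of_int i < 2" using a 1 wb(1) unfolding c by (elim disjE; linarith)+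
  then have i: "i = 0 \<or> i = 1" by linarith
  have "-1 < real_of_int j" "real_of_int j < 2" using b 2 wb(2) unfolding c by (elim disjE; linarith)+
  then have j: "j = 0 \<or> j = 1" by linarith
  have ij: "(real_of_int i = 0 \<and> pm i = 1) \<or> (real_of_int i = 1 \<and> pm i = -1)"
    "(real_of_int j = 0 \<and> pm j = 1) \<or> (real_of_int j = 1 \<and> pm j = -1)"
    using i j by (auto simp: pm_def)
  have o: "om a b * pm (c + d) = pm i * pm j"
  proof -
    have "c + d = (\<alpha> + \<gamma>) + (i + j)" by (simp add: i_def j_def)
    then have "pm (c + d) = pm (\<alpha> + \<gamma>) * (pm i * pm j)" by (simp add: pm_add)
    then show ?thesis by (simp add: om_def \<alpha>_def \<gamma>_def)
  qed
  have "pm i * pm j * pm b * w1 \<ge> 0 \<and> pm i * pm j * pm a * w2 \<ge> 0"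
    using ij a b 1 2 w unfolding c by (elim disjE conjE; simp; linarith)
  then show ?thesis using o by (simp add: mult_ac)
qed

lemma tile_image:
  assumes x: "base x \<in> tile a b"
  shows "F x \<in> quad (su a b) (sv a b)"
proof -
  define \<beta> where "\<beta> \<longleftrightarrow> ht (Hm (fst x) (fst (snd x))) \<ge> 0"
  obtain k m y1 y2 where r: "(y1, y2) \<in> sqQ" "fst x = lam * (2 * of_int k + pm k * y1)"
    "fst (snd x) = lam * (2 * of_int m + pm m * y2)" "Hm (fst x) (fst (snd x)) = reflp (k + m) (hh (y1, y2))" "even (k + m) = \<beta>"
    using Hm_rep_parity[of \<beta> "fst x" "fst (snd x)"] unfolding \<beta>_def by (metis linear)
  define A B where "A = 2 * real_of_int k + pm k * y1" and "B = 2 * real_of_int m + pm m * y2"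
  have "lam * (2 * of_int a) \<le> lam * (A + B)" "lam * (A + B) \<le> lam * (2 * of_int (a + 1))"
    "lam * (2 * of_int b) \<le> lam * (A - B)" "lam * (A - B) \<le> lam * (2 * of_int (b + 1))"
    using x unfolding tile_def r(2,3) A_def[symmetric] B_def[symmetric] by (auto simp: algebra_simps)
  then have AB: "2 * of_int a \<le> A + B" "A + B \<le> 2 * of_int (a + 1)" "2 * of_int b \<le> A - B" "A - B \<le> 2 * of_int (b + 1)"
    by (simp_all only: mult_le_cancel_left_pos[OF lam_pos(1)])
  have y: "\<bar>y1\<bar> \<le> 1" "\<bar>y2\<bar> \<le> 1" using r(1) by (auto simp: sqQ_def)
  then have yb: "\<bar>y1 + y2\<bar> + \<bar>y1 - y2\<bar> \<le> 2" by linarith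
  have "om a b * pm b * (y1 + y2) \<ge> 0 \<and> om a b * pm a * (y1 - y2) \<ge> 0"
  proof (cases "even (k + m)")
    case True
    then obtain c where c: "k + m = 2 * c" by (elim evenE)
    define d where "d = k - c"
    have km: "k = c + d" "m = c - d" using c by (auto simp: d_def)
    define w1 w2 where "w1 = pm (c + d) * (y1 + y2)" and "w2 = pm (c + d) * (y1 - y2)"
    have p: "pm m = pm (c + d)" by (auto simp: km pm_add pm_diff)
    have e: "A + B = 4 * of_int c + w1" "A - B = 4 * of_int d + w2"
      unfolding A_def B_def p w1_def w2_def by (auto simp: km algebra_simps)
    have "\<bar>w1\<bar> + \<bar>w2\<bar> \<le> 2" using yb by (simp add: w1_def w2_def abs_mult)
    then have "om a b * pm b * (pm (c + d) * w1) \<ge> 0 \<and> om a b * pm a * (pm (c + d) * w2) \<ge> 0"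
      using AB unfolding e by (intro sign_aux) auto
    then show ?thesis by (simp add: w1_def w2_def)
  next
    case False
    then obtain c where c: "k + m = 2 * c + 1" by (elim oddE)
    define d where "d = k - c - 1"
    have km: "k = c + d + 1" "m = c - d" using c by (auto simp: d_def)
    define w1 w2 where "w1 = pm (c + d) * (y1 + y2)" and "w2 = pm (c + d) * (y1 - y2)"
    have p: "pm m = pm (c + d)" "pm k = - pm (c + d)" by (auto simp: km pm_add pm_diff) (auto simp: pm_def)
    have e: "A + B = 4 * of_int c + 2 - w2" "A - B = 4 * of_int d + 2 - w1"
      unfolding A_def B_def p w1_def w2_def by (auto simp: km algebra_simps)
    have "\<bar>- w2\<bar> + \<bar>- w1\<bar> \<le> 2" using yb by (simp add: w1_def w2_def abs_mult)
    then have "om (a - 1) (b - 1) * pm (b - 1) * (pm (c + d) * - w2) \<ge> 0 \<and> om (a - 1) (b - 1) * pm (a - 1) * (pm (c + d) * - w1) \<ge> 0"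
      using AB unfolding e by (intro sign_aux) auto
    moreover have "om (a - 1) (b - 1) = om a b * (pm a * pm b)"
    proof -
      have h: "pm ((n - 1) div 2) = - pm n * pm (n div 2)" for n
      proof -
        have "even n \<Longrightarrow> (n - 1) div 2 = n div 2 - 1" "odd n \<Longrightarrow> (n - 1) div 2 = n div 2" by presburger+
        then show ?thesis by (cases "even n") (auto simp: pm_def)
      qed
      show ?thesis unfolding om_def by (simp add: pm_add h)
    qed
    moreover have "pm (a - 1) = - pm a" "pm (b - 1) = - pm b" by (auto simp: pm_def)
    moreover have "pm (c + d) * w1 = y1 + y2" "pm (c + d) * w2 = y1 - y2" by (auto simp: w1_def w2_def)
    moreover have "om a b * (pm a * pm b) * - pm b * (pm (c + d) * - w2) = om a b * pm a * (pm (c + d) * w2)"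
      "om a b * (pm a * pm b) * - pm a * (pm (c + d) * - w1) = om a b * pm b * (pm (c + d) * w1)"
      using pm_simps(1)[of a] pm_simps(1)[of b] by algebra+
    ultimately show ?thesis by simp
  qed
  then show ?thesis using quad_hh[OF r(1), of "nu * lam * exp (ht x)" "k + m" a b] nu
    by (simp add: F_eq r(4))
qed

section \<open>Continuous sections over sectors\<close>

definition hi :: "R3 \<Rightarrow> real \<times> real" where "hi = inv_into sqQ hh"

lemma hi: "norm w = 1 \<Longrightarrow> ht w \<ge> 0 \<Longrightarrow> hi w \<in> sqQ \<and> hh (hi w) = w"
  unfolding hi_def using onto by (auto simp: upper_hemisphere_def intro!: inv_into_into f_inv_into_f)

lemma hi_cont: "continuous_on upper_hemisphere hi"
proof -
  have "sqQ = cbox (-1, -1) (1, 1)" by (auto simp: sqQ_def cbox_Pair_eq abs_le_iff)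
  then have "compact sqQ" by (metis compact_cbox)
  moreover have "hi (hh y) = y" if "y \<in> sqQ" for y
    unfolding hi_def using that hh_inj by (intro inv_into_f_f inj_onI) auto
  ultimately show ?thesis using continuous_on_inv[OF hh_cont, of hi] onto by simp
qed

lemma reflp_cont [continuous_intros]: "continuous_on S g \<Longrightarrow> continuous_on S (\<lambda>x. reflp j (g x))"
  unfolding reflp_def refl3_def by (cases "even j") (auto intro!: continuous_intros)

text \<open>Over the upper or lower half of a sector the inverse is explicit: the norm determines
  the height, and the direction, reflected to the upper hemisphere, determines the point of the
  square given by \<open>tile_surj\<close>.\<close>

lemma half_section:
  fixes \<beta> :: bool and a b :: int
  shows "\<exists>g k m. even (k + m) = \<beta> \<and>
    continuous_on {p \<in> sector a b. pm (k + m) * ht p \<ge> 0} g \<and>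
    (\<forall>p \<in> sector a b. pm (k + m) * ht p \<ge> 0 \<longrightarrow>
       F (g p) = p \<and> base (g p) \<in> tile a b \<and>
       in_beam k (fst (g p)) \<and> in_beam m (fst (snd (g p))))"
proof -
  define c d where "c = (if \<beta> then (a + 1) div 2 else a div 2)" and "d = (if \<beta> then (b + 1) div 2 else b div 2)"
  define k m where "k = (if \<beta> then c + d else c + d + 1)" and "m = c - d"
  have par: "even (k + m) = \<beta>" by (auto simp: k_def m_def)
  define w where "w = (\<lambda>p. reflp (k + m) ((1 / norm p) *\<^sub>R p))"
  define g where "g = (\<lambda>p. (lam * (2 * of_int k + pm k * fst (hi (w p))), lam * (2 * of_int m + pm m * snd (hi (w p))), ln (norm p / (nu * lam))))"
  let ?S = "{p \<in> sector a b. pm (k + m) * ht p \<ge> 0}"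
  have wh: "w p \<in> upper_hemisphere" if "p \<in> ?S" for p
    using that by (auto simp: w_def upper_hemisphere_def zero_le_mult_iff divide_nonneg_nonneg intro: divide_nonpos_nonneg)
  have "continuous_on ?S w" unfolding w_def by (intro continuous_intros) auto
  then have "continuous_on ?S (\<lambda>p. hi (w p))"
    using wh by (intro continuous_on_compose2[OF hi_cont]) auto
  then have "continuous_on ?S g" unfolding g_def using nu by (intro continuous_intros) auto
  moreover have "F (g p) = p \<and> base (g p) \<in> tile a b \<and>
       in_beam k (fst (g p)) \<and> in_beam m (fst (snd (g p)))" if p: "p \<in> ?S" for p
  proof -
    have np: "norm p > 0" using p by simp
    obtain y1 y2 where y: "hi (w p) = (y1, y2)" by (cases "hi (w p)")
    have q: "(y1, y2) \<in> sqQ" "hh (y1, y2) = w p" using wh[OF p] hi[of "w p"] y by (auto simp: upper_hemisphere_def)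
    have "norm p *\<^sub>R reflp (k + m) (hh (y1, y2)) = p" using np by (simp add: q(2) w_def)
    then have sg: "om a b * pm b * (y1 + y2) \<ge> 0" "om a b * pm a * (y1 - y2) \<ge> 0"
      using quad_hh[OF q(1) np, of "k + m" a b] p by simp_all
    have t: "base (g p) \<in> tile a b"
      unfolding g_def y fst_conv snd_conv k_def m_def c_def d_def by (rule tile_surj(2)[OF q(1) sg])
    have "Hm (fst (g p)) (fst (snd (g p))) = reflp (k + m) (hh (y1, y2))"
      by (rule Hm_param[OF q(1)]) (auto simp: g_def y)
    also have "\<dots> = (1 / norm p) *\<^sub>R p" by (simp add: q(2) w_def)
    finally have "F (g p) = (nu * lam * exp (ln (norm p / (nu * lam)))) *\<^sub>R (1 / norm p) *\<^sub>R p"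
      by (simp add: F_eq g_def)
    also have "\<dots> = p" using np nu by simp
    finally have "F (g p) = p" .
    moreover have "in_beam k (fst (g p))"
    proof -
      have "fst (g p) - 2 * of_int k * lam = lam * (pm k * y1)" by (simp add: g_def y algebra_simps)
      then show ?thesis using q(1) by (simp add: abs_mult sqQ_def)
    qed
    moreover have "in_beam m (fst (snd (g p)))"
    proof -
      have "fst (snd (g p)) - 2 * of_int m * lam = lam * (pm m * y2)" by (simp add: g_def y algebra_simps)
      then show ?thesis using q(1) by (simp add: abs_mult sqQ_def)
    qed
    ultimately show ?thesis using t by simp
  qed
  ultimately show ?thesis using par by blast
qed

text \<open>The two halves agree on height 0 because \<open>F\<close> is injective on the closed
  tile. Points of nonnegative height come from a single beam, which makes \<open>F_est\<close>
  available in \<open>pulled_grow\<close>.\<close>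

lemma tile_section:
  "\<exists>g k m. continuous_on (sector a b) g \<and>
    (\<forall>p \<in> sector a b. F (g p) = p \<and> base (g p) \<in> tile a b) \<and>
    (\<forall>p \<in> sector a b. ht p \<ge> 0 \<longrightarrow>
       in_beam k (fst (g p)) \<and> in_beam m (fst (snd (g p))))"
proof -
  let ?V = "sector a b"
  from half_section[of True a b]
  obtain g1 k m where g1: "even (k + m) = True" "continuous_on {p \<in> ?V. pm (k + m) * ht p \<ge> 0} g1"
    "\<forall>p \<in> ?V. pm (k + m) * ht p \<ge> 0 \<longrightarrow>
       F (g1 p) = p \<and> base (g1 p) \<in> tile a b \<and>
       in_beam k (fst (g1 p)) \<and> in_beam m (fst (snd (g1 p)))"
    by (elim exE conjE) (rule that)
  from half_section[of False a b]
  obtain g2 k' m' where g2: "even (k' + m') = False" "continuous_on {p \<in> ?V. pm (k' + m') * ht p \<ge> 0} g2"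
    "\<forall>p \<in> ?V. pm (k' + m') * ht p \<ge> 0 \<longrightarrow>
       F (g2 p) = p \<and> base (g2 p) \<in> tile a b \<and>
       in_beam k' (fst (g2 p)) \<and> in_beam m' (fst (snd (g2 p)))"
    by (elim exE conjE) (rule that)
  have p: "pm (k + m) = 1" "pm (k' + m') = -1" using g1(1) g2(1) by (auto simp: pm_def)
  have agree: "g2 t = g1 t" if t: "t \<in> ?V" "ht t = 0" for t
  proof -
    have 1: "F (g1 t) = t" "base (g1 t) \<in> tile a b" using bspec[OF g1(3) t(1)] t(2) by simp_all
    have 2: "F (g2 t) = t" "base (g2 t) \<in> tile a b" using bspec[OF g2(3) t(1)] t(2) by simp_all
    show ?thesis by (rule inj_onD[OF F_inj_tile[of a b]]) (simp_all add: 1 2)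
  qed
  define g where "g = (\<lambda>p. if ht p \<le> 0 then g2 p else g1 p)"
  have "continuous_on ?V g" unfolding g_def
  proof (rule continuous_on_cases_le)
    show "continuous_on {t \<in> ?V. ht t \<le> 0} g2" using g2(2) by (simp add: p)
    show "continuous_on {t \<in> ?V. 0 \<le> ht t} g1" using g1(2) by (simp add: p)
    show "continuous_on ?V (\<lambda>p. ht p)" by (intro continuous_intros)
    fix t assume t: "t \<in> ?V" "ht t = 0"
    then show "g2 t = g1 t" by (intro agree) auto
  qed
  moreover have "F (g t) = t \<and> base (g t) \<in> tile a b" if "t \<in> ?V" for t
    using bspec[OF g1(3) that] bspec[OF g2(3) that] by (auto simp: g_def p)
  moreover have "in_beam k (fst (g t)) \<and> in_beam m (fst (snd (g t)))"
    if t: "t \<in> ?V" "ht t \<ge> 0" for t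
  proof (cases "ht t = 0")
    case True
    then have "g2 t = g1 t" using t by (intro agree) auto
    then show ?thesis using bspec[OF g1(3) t(1)] t True by (simp add: g_def p)
  next
    case False
    then show ?thesis using bspec[OF g1(3) t(1)] t by (simp add: g_def p)
  qed
  ultimately show ?thesis by blast
qed

text \<open>Closed quadrants are unions of tiles, since the lines bounding them belong to the tile
  grid.\<close>

lemma tile_in_quad:
  assumes x: "x \<in> quad s1 s2" and s: "s1 \<in> {1, -1}" "s2 \<in> {1, -1}"
  obtains a b where "base x \<in> tile a b"
    "\<And>z. base z \<in> tile a b \<Longrightarrow> z \<in> quad s1 s2"
proof -
  have one: "\<exists>a::int. 2 * lam * of_int a \<le> t \<and> t \<le> 2 * lam * of_int (a + 1) \<and>
      (\<forall>r. 2 * lam * of_int a \<le> r \<and> r \<le> 2 * lam * of_int (a + 1) \<longrightarrow> s * r \<ge> 0)"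
    if "s * t \<ge> 0" "s \<in> {1, -1}" for s t
  proof (cases "s = 1")
    case True
    define a where "a = \<lfloor>t / (2 * lam)\<rfloor>"
    have "of_int a \<le> t / (2 * lam)" "t / (2 * lam) < of_int (a + 1)" unfolding a_def by linarith+
    then have "2 * lam * of_int a \<le> t" "t \<le> 2 * lam * of_int (a + 1)" by (auto simp: field_simps)
    moreover have "2 * lam * of_int a \<ge> 0" using that True by (simp add: a_def)
    ultimately show ?thesis using True by (intro exI[of _ a]) auto
  next
    case False
    then have s: "s = -1" using that by auto
    \<comment> \<open>Ceiling minus one, so that a point on the boundary of the quadrant falls into
      the tile on the negative side.\<close>
    define a where "a = \<lceil>t / (2 * lam)\<rceil> - 1"
    have "of_int a < t / (2 * lam)" "t / (2 * lam) \<le> of_int (a + 1)" unfolding a_def by linarith+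
    then have "2 * lam * of_int a \<le> t" "t \<le> 2 * lam * of_int (a + 1)" by (auto simp: field_simps)
    moreover have "2 * lam * of_int (a + 1) \<le> 0"
    proof -
      have "t \<le> 0" using that s by simp
      then have "a + 1 \<le> 0" unfolding a_def by (simp add: divide_nonpos_pos)
      then have "real_of_int (a + 1) \<le> 0" by linarith
      then show ?thesis by (intro mult_nonneg_nonpos) auto
    qed
    ultimately show ?thesis using s by (intro exI[of _ a]) auto
  qed
  obtain a :: int where a: "2 * lam * of_int a \<le> fst x + fst (snd x)" "fst x + fst (snd x) \<le> 2 * lam * of_int (a + 1)"
    "\<And>r. 2 * lam * of_int a \<le> r \<Longrightarrow> r \<le> 2 * lam * of_int (a + 1) \<Longrightarrow> s1 * r \<ge> 0"
    using one[of s1 "fst x + fst (snd x)"] x s by (auto simp: quad_def)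
  obtain b :: int where b: "2 * lam * of_int b \<le> fst x - fst (snd x)" "fst x - fst (snd x) \<le> 2 * lam * of_int (b + 1)"
    "\<And>r. 2 * lam * of_int b \<le> r \<Longrightarrow> r \<le> 2 * lam * of_int (b + 1) \<Longrightarrow> s2 * r \<ge> 0"
    using one[of s2 "fst x - fst (snd x)"] x s by (auto simp: quad_def)
  show thesis
    by (rule that[of a b]) (use a b in \<open>auto simp: tile_def quad_def\<close>)
qed

text \<open>One-sided inverse branches: restricted to a closed quadrant they exist even at points where
  the iterate is branched.\<close>

definition pulled :: "(R3) set \<Rightarrow> nat \<Rightarrow> real \<Rightarrow> real \<Rightarrow> R3 \<Rightarrow> real \<Rightarrow> bool" where
  "pulled U n s1 s2 x \<epsilon> \<longleftrightarrow> s1 \<in> {1, -1} \<and> s2 \<in> {1, -1} \<and> x \<in> quad s1 s2 \<and> \<epsilon> > 0 \<and>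
     (\<exists>g. continuous_on (quad s1 s2 \<inter> cball x \<epsilon>) g \<and> (\<forall>p \<in> quad s1 s2 \<inter> cball x \<epsilon>. (F ^^ n) (g p) = p \<and> g p \<in> U))"

text \<open>The section over the tile is applied before the given branch. This is possible because
  the whole tile lies in the quadrant on which that branch lives.\<close>

lemma pulled_Suc:
  assumes pl: "pulled U n s1 s2 x \<epsilon>" and t: "base x \<in> tile a b"
    and tq: "\<And>z. base z \<in> tile a b \<Longrightarrow> z \<in> quad s1 s2"
    and \<delta>: "\<delta> > 0" "0 \<notin> cball (F x) \<delta>"
    and h: "continuous_on (sector a b) h"
       "\<And>p. p \<in> sector a b \<Longrightarrow> F (h p) = p \<and> base (h p) \<in> tile a b"
    and near: "\<And>p. p \<in> sector a b \<Longrightarrow> dist p (F x) \<le> \<delta> \<Longrightarrow> dist (h p) x \<le> \<epsilon>"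
  shows "pulled U (Suc n) (su a b) (sv a b) (F x) \<delta>"
proof -
  obtain g where g: "continuous_on (quad s1 s2 \<inter> cball x \<epsilon>) g"
    "\<And>p. p \<in> quad s1 s2 \<inter> cball x \<epsilon> \<Longrightarrow> (F ^^ n) (g p) = p \<and> g p \<in> U"
    using pl unfolding pulled_def by blast
  have hp: "h p \<in> quad s1 s2 \<inter> cball x \<epsilon>" "F (h p) = p" if p: "p \<in> quad (su a b) (sv a b) \<inter> cball (F x) \<delta>" for p
  proof -
    have p': "p \<in> sector a b" using p \<delta>(2) by blast
    have "dist p (F x) \<le> \<delta>" using p by (simp add: dist_commute)
    then show "h p \<in> quad s1 s2 \<inter> cball x \<epsilon>" using near[OF p'] h(2)[OF p'] tq[of "h p"] by (simp add: dist_commute)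
    show "F (h p) = p" using h(2)[OF p'] by simp
  qed
  have "continuous_on (quad (su a b) (sv a b) \<inter> cball (F x) \<delta>) (\<lambda>p. g (h p))"
  proof (rule continuous_on_compose2[OF g(1)])
    show "continuous_on (quad (su a b) (sv a b) \<inter> cball (F x) \<delta>) h"
      by (rule continuous_on_subset[OF h(1)]) (use \<delta>(2) in blast)
  qed (use hp in blast)
  moreover have "(F ^^ Suc n) (g (h p)) = p \<and> g (h p) \<in> U" if "p \<in> quad (su a b) (sv a b) \<inter> cball (F x) \<delta>" for p
    using g(2)[OF hp(1)[OF that]] hp(2)[OF that] by simp
  ultimately show ?thesis
    unfolding pulled_def using su_sv[of a b] tile_image[OF t] \<delta>(1) by blast
qed

text \<open>Branch points on the orbit do no harm: at each step a tile inside the current quadrant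
  is selected, and its section is continuous up to the boundary.\<close>

lemma pulled_exists:
  assumes U: "open U" "x \<in> U"
  shows "\<exists>s1 s2 \<epsilon>. pulled U n s1 s2 ((F ^^ n) x) \<epsilon>"
proof (induction n)
  case 0
  obtain \<epsilon> where \<epsilon>: "\<epsilon> > 0" "cball x \<epsilon> \<subseteq> U" using U open_contains_cball by blast
  have "pulled U 0 (if fst x + fst (snd x) \<ge> 0 then 1 else -1) (if fst x - fst (snd x) \<ge> 0 then 1 else -1) x \<epsilon>"
    unfolding pulled_def using \<epsilon> by (auto simp: quad_def intro!: exI[of _ id])
  then show ?case by auto
next
  case (Suc n)
  define y where "y = (F ^^ n) x"
  obtain s1 s2 \<epsilon> where pl: "pulled U n s1 s2 y \<epsilon>" using Suc y_def by blast
  then have y: "y \<in> quad s1 s2" "s1 \<in> {1, -1}" "s2 \<in> {1, -1}" and \<epsilon>: "\<epsilon> > 0" by (auto simp: pulled_def)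
  obtain a b where t: "base y \<in> tile a b" "\<And>z. base z \<in> tile a b \<Longrightarrow> z \<in> quad s1 s2"
    using tile_in_quad[OF y] by blast
  let ?V = "sector a b"
  from tile_section[of a b]
  obtain h k m where h: "continuous_on ?V h" "\<forall>p \<in> ?V. F (h p) = p \<and> base (h p) \<in> tile a b"
    by (elim exE conjE) (rule that)
  have Fy: "F y \<in> ?V" using tile_image[OF t(1)] by simp
  have hF: "h (F y) = y" by (rule inj_onD[OF F_inj_tile[of a b]]) (use bspec[OF h(2) Fy] t in auto)
  obtain d where d: "d > 0" "\<And>p. p \<in> ?V \<Longrightarrow> dist p (F y) < d \<Longrightarrow> dist (h p) (h (F y)) < \<epsilon>"
    using h(1) Fy \<epsilon> unfolding continuous_on_iff by meson
  \<comment> \<open>Half the norm of \<open>F y\<close> keeps the origin out of the closed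
    ball.\<close>
  define \<delta> where "\<delta> = min (d / 2) (norm (F y) / 2)"
  have nF: "norm (F y) > 0" by simp
  have \<delta>: "\<delta> > 0" "0 \<notin> cball (F y) \<delta>" using d(1) nF by (auto simp: \<delta>_def min_def)
  have "pulled U (Suc n) (su a b) (sv a b) (F y) \<delta>"
  proof (rule pulled_Suc[OF pl t \<delta> h(1) bspec[OF h(2)]])
    fix p assume p: "p \<in> ?V" "dist p (F y) \<le> \<delta>"
    then have "dist p (F y) < d" using d(1) by (auto simp: \<delta>_def)
    then show "dist (h p) y \<le> \<epsilon>" using d(2)[OF p(1)] hF by simp
  qed auto
  then show ?case by (auto simp: y_def)
qed

section \<open>Growth of inverse branches along the axis\<close>

lemma Hm_axis: "Hm (2 * lam * of_int i) (2 * lam * of_int j) = reflp (i + j) (0, 0, 1)"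
  using Hm_param[of 0 0 "2 * lam * of_int i" i "2 * lam * of_int j" j] by (simp add: sqQ_def hh_origin)

lemma F_axis: "F (0, 0, M) = (0, 0, nu * lam * exp M)"
  using Hm_axis[of 0 0] by (simp add: F_eq reflp_def)

lemma F_axes:
  assumes "x \<in> axes" obtains M where "F x = (0, 0, M)"
proof -
  obtain i j where "fst x = 2 * lam * of_int i" "fst (snd x) = 2 * lam * of_int j" using assms by (auto simp: axes_def)
  then have "F x = (nu * lam * exp (ht x)) *\<^sub>R reflp (i + j) (0, 0, 1)"
    by (subst F_eq) (simp only: Hm_axis)
  then show thesis using that by (simp add: prod_eq_iff)
qed

text \<open>The bound \<open>2 * K\<close> keeps the ball above half the height \<open>M'\<close> of
  its centre. There \<open>F_est\<close> gives a contraction by at least 2, because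
  \<open>4 * lam * L \<le> M'\<close>; so the radius may double until it reaches
  \<open>K\<close>.\<close>

lemma pulled_grow:
  assumes pl: "pulled U n s1 s2 (0, 0, M) \<epsilon>" and K: "K > 0"
    and M: "nu * lam * exp M \<ge> 2 * K" "nu * lam * exp M \<ge> 4 * lam * L"
  shows "\<exists>s1 s2. pulled U (Suc n) s1 s2 (0, 0, nu * lam * exp M) (min (2 * \<epsilon>) K)"
proof -
  define x :: R3 where "x = (0, 0, M)"
  define M' where "M' = nu * lam * exp M"
  have Fx: "F x = (0, 0, M')" by (simp add: x_def F_axis M'_def)
  have M': "M' > 0" "M' \<ge> 2 * K" "M' \<ge> 4 * lam * L" using nu M by (auto simp: M'_def)
  have y: "x \<in> quad s1 s2" "s1 \<in> {1, -1}" "s2 \<in> {1, -1}" and \<epsilon>: "\<epsilon> > 0" using pl by (auto simp: pulled_def x_def)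
  obtain a b where t: "base x \<in> tile a b" "\<And>z. base z \<in> tile a b \<Longrightarrow> z \<in> quad s1 s2"
    using tile_in_quad[OF y] by blast
  let ?V = "sector a b"
  from tile_section[of a b]
  obtain h k m where h: "continuous_on ?V h" "\<forall>p \<in> ?V. F (h p) = p \<and> base (h p) \<in> tile a b"
    "\<forall>p \<in> ?V. ht p \<ge> 0 \<longrightarrow>
       in_beam k (fst (h p)) \<and> in_beam m (fst (snd (h p)))"
    by (elim exE conjE) (rule that)
  have Fy: "F x \<in> ?V" using tile_image[OF t(1)] by simp
  have hF: "h (F x) = x" by (rule inj_onD[OF F_inj_tile[of a b]]) (use bspec[OF h(2) Fy] t in auto)
  define \<delta> where "\<delta> = min (2 * \<epsilon>) K"
  have nF: "norm (F x) = M'" using M' by (simp add: Fx norm_triple)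
  have \<delta>: "\<delta> > 0" "0 \<notin> cball (F x) \<delta>" using \<epsilon> K M' nF by (auto simp: \<delta>_def)
  have "pulled U (Suc n) (su a b) (sv a b) (F x) \<delta>"
  proof (rule pulled_Suc[OF pl[folded x_def] t \<delta> h(1) bspec[OF h(2)]])
    fix p assume p: "p \<in> ?V" "dist p (F x) \<le> \<delta>"
    have pK: "dist p (F x) \<le> K" using p by (simp add: \<delta>_def)
    have "\<bar>ht p - M'\<bar> \<le> dist p (F x)"
      using third_le_norm[of "p - F x"] by (simp add: Fx dist_norm)
    then have p3: "ht p \<ge> M' / 2" using pK M' by linarith
    then have np: "norm p \<ge> M' / 2" using third_le_norm[of p] by linarith
    have sq: "in_beam k (fst (h p)) \<and> in_beam m (fst (snd (h p)))"
      "in_beam k (fst x) \<and> in_beam m (fst (snd x))"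
      using bspec[OF h(3) p(1)] bspec[OF h(3) Fy, unfolded hF] p3 M' by (auto simp: Fx)
    have Fh: "F (h p) = p" using bspec[OF h(2) p(1)] by simp
    have est: "((fst (h p) - fst x)\<^sup>2 + (fst (snd (h p)) - fst (snd x))\<^sup>2 + (lam * L * (ht (h p) - ht x))\<^sup>2) *
      (norm (F x) * norm (F (h p))) \<le> (lam * L * dist (F x) (F (h p)))\<^sup>2"
      by (rule F_est) (use sq in auto)
    have "(dist (h p) x)\<^sup>2 \<le> (fst (h p) - fst x)\<^sup>2 + (fst (snd (h p)) - fst (snd x))\<^sup>2 + (lam * L * (ht (h p) - ht x))\<^sup>2"
    proof -
      have "lam * L \<ge> 1 * 1" using lam L by (intro mult_mono) auto
      then have "(lam * L)\<^sup>2 \<ge> 1" by simp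
      then have "(lam * L)\<^sup>2 * (ht (h p) - ht x)\<^sup>2 \<ge> 1 * (ht (h p) - ht x)\<^sup>2"
        by (intro mult_right_mono) auto
      moreover have "(dist (h p) x)\<^sup>2 = (fst (h p) - fst x)\<^sup>2 + (fst (snd (h p)) - fst (snd x))\<^sup>2 + (ht (h p) - ht x)\<^sup>2"
        by (cases "h p"; cases x) (simp add: dist_Pair_Pair dist_real_def)
      ultimately show ?thesis by (simp add: power_mult_distrib)
    qed
    then have "(dist (h p) x)\<^sup>2 * (M' * (M' / 2)) \<le>
      ((fst (h p) - fst x)\<^sup>2 + (fst (snd (h p)) - fst (snd x))\<^sup>2 + (lam * L * (ht (h p) - ht x))\<^sup>2) * (norm (F x) * norm (F (h p)))"
      using np M' by (intro mult_mono) (auto simp: nF Fh)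
    also note est
    also have "(lam * L * dist (F x) (F (h p)))\<^sup>2 \<le> (M' / 4 * \<delta>)\<^sup>2"
      using M'(1,3) p(2) L by (intro power_mono mult_mono) (auto simp: Fh dist_commute)
    finally have "(dist (h p) x)\<^sup>2 * (M' * (M' / 2)) \<le> (\<delta>\<^sup>2 / 8) * (M' * (M' / 2))"
      by (simp add: power_mult_distrib power2_eq_square mult_ac)
    then have "(dist (h p) x)\<^sup>2 \<le> \<delta>\<^sup>2 / 8" using M'(1) by (simp add: mult_le_cancel_right)
    also have "\<dots> \<le> (\<delta> / 2)\<^sup>2" by (simp add: power_divide)
    finally have "dist (h p) x \<le> \<delta> / 2" by (rule power2_le_imp_le) (use \<delta>(1) in auto)
    then show "dist (h p) x \<le> \<epsilon>" by (auto simp: \<delta>_def)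
  qed auto
  then show ?thesis unfolding Fx \<delta>_def M'_def by blast
qed

text \<open>Once the orbit is on the positive axis its height tends to infinity, so both conditions
  of \<open>pulled_grow\<close> hold from some time on and finitely many doublings reach
  \<open>K\<close>.\<close>

lemma pulled_large:
  assumes U: "open U" "U \<noteq> {}" and K: "K > 0"
  shows "\<exists>n M s1 s2. M \<ge> M0 \<and> n \<ge> 1 \<and> pulled U n s1 s2 (0, 0, M) K"
proof -
  obtain n0 x where x: "x \<in> U" "(F ^^ n0) x \<in> axes" using iterates_hit_axes[OF U] by blast
  obtain M1 where M1: "F ((F ^^ n0) x) = (0, 0, M1)" using F_axes[OF x(2)] by blast
  define a where "a = nu * lam"
  have a: "a > 1" using a_gt_1 by (simp add: a_def)
  \<comment> \<open>Heights along the axis from two steps after the hit: the first step reaches the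
    axis, possibly below 0, and the second makes the height positive.\<close>
  define h where "h = rec_nat (a * exp M1) (\<lambda>_ t. a * exp t)"
  have h0: "h 0 = a * exp M1" and hS: "h (Suc j) = a * exp (h j)" for j by (auto simp: h_def)
  have it: "(F ^^ (n0 + 2 + j)) x = (0, 0, h j)" for j
  proof (induction j)
    case 0
    have "(F ^^ (n0 + 2)) x = F (F ((F ^^ n0) x))" by (simp add: numeral_2_eq_2)
    then show ?case by (simp add: M1 F_axis h0 a_def)
  next
    case (Suc j)
    then show ?case by (simp add: F_axis hS a_def)
  qed
  have hj: "h j \<ge> real j" for j
  proof (induction j)
    case 0
    show ?case using a by (simp add: h0)
  next
    case (Suc j)
    have "1 * (1 + h j) \<le> a * exp (h j)" using a Suc exp_ge_add_one_self[of "h j"] by (intro mult_mono) auto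
    then show ?case using Suc by (simp add: hS)
  qed
  obtain J where J: "real J \<ge> max M0 (max (2 * K) (4 * lam * L))" using real_arch_simple by blast
  obtain s1 s2 \<epsilon> where pl: "pulled U (n0 + 2 + J) s1 s2 (0, 0, h J) \<epsilon>"
    using pulled_exists[OF U(1) x(1), of "n0 + 2 + J"] unfolding it by blast
  then have \<epsilon>: "\<epsilon> > 0" by (simp add: pulled_def)
  have sm: "pulled U n s1 s2 x r" if "pulled U n s1 s2 x r'" "0 < r" "r \<le> r'" for n s1 s2 x r r'
  proof -
    have "quad s1 s2 \<inter> cball x r \<subseteq> quad s1 s2 \<inter> cball x r'" using that(3) by auto
    then show ?thesis using that(1,2) unfolding pulled_def by (meson continuous_on_subset subsetD)
  qed
  have grow: "\<exists>s1 s2. pulled U (n0 + 2 + J + i) s1 s2 (0, 0, h (J + i)) (min (2 ^ i * \<epsilon>) K)" for i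
  proof (induction i)
    case 0
    have "pulled U (n0 + 2 + J) s1 s2 (0, 0, h J) (min \<epsilon> K)" by (rule sm[OF pl]) (use \<epsilon> K in auto)
    then show ?case by auto
  next
    case (Suc i)
    then obtain s1 s2 where s: "pulled U (n0 + 2 + J + i) s1 s2 (0, 0, h (J + i)) (min (2 ^ i * \<epsilon>) K)" by blast
    have "real J \<le> nu * lam * exp (h (J + i))" using hj[of "J + Suc i"] by (simp add: hS a_def)
    then have big: "nu * lam * exp (h (J + i)) \<ge> 2 * K" "nu * lam * exp (h (J + i)) \<ge> 4 * lam * L"
      using J by linarith+
    have "min (2 * min (2 ^ i * \<epsilon>) K) K = min (2 ^ Suc i * \<epsilon>) K" using K by (auto simp: min_def)
    then show ?case using pulled_grow[OF s K big] by (simp add: hS a_def)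
  qed
  obtain i where i: "K / \<epsilon> < 2 ^ i" using real_arch_pow[of 2 "K / \<epsilon>"] by auto
  then have "min (2 ^ i * \<epsilon>) K = K" using \<epsilon> by (simp add: field_simps)
  moreover have "h (J + i) \<ge> M0" using hj[of "J + i"] J by simp
  moreover obtain s1 s2 where "pulled U (n0 + 2 + J + i) s1 s2 (0, 0, h (J + i)) (min (2 ^ i * \<epsilon>) K)" using grow by blast
  moreover have "n0 + 2 + J + i \<ge> 1" by simp
  ultimately show ?thesis by metis
qed

section \<open>Returning to the ball in two steps\<close>

lemma far_tile:
  assumes r: "r1 \<in> {1, -1}" "r2 \<in> {1, -1}" and t: "t1 \<in> {1, -1}" "t2 \<in> {1, -1}" and X: "X \<ge> 0"
  obtains a b where "su a b = t1" "sv a b = t2"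
    "\<And>z. base z \<in> tile a b \<Longrightarrow> z \<in> quad r1 r2 \<and>
       X \<le> \<bar>fst z + fst (snd z)\<bar> \<and> \<bar>fst z + fst (snd z)\<bar> \<le> X + 16 * lam \<and> \<bar>fst z - fst (snd z)\<bar> \<le> 8 * lam"
proof -
  define t1' t2' where "t1' = etau * t1" and "t2' = etav * t2"
  have t': "t1' \<in> {1, -1}" "t2' \<in> {1, -1}" "etau * t1' = t1" "etav * t2' = t2"
    using t etau(1) etav(1) by (auto simp: t1'_def t2'_def)
  \<comment> \<open>With \<open>b\<close> divisible by 4, the residue of \<open>a\<close> modulo 4
    alone decides the image quadrant; the four residues realise all four quadrants.\<close>
  define \<rho> :: int where "\<rho> = (if t1' = 1 then (if t2' = 1 then 0 else 1) else (if t2' = 1 then 3 else 2))"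
  define N where "N = \<lceil>X / (8 * lam)\<rceil>"
  have "X / (8 * lam) \<le> of_int N" "of_int N < X / (8 * lam) + 1" unfolding N_def by linarith+
  then have N: "X \<le> 8 * (lam * of_int N)" "8 * (lam * of_int N) < X + 8 * lam" by (auto simp: field_simps)
  \<comment> \<open>Changing \<open>a\<close> by 4 keeps the image quadrant and moves the tile by
    \<open>8 * lam\<close>. The value \<open>- N - 1\<close> is the mirror image of \<open>N\<close>
    for the negative side.\<close>
  define q where "q = (if r1 = 1 then N else - N - 1)"
  define a where "a = 4 * q + \<rho>"
  define b :: int where "b = (if r2 = 1 then 0 else -4)"
  have \<rho>: "0 \<le> \<rho>" "\<rho> \<le> 3" by (auto simp: \<rho>_def)
  have "pm a = pm \<rho>" by (simp add: a_def pm_def)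
  moreover have "a div 2 = 2 * q + \<rho> div 2" by (simp add: a_def)
  then have "pm (a div 2 + b div 2) = pm (\<rho> div 2)" by (simp add: pm_def b_def)
  moreover have "pm b = 1" by (simp add: b_def pm_def)
  ultimately have "om a b * pm b = pm (\<rho> div 2)" "om a b * pm a = pm (\<rho> div 2) * pm \<rho>" by (auto simp: om_def)
  moreover have "pm (\<rho> div 2) = t1'" "pm (\<rho> div 2) * pm \<rho> = t2'" using t'(1,2) by (auto simp: \<rho>_def pm_def)
  ultimately have s: "su a b = t1" "sv a b = t2" using t' by (auto simp: su_def sv_def)
  show thesis
  proof (rule that[OF s])
    fix z :: R3 assume z: "base z \<in> tile a b"
    define u v where "u = fst z + fst (snd z)" and "v = fst z - fst (snd z)"
    have uv: "2 * lam * of_int a \<le> u" "u \<le> 2 * lam * of_int (a + 1)" "2 * lam * of_int b \<le> v" "v \<le> 2 * lam * of_int (b + 1)"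
      using z by (auto simp: tile_def u_def v_def)
    have u1: "8 * (lam * of_int q) \<le> u" "u \<le> 8 * (lam * of_int q) + 8 * lam"
    proof -
      have e: "2 * lam * of_int a = 8 * (lam * of_int q) + 2 * (lam * of_int \<rho>)"
        "2 * lam * of_int (a + 1) = 8 * (lam * of_int q) + 2 * (lam * of_int \<rho>) + 2 * lam"
        by (auto simp: a_def algebra_simps)
      have "lam * of_int \<rho> \<ge> 0" using \<rho> by simp
      moreover have "lam * of_int \<rho> \<le> lam * 3" using \<rho>(2) by (intro mult_left_mono) auto
      ultimately show "8 * (lam * of_int q) \<le> u" "u \<le> 8 * (lam * of_int q) + 8 * lam" using uv unfolding e by linarith+
    qed
    have u2: "r1 * u \<ge> 0 \<and> X \<le> \<bar>u\<bar> \<and> \<bar>u\<bar> \<le> X + 16 * lam"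
    proof (cases "r1 = 1")
      case True
      then have "q = N" by (simp add: q_def)
      then have "X \<le> u" "u \<le> X + 16 * lam" using u1[unfolded \<open>q = N\<close>] N by linarith+
      then show ?thesis using True X by simp
    next
      case False
      then have r: "r1 = -1" "q = - N - 1" using r by (auto simp: q_def)
      have "lam * of_int q = - (lam * of_int N) - lam" by (simp add: r algebra_simps)
      then have "u \<le> - X" "- X - 16 * lam \<le> u" using u1 N by linarith+
      then show ?thesis using r X by simp
    qed
    have v2: "r2 * v \<ge> 0 \<and> \<bar>v\<bar> \<le> 8 * lam"
    proof (cases "r2 = 1")
      case True
      then have "0 \<le> v" "v \<le> 2 * lam" using uv(3,4) by (auto simp: b_def)
      then show ?thesis using True lam_pos(1) by simp
    next
      case False
      then have r: "r2 = -1" "b = -4" using r by (auto simp: b_def)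
      then have "- (8 * lam) \<le> v" "v \<le> - (6 * lam)" using uv(3,4) by auto
      then show ?thesis using r lam_pos(1) by simp
    qed
    show "z \<in> quad r1 r2 \<and> X \<le> \<bar>fst z + fst (snd z)\<bar> \<and> \<bar>fst z + fst (snd z)\<bar> \<le> X + 16 * lam \<and> \<bar>fst z - fst (snd z)\<bar> \<le> 8 * lam"
      using u2 v2 by (simp add: quad_def u_def v_def)
  qed
qed

lemma log_height:
  assumes "F z = p" shows "ht z = ln (norm p / (nu * lam))"
  using assms norm_F[of z] nu by (simp flip: assms)

text \<open>Points at distance about \<open>nu * lam * exp M\<close> from the origin have preimages
  at height about \<open>M\<close>. So \<open>D\<close> is pulled back first to a far tile at that
  distance, in the sector covered by a tile at the axis, and then into this tile. The radius
  \<open>8 * lam + 1\<close> allows for the width of the tile and an error of 1 in height.\<close>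

lemma near_tile_section:
  assumes s: "s1 \<in> {1, -1}" "s2 \<in> {1, -1}" and t: "t1 \<in> {1, -1}" "t2 \<in> {1, -1}"
    and D: "compact D" "D \<subseteq> quad t1 t2" "0 \<notin> D"
  obtains M0 where "\<And>M. M \<ge> M0 \<Longrightarrow> \<exists>g. continuous_on D g \<and>
      (\<forall>p\<in>D. F (F (g p)) = p \<and> g p \<in> quad s1 s2 \<inter> cball (0, 0, M) (8 * lam + 1))"
proof -
  have "compact ((\<lambda>p. ln (norm p / (nu * lam))) ` D)"
    using D nu by (intro compact_continuous_image continuous_intros) auto
  then obtain R where R: "\<And>p. p \<in> D \<Longrightarrow> \<bar>ln (norm p / (nu * lam))\<bar> \<le> R"
    unfolding bounded_iff by (metis (no_types, lifting) bounded_iff compact_imp_bounded imageI real_norm_def)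
  show thesis
  \<comment> \<open>The far tile contributes \<open>16 * lam\<close> and \<open>8 * lam\<close> to
    the norm and the height at most \<open>R\<close>. Norms there lie between \<open>X / 2\<close>
    and \<open>2 * X\<close>, and \<open>exp 1 \<ge> 2\<close> turns this into a height error of at
    most 1.\<close>
  proof (rule that[of "max 0 ((24 * lam + \<bar>R\<bar>) / (nu * lam))"])
    fix M assume M: "M \<ge> max 0 ((24 * lam + \<bar>R\<bar>) / (nu * lam))"
    define X where "X = nu * lam * exp M"
    have X: "X > 0" "X \<ge> 24 * lam + \<bar>R\<bar>"
    proof -
      show "X > 0" using nu by (simp add: X_def)
      have "(24 * lam + \<bar>R\<bar>) / (nu * lam) \<le> exp M" using M exp_ge_add_one_self[of M] by linarith
      then show "X \<ge> 24 * lam + \<bar>R\<bar>" using nu by (simp add: X_def field_simps)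
    qed
    define x :: R3 where "x = (0, 0, M)"
    have xq: "x \<in> quad s1 s2" by (simp add: x_def quad_def)
    obtain a b where t1: "base x \<in> tile a b" "\<And>z. base z \<in> tile a b \<Longrightarrow> z \<in> quad s1 s2"
      using tile_in_quad[OF xq s] by blast
    from tile_section[of a b]
    obtain h1 k m where h1: "continuous_on (sector a b) h1"
      "\<forall>p \<in> sector a b. F (h1 p) = p \<and> base (h1 p) \<in> tile a b"
      "\<forall>p \<in> sector a b. ht p \<ge> 0 \<longrightarrow>
         in_beam k (fst (h1 p)) \<and> in_beam m (fst (snd (h1 p)))"
      by (elim exE conjE) (rule that)
    obtain a' b' where ab': "su a' b' = t1" "sv a' b' = t2"
      "\<And>z. base z \<in> tile a' b' \<Longrightarrow> z \<in> quad (su a b) (sv a b) \<and>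
       X \<le> \<bar>fst z + fst (snd z)\<bar> \<and> \<bar>fst z + fst (snd z)\<bar> \<le> X + 16 * lam \<and> \<bar>fst z - fst (snd z)\<bar> \<le> 8 * lam"
      using far_tile[OF su_sv(1)[of a b] su_sv(2)[of a b] t less_imp_le[OF X(1)]] by blast
    from tile_section[of a' b']
    obtain h2 k' m' where h2: "continuous_on (quad t1 t2 - {0}) h2"
      "\<forall>p \<in> quad t1 t2 - {0}. F (h2 p) = p \<and> base (h2 p) \<in> tile a' b'"
      "\<forall>p \<in> quad t1 t2 - {0}. ht p \<ge> 0 \<longrightarrow>
         in_beam k' (fst (h2 p)) \<and> in_beam m' (fst (snd (h2 p)))"
      unfolding ab'(1,2) by (elim exE conjE) (rule that)
    have Dq: "p \<in> quad t1 t2 - {0}" if "p \<in> D" for p using that D by blast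
    have h2q: "h2 p \<in> sector a b" "exp (M - 1) * (nu * lam) \<le> norm (h2 p)" "norm (h2 p) \<le> exp (M + 1) * (nu * lam)"
      if p: "p \<in> D" for p
    proof -
      obtain p1 p2 p3 where z: "h2 p = (p1, p2, p3)" by (metis prod.exhaust)
      have T: "base (h2 p) \<in> tile a' b'" and Fp: "F (h2 p) = p" using bspec[OF h2(2) Dq[OF p]] by auto
      have uv: "h2 p \<in> quad (su a b) (sv a b)" "X \<le> \<bar>p1 + p2\<bar>" "\<bar>p1 + p2\<bar> \<le> X + 16 * lam" "\<bar>p1 - p2\<bar> \<le> 8 * lam"
        using ab'(3)[OF T] by (auto simp: z)
      have h: "\<bar>p3\<bar> \<le> R" using R[OF p] log_height[OF Fp] by (simp add: z)
      have e2: "exp (1::real) \<ge> 2" using exp_ge_add_one_self[of 1] by simp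
      have n1: "\<bar>p1\<bar> \<le> norm (h2 p)" "\<bar>p2\<bar> \<le> norm (h2 p)"
        unfolding z norm_triple by (auto intro!: real_le_rsqrt)
      have "norm (h2 p) \<le> \<bar>p1\<bar> + (\<bar>p2\<bar> + \<bar>p3\<bar>)"
        using norm_Pair_le[of p1 "(p2, p3)"] norm_Pair_le[of p2 p3] by (simp add: z)
      also have "\<dots> \<le> \<bar>p1 + p2\<bar> + \<bar>p1 - p2\<bar> + \<bar>p3\<bar>" by linarith
      also have "\<dots> \<le> 2 * X" using uv h X by linarith
      also have "\<dots> \<le> exp 1 * X" using e2 X(1) by (intro mult_right_mono) auto
      finally show "norm (h2 p) \<le> exp (M + 1) * (nu * lam)" by (simp add: X_def exp_add mult_ac)
      have "X \<le> 2 * norm (h2 p)" using n1 uv(2) by linarith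
      also have "\<dots> \<le> exp 1 * norm (h2 p)" using e2 by (intro mult_right_mono) auto
      finally show le: "exp (M - 1) * (nu * lam) \<le> norm (h2 p)" by (simp add: X_def exp_diff field_simps)
      have "exp (M - 1) * (nu * lam) > 0" using nu by simp
      then have "h2 p \<noteq> 0" using le by auto
      then show "h2 p \<in> sector a b" using uv(1) by simp
    qed
    define g where "g = (\<lambda>p. h1 (h2 p))"
    have "continuous_on D g" unfolding g_def
    proof (rule continuous_on_compose2[OF h1(1)])
      show "continuous_on D h2" by (rule continuous_on_subset[OF h2(1)]) (use Dq in blast)
      show "h2 ` D \<subseteq> sector a b" by (rule image_subsetI) (rule h2q(1))
    qed
    moreover have "F (F (g p)) = p \<and> g p \<in> quad s1 s2 \<inter> cball (0, 0, M) (8 * lam + 1)" if p: "p \<in> D" for p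
    proof -
      have 1: "F (g p) = h2 p" and T: "base (g p) \<in> tile a b"
        using bspec[OF h1(2) h2q(1)[OF p]] by (auto simp: g_def)
      have 2: "F (h2 p) = p" using bspec[OF h2(2) Dq[OF p]] by simp
      obtain p1 p2 p3 where z: "g p = (p1, p2, p3)" by (metis prod.exhaust)
      have "p3 = ln (norm (h2 p) / (nu * lam))" using log_height[OF 1] by (simp add: z)
      moreover have "ln (exp (M - 1)) \<le> ln (norm (h2 p) / (nu * lam))" "ln (norm (h2 p) / (nu * lam)) \<le> ln (exp (M + 1))"
      proof -
        have le: "exp (M - 1) \<le> norm (h2 p) / (nu * lam)" "norm (h2 p) / (nu * lam) \<le> exp (M + 1)"
          using h2q(2,3)[OF p] nu by (auto simp: field_simps)
        then have "0 < norm (h2 p) / (nu * lam)" using less_le_trans[OF exp_gt_zero] by blast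
        then show "ln (exp (M - 1)) \<le> ln (norm (h2 p) / (nu * lam))" "ln (norm (h2 p) / (nu * lam)) \<le> ln (exp (M + 1))"
          using le by (simp_all only: ln_le_cancel_iff exp_gt_zero)
      qed
      ultimately have p3: "\<bar>p3 - M\<bar> \<le> 1" by simp
      have ux: "2 * lam * of_int a \<le> 0" "0 \<le> 2 * lam * of_int (a + 1)" "2 * lam * of_int b \<le> 0" "0 \<le> 2 * lam * of_int (b + 1)"
        using t1(1) by (auto simp: tile_def x_def)
      have "\<bar>p1 + p2\<bar> \<le> 2 * lam" "\<bar>p1 - p2\<bar> \<le> 2 * lam"
        using T ux by (auto simp: tile_def z algebra_simps abs_le_iff)
      then have "\<bar>p1\<bar> \<le> 4 * lam" "\<bar>p2\<bar> \<le> 4 * lam" using lam_pos(1) by linarith+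
      moreover have "dist (0, 0, M) (g p) \<le> \<bar>p1\<bar> + (\<bar>p2\<bar> + \<bar>p3 - M\<bar>)"
        using norm_Pair_le[of "- p1" "(- p2, M - p3)"] norm_Pair_le[of "- p2" "M - p3"]
        by (simp add: z dist_norm abs_minus_commute)
      ultimately have "dist (0, 0, M) (g p) \<le> 8 * lam + 1" using p3 by linarith
      then show ?thesis using 1 2 t1(2)[OF T] by simp
    qed
    ultimately show "\<exists>g. continuous_on D g \<and>
      (\<forall>p\<in>D. F (F (g p)) = p \<and> g p \<in> quad s1 s2 \<inter> cball (0, 0, M) (8 * lam + 1))" by blast
  qed
qed

lemma periodic_dense:
  assumes S: "open S" "S \<noteq> {}"
  shows "\<exists>x\<in>S. periodic_point F x"
proof -
  \<comment> \<open>A point off the two planes allows a ball inside one open quadrant, hence inside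
    the image of a single tile and away from 0.\<close>
  have "\<not> S \<subseteq> {x. inner (1, 1, 0) x = 0} \<union> {x. inner (1, -1, 0) x = 0}"
  proof
    assume sub: "S \<subseteq> {x. inner (1, 1, 0) x = 0} \<union> {x. inner (1, -1, 0) x = 0}"
    have "{x :: R3. inner (1, 1, 0) x = 0} \<union> {x. inner (1, -1, 0) x = 0} \<in> null_sets lborel"
      by (intro null_sets.Un hyperplane_null) (auto simp: zero_prod_def)
    then have "S \<in> null_sets lborel" using sub S(1) by (intro null_sets_subset[OF _ _ sub]) auto
    then show False using open_emeasure_pos[OF S] by auto
  qed
  then obtain c where c0: "c \<in> S" "fst c + fst (snd c) \<noteq> 0" "fst c - fst (snd c) \<noteq> 0"
    by (auto simp: inner_prod_def)
  define t1 t2 where "t1 = sgn (fst c + fst (snd c))" and "t2 = sgn (fst c - fst (snd c))"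
  have t12: "t1 \<in> {1, -1}" "t2 \<in> {1, -1}" using c0 by (auto simp: t1_def t2_def sgn_if)
  define S' where "S' = S \<inter> {x. 0 < t1 * (fst x + fst (snd x)) \<and> 0 < t2 * (fst x - fst (snd x))}"
  have "open S'" unfolding S'_def using S(1)
    by (intro open_Int open_Collect_conj open_Collect_less continuous_intros)
  moreover have "c \<in> S'" using c0 by (simp add: S'_def t1_def t2_def sgn_if)
  ultimately obtain r where r: "r > 0" "cball c r \<subseteq> S'" by (meson open_contains_cball)
  have t3: "cball c r \<subseteq> quad t1 t2" 
  proof
    fix x assume "x \<in> cball c r"
    then have "x \<in> S'" using r(2) by blast
    then show "x \<in> quad t1 t2" unfolding S'_def quad_def by (simp add: less_imp_le)
  qed
  have "0 \<notin> S'" by (simp add: S'_def)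
  then have c: "r > 0" "cball c r \<subseteq> S" "0 \<notin> cball c r" using r unfolding S'_def by blast+
  note t = t12 t3
  have "\<exists>M0. \<forall>M\<ge>M0. \<exists>g. continuous_on (cball c r) g \<and>
      (\<forall>p\<in>cball c r. F (F (g p)) = p \<and> g p \<in> quad s1 s2 \<inter> cball (0, 0, M) (8 * lam + 1))"
    if "s1 \<in> {1, -1}" "s2 \<in> {1, -1}" for s1 s2
    using near_tile_section[OF that t(1,2) compact_cball t(3) c(3)] by metis
  then obtain m where m: "\<And>s1 s2 M. s1 \<in> {1, -1} \<Longrightarrow> s2 \<in> {1, -1} \<Longrightarrow> M \<ge> m s1 s2 \<Longrightarrow> \<exists>g. continuous_on (cball c r) g \<and>
      (\<forall>p\<in>cball c r. F (F (g p)) = p \<and> g p \<in> quad s1 s2 \<inter> cball (0, 0, M) (8 * lam + 1))"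
    by metis
  \<comment> \<open>The quadrant supplied by \<open>pulled_large\<close> is not known beforehand, so
    the height has to work for all four.\<close>
  define M0 where "M0 = max (max (m 1 1) (m 1 (-1))) (max (m (-1) 1) (m (-1) (-1)))"
  have K: "8 * lam + 1 > 0" using lam_pos(1) by linarith
  have "ball c r \<noteq> {}" using c(1) by simp
  then obtain n M s1 s2 where n: "M \<ge> M0" "n \<ge> 1" "pulled (ball c r) n s1 s2 (0, 0, M) (8 * lam + 1)"
    using pulled_large[OF open_ball _ K, of c r M0] by blast
  then have s: "s1 \<in> {1, -1}" "s2 \<in> {1, -1}" by (auto simp: pulled_def)
  then have "M \<ge> m s1 s2" using n(1) by (auto simp: M0_def)
  then obtain g where g: "continuous_on (cball c r) g"
      "\<And>p. p \<in> cball c r \<Longrightarrow> F (F (g p)) = p \<and> g p \<in> quad s1 s2 \<inter> cball (0, 0, M) (8 * lam + 1)"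
    using m[OF s] by blast
  obtain f where f: "continuous_on (quad s1 s2 \<inter> cball (0, 0, M) (8 * lam + 1)) f"
     "\<And>p. p \<in> quad s1 s2 \<inter> cball (0, 0, M) (8 * lam + 1) \<Longrightarrow> (F ^^ n) (f p) = p \<and> f p \<in> ball c r"
    using n(3) unfolding pulled_def by blast
  have cont: "continuous_on (cball c r) (\<lambda>p. f (g p))"
    by (rule continuous_on_compose2[OF f(1) g(1)]) (use g(2) in blast)
  have fb: "f (g p) \<in> ball c r" if "p \<in> cball c r" for p using f(2) g(2)[OF that] by blast
  have inv: "(F ^^ (2 + n)) (f (g p)) = p" if "p \<in> cball c r" for p
  proof -
    have "(F ^^ n) (f (g p)) = g p" using f(2) g(2)[OF that] by blast
    then have "(F ^^ (2 + n)) (f (g p)) = F (F (g p))" by (simp add: numeral_2_eq_2)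
    then show ?thesis using g(2)[OF that] by simp
  qed
  \<comment> \<open>Brouwer is applied to the composed inverse branch, which maps the ball into
    itself; its fixed point is fixed by the iterate of order \<open>2 + n\<close>.\<close>
  obtain p where p: "p \<in> cball c r" "f (g p) = p"
    using brouwer_ball[OF c(1) cont] fb ball_subset_cball by blast
  then have "(F ^^ (2 + n)) p = p" using inv[OF p(1)] by simp
  then have "periodic_point F p" unfolding periodic_point_def by (intro exI[of _ "2 + n"]) auto
  then show ?thesis using p(1) c(2) by blast
qed

end

theorem theorem1p2:
  fixes hh :: "(real \<times> real) \<Rightarrow> (real \<times> real \<times> real)"
    and L lam nu :: real
  assumes L: "L \<ge> 1"
    and bilip: "bi_lipschitz_on L sqQ hh"
    and sense: "sense_preserving_hemi hh"
    and onto: "hh ` sqQ = upper_hemisphere"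
    and bdry: "hh ` frontier sqQ = equator"
    and diag1: "\<And>t. t \<in> {-1..1} \<Longrightarrow> fst (hh (t, t)) = fst (snd (hh (t, t)))"
    and diag2: "\<And>t. t \<in> {-1..1} \<Longrightarrow> fst (hh (t, -t)) = - fst (snd (hh (t, -t)))"
    and lam: "lam \<ge> 1" "lam > L ^ 5"
    and nu: "nu > 0" "nu > sqrt (2 * L / lam)"
  shows "closure {x. periodic_point (zorich hh lam nu) x} = UNIV"
proof -
  interpret zorich_map hh L lam nu
    using assms by unfold_locales
  have "x \<in> closure {x. periodic_point F x}" for x
  proof (rule ccontr)
    assume "x \<notin> closure {x. periodic_point F x}"
    then have "- closure {x. periodic_point F x} \<noteq> {}" by blast
    moreover have "open (- closure {x. periodic_point F x})" by (intro open_Compl closed_closure)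
    ultimately obtain y where "y \<in> - closure {x. periodic_point F x}" "periodic_point F y"
      using periodic_dense by blast
    then show False using closure_subset[of "{x. periodic_point F x}"] by blast
  qed
  then show ?thesis by blast
qed

end
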